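(* Given a line graph $G$ on $n$ vertices, a proper colouring of $G$ using at most $\gamma_l(G)=\max_{v\in V(G)}\lceil\frac12(d(v)+1+\omega(v))\rceil$ colours can be found in $O(n^2)$ time.
   Context: A graph $G'$ is a line graph if there is a finite multigraph $H$ such that $G'$ is isomorphic to $L(H)$, the graph whose vertices are the edges of $H$, two being adjacent iff they share an endpoint. $d(v)$ is the degree of $v$ and $\omega(v)$ is the size of the largest clique containing $v$. *)

theory Defs
  imports Complex_Main "HOL-Library.Landau_Symbols"
begin

section \<open>Graphs, multigraphs and line graphs\<close>

record 'a graph =
  verts :: "'a set"
  adj :: "'a \<Rightarrow> 'a \<Rightarrow> bool"

definition simple_graph :: "'a graph \<Rightarrow> bool" where
  "simple_graph G \<longleftrightarrow> finite (verts G) \<and>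
     (\<forall>u v. adj G u v \<longrightarrow> u \<in> verts G \<and> v \<in> verts G \<and> u \<noteq> v \<and> adj G v u)"

definition isomorphic :: "'a graph \<Rightarrow> 'b graph \<Rightarrow> bool" where
  "isomorphic G G' \<longleftrightarrow> (\<exists>f. bij_betw f (verts G) (verts G') \<and>
     (\<forall>u\<in>verts G. \<forall>v\<in>verts G. adj G u v \<longleftrightarrow> adj G' (f u) (f v)))"

record ('v, 'e) multigraph =
  mverts :: "'v set"
  medges :: "'e set"
  ends :: "'e \<Rightarrow> 'v set"

text \<open>Parallel edges are distinct edges with the same set of ends. Loops are excluded; since a loop
  could be replaced by an edge to a new vertex, admitting them would not yield more line graphs.\<close>

definition finite_multigraph :: "('v, 'e) multigraph \<Rightarrow> bool" where
  "finite_multigraph H \<longleftrightarrow> finite (mverts H) \<and> finite (medges H) \<and>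
     (\<forall>e\<in>medges H. ends H e \<subseteq> mverts H \<and> card (ends H e) = 2)"

definition line_graph_of :: "('v, 'e) multigraph \<Rightarrow> 'e graph" where
  "line_graph_of H = \<lparr> verts = medges H,
     adj = (\<lambda>e f. e \<in> medges H \<and> f \<in> medges H \<and> e \<noteq> f \<and> ends H e \<inter> ends H f \<noteq> {}) \<rparr>"

text \<open>As the multigraph is finite, its vertices and edges may be taken to be natural numbers.\<close>

definition line_graph :: "'a graph \<Rightarrow> bool" where
  "line_graph G \<longleftrightarrow> simple_graph G \<and>
     (\<exists>H :: (nat, nat) multigraph. finite_multigraph H \<and> isomorphic G (line_graph_of H))"

definition degree :: "'a graph \<Rightarrow> 'a \<Rightarrow> nat" where
  "degree G v = card {u \<in> verts G. adj G v u}"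

definition clique :: "'a graph \<Rightarrow> 'a set \<Rightarrow> bool" where
  "clique G K \<longleftrightarrow> K \<subseteq> verts G \<and> (\<forall>u\<in>K. \<forall>v\<in>K. u \<noteq> v \<longrightarrow> adj G u v)"

definition omega :: "'a graph \<Rightarrow> 'a \<Rightarrow> nat" where
  "omega G v = Max {card K | K. clique G K \<and> v \<in> K}"

text \<open>On a finite nonempty set of naturals the supremum is the maximum; for the graph without
  vertices it is 0.\<close>

definition gamma_l :: "'a graph \<Rightarrow> nat" where
  "gamma_l G = (SUP v\<in>verts G. nat \<lceil>(1 / 2 :: real) * (real (degree G v) + 1 + real (omega G v))\<rceil>)"

definition proper_colouring :: "'a graph \<Rightarrow> ('a \<Rightarrow> 'c) \<Rightarrow> bool" where
  "proper_colouring G c \<longleftrightarrow> (\<forall>u\<in>verts G. \<forall>v\<in>verts G. adj G u v \<longrightarrow> c u \<noteq> c v)"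


section \<open>A word RAM\<close>

text \<open>Running time is measured on a unit-cost random access machine, presented as a structured
  language over finitely many (those named in the program) scalar registers and arrays of natural
  numbers. Each node of an expression evaluated and each command executed costs one step.
  To keep unit cost realistic, a run is legal only if every value and every array index it computes
  is below a bound \<open>W\<close>; there is no transition otherwise.\<close>

datatype aexp =
    Const nat
  | Var nat
  | Read nat aexp
  | Plus aexp aexp
  | Minus aexp aexp
  | Times aexp aexp

datatype bexp =
    Less aexp aexp
  | Equal aexp aexp
  | Not bexp
  | And bexp bexp

datatype com =
    Skip
  | Assign nat aexp
  | Store nat aexp aexp
  | Seq com com
  | If bexp com com
  | While bexp com

record state =
  regs :: "nat \<Rightarrow> nat"
  arrs :: "nat \<Rightarrow> nat \<Rightarrow> nat"

text \<open>\<open>Minus\<close> is truncated subtraction.\<close>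

fun aval :: "aexp \<Rightarrow> state \<Rightarrow> nat" where
  "aval (Const k) s = k"
| "aval (Var x) s = regs s x"
| "aval (Read a e) s = arrs s a (aval e s)"
| "aval (Plus e f) s = aval e s + aval f s"
| "aval (Minus e f) s = aval e s - aval f s"
| "aval (Times e f) s = aval e s * aval f s"

fun bval :: "bexp \<Rightarrow> state \<Rightarrow> bool" where
  "bval (Less e f) s \<longleftrightarrow> aval e s < aval f s"
| "bval (Equal e f) s \<longleftrightarrow> aval e s = aval f s"
| "bval (Not b) s \<longleftrightarrow> \<not> bval b s"
| "bval (And b b') s \<longleftrightarrow> bval b s \<and> bval b' s"

fun acost :: "aexp \<Rightarrow> nat" where
  "acost (Const k) = 1"
| "acost (Var x) = 1"
| "acost (Read a e) = 1 + acost e"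
| "acost (Plus e f) = 1 + acost e + acost f"
| "acost (Minus e f) = 1 + acost e + acost f"
| "acost (Times e f) = 1 + acost e + acost f"

fun bcost :: "bexp \<Rightarrow> nat" where
  "bcost (Less e f) = 1 + acost e + acost f"
| "bcost (Equal e f) = 1 + acost e + acost f"
| "bcost (Not b) = 1 + bcost b"
| "bcost (And b b') = 1 + bcost b + bcost b'"

fun afits :: "nat \<Rightarrow> aexp \<Rightarrow> state \<Rightarrow> bool" where
  "afits W (Const k) s \<longleftrightarrow> k < W"
| "afits W (Var x) s \<longleftrightarrow> regs s x < W"
| "afits W (Read a e) s \<longleftrightarrow> afits W e s \<and> aval (Read a e) s < W"
| "afits W (Plus e f) s \<longleftrightarrow> afits W e s \<and> afits W f s \<and> aval (Plus e f) s < W"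
| "afits W (Minus e f) s \<longleftrightarrow> afits W e s \<and> afits W f s"
| "afits W (Times e f) s \<longleftrightarrow> afits W e s \<and> afits W f s \<and> aval (Times e f) s < W"

fun bfits :: "nat \<Rightarrow> bexp \<Rightarrow> state \<Rightarrow> bool" where
  "bfits W (Less e f) s \<longleftrightarrow> afits W e s \<and> afits W f s"
| "bfits W (Equal e f) s \<longleftrightarrow> afits W e s \<and> afits W f s"
| "bfits W (Not b) s \<longleftrightarrow> bfits W b s"
| "bfits W (And b b') s \<longleftrightarrow> bfits W b s \<and> bfits W b' s"

text \<open>\<open>exec W c s t s'\<close>: started in \<open>s\<close>, the program \<open>c\<close> halts in \<open>s'\<close> after exactly \<open>t\<close> steps,
  having computed only values below \<open>W\<close>.\<close>

inductive exec :: "nat \<Rightarrow> com \<Rightarrow> state \<Rightarrow> nat \<Rightarrow> state \<Rightarrow> bool" for W where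
  Skip: "exec W Skip s 1 s"
| Assign: "afits W e s \<Longrightarrow>
    exec W (Assign x e) s (1 + acost e) (s\<lparr>regs := (regs s)(x := aval e s)\<rparr>)"
| Store: "afits W i s \<Longrightarrow> afits W e s \<Longrightarrow>
    exec W (Store a i e) s (1 + acost i + acost e)
      (s\<lparr>arrs := (arrs s)(a := (arrs s a)(aval i s := aval e s))\<rparr>)"
| Seq: "exec W c s t s' \<Longrightarrow> exec W c' s' t' s'' \<Longrightarrow> exec W (Seq c c') s (1 + t + t') s''"
| IfTrue: "bfits W b s \<Longrightarrow> bval b s \<Longrightarrow> exec W c s t s' \<Longrightarrow>
    exec W (If b c c') s (1 + bcost b + t) s'"
| IfFalse: "bfits W b s \<Longrightarrow> \<not> bval b s \<Longrightarrow> exec W c' s t s' \<Longrightarrow>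
    exec W (If b c c') s (1 + bcost b + t) s'"
| WhileFalse: "bfits W b s \<Longrightarrow> \<not> bval b s \<Longrightarrow> exec W (While b c) s (1 + bcost b) s"
| WhileTrue: "bfits W b s \<Longrightarrow> bval b s \<Longrightarrow> exec W c s t s' \<Longrightarrow> exec W (While b c) s' t' s'' \<Longrightarrow>
    exec W (While b c) s (1 + bcost b + t + t') s''"

text \<open>A graph with vertices \<open>0, \<dots>, n - 1\<close> is given by \<open>n\<close> in register 0 and its adjacency
  matrix, row by row, in array 0; everything else is 0. Within quadratic time this is
  interchangeable with adjacency lists. The colour of vertex \<open>v\<close> is returned in cell \<open>v\<close> of
  array 1.\<close>

definition input_state :: "nat \<Rightarrow> nat graph \<Rightarrow> state" where
  "input_state n G =
     \<lparr> regs = (\<lambda>x. if x = 0 then n else 0),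
       arrs = (\<lambda>a i. if a = 0 \<and> i < n * n \<and> adj G (i div n) (i mod n) then 1 else 0) \<rparr>"

definition output_colouring :: "state \<Rightarrow> nat \<Rightarrow> nat" where
  "output_colouring s = arrs s 1"

end

theory Submission
  imports Defs
begin

text \<open>
  Write \<open>G\<close> as the line graph of a multigraph \<open>H\<close>; the edges of \<open>H\<close> are coloured one at a time.
  Let \<open>E = XY\<close> be the next edge and let \<open>k\<close> colours be in use. A fan at \<open>X\<close> consists of \<open>Y\<close> and
  neighbours \<open>V\<close> of \<open>X\<close> joined to \<open>X\<close> by an edge whose colour is missing at an earlier fan vertex. If
  some colour is missing at two of the vertices \<open>X\<close>, \<open>Y\<close>, \<open>V\<close>, \<open>V'\<close> of a fan, then a Kempe change at
  \<open>X\<close> followed by a shift along the fan frees a colour for \<open>E\<close>. Otherwise counting missing colours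
  against \<open>2k \<ge> 2d(u) + d(v) - \<mu>(uv)\<close> excludes fans with three vertices besides \<open>X\<close>, so the maximal
  fans at \<open>X\<close> and at \<open>Y\<close> are \<open>Y, V\<close> and \<open>X, W\<close>. If \<open>V = W\<close> the triangle \<open>XYV\<close> violates the clique
  bound; if \<open>V \<noteq> W\<close>, either a colour missing at both gives an explicit recolouring, or counting the
  edges \<open>XY\<close> again gives a contradiction. So a failed attempt proves that \<open>k\<close> is below the bound, and a
  new colour may be used for \<open>E\<close>; the bound itself is never computed.

  To find \<open>H\<close>, keep one vertex of \<open>G\<close> from each class of twins. What is left is the line graph of a
  simple graph. Once the star of one end of an edge \<open>F\<close> is known, the star of the other end is \<open>F\<close> and
  its neighbours outside the first star. A first star comes from a triangle \<open>F, P, Q\<close>: if some vertex is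
  adjacent to one or three of its members, it is part of a star, and otherwise there is a root in
  which it is a triangle.
\<close>

section \<open>Counting loop iterations\<close>

text \<open>Quadratic time leaves O(n) for each edge, and this shapes every stage. No fan ever has
  to grow beyond three vertices besides its centre, so a fan fits into a fixed set of registers,
  each colour is tested against it in constant time through a table indexed by vertex and colour,
  and an insertion takes a bounded number of scans over the colours and at most one Kempe chain.
  Comparing neighbourhoods pairwise would be cubic, so twins are found with a trie. A root has few
  enough unnamed ends, two for each edge, that each star may be collected by a scan over all edges.

  The root found need not be \<open>H\<close>: twins need not be parallel in \<open>H\<close>, and a
  triangle of \<open>G\<close> can come from a star or from a triangle. This is harmless because the
  bound is a function of \<open>G\<close> alone, and its consequences for degrees and triangles hold
  in every root. The degree inequality stems from d(e) + 1 = d(u) + d(v) - \<mu>(uv) for an edge e =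
  uv, together with the clique formed by the star of u.\<close>

text \<open>Only loop iterations are counted and there is no bound on the values: the actual cost is at most a
  constant times one more than this count (\<open>ex_exec\<close>), and values stay polynomial in programs that
  only ever store a register, an array cell or a constant, up to adding a constant (\<open>tame\<close>).\<close>

inductive ex :: "com \<Rightarrow> state \<Rightarrow> nat \<Rightarrow> state \<Rightarrow> bool" where
  Skip: "ex Skip s 0 s"
| Assign: "ex (Assign x e) s 0 (s\<lparr>regs := (regs s)(x := aval e s)\<rparr>)"
| Store: "ex (Store a i e) s 0 (s\<lparr>arrs := (arrs s)(a := (arrs s a)(aval i s := aval e s))\<rparr>)"
| Seq: "ex c s t s' \<Longrightarrow> ex c' s' t' s'' \<Longrightarrow> ex (Seq c c') s (t + t') s''"
| IfTrue: "bval b s \<Longrightarrow> ex c s t s' \<Longrightarrow> ex (If b c c') s t s'"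
| IfFalse: "\<not> bval b s \<Longrightarrow> ex c' s t s' \<Longrightarrow> ex (If b c c') s t s'"
| WhileFalse: "\<not> bval b s \<Longrightarrow> ex (While b c) s 0 s"
| WhileTrue: "bval b s \<Longrightarrow> ex c s t s' \<Longrightarrow> ex (While b c) s' t' s'' \<Longrightarrow>
    ex (While b c) s (1 + t + t') s''"

definition bounded_state :: "nat \<Rightarrow> state \<Rightarrow> bool" where
  "bounded_state V s \<longleftrightarrow> (\<forall>x. regs s x \<le> V) \<and> (\<forall>a i. arrs s a i \<le> V)"

lemma bounded_state_mono: "bounded_state V s \<Longrightarrow> V \<le> V' \<Longrightarrow> bounded_state V' s"
  unfolding bounded_state_def by (meson le_trans)

fun tame_exp :: "aexp \<Rightarrow> bool" where
  "tame_exp (Const k) = True"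
| "tame_exp (Var x) = True"
| "tame_exp (Read a e) = True"
| "tame_exp (Plus e f) = (tame_exp e \<and> (case f of Const k \<Rightarrow> True | _ \<Rightarrow> False))"
| "tame_exp (Minus e f) = tame_exp e"
| "tame_exp (Times e f) = False"

fun increment :: "aexp \<Rightarrow> nat" where
  "increment (Const k) = k"
| "increment (Plus e f) = increment e + increment f"
| "increment (Minus e f) = increment e"
| "increment _ = 0"

lemma aval_le_increment: "tame_exp e \<Longrightarrow> bounded_state V s \<Longrightarrow> aval e s \<le> V + increment e"
proof (induction e)
  case (Plus e f)
  then show ?case by (cases f) auto
next
  case (Minus e f)
  then show ?case by (simp add: le_diff_conv trans_le_add1)
qed (auto simp: bounded_state_def)

fun tame :: "com \<Rightarrow> bool" where
  "tame Skip = True"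
| "tame (Assign x e) = tame_exp e"
| "tame (Store a i e) = tame_exp e"
| "tame (Seq c d) = (tame c \<and> tame d)"
| "tame (If b c d) = (tame c \<and> tame d)"
| "tame (While b c) = tame c"

fun growth :: "com \<Rightarrow> nat" where
  "growth Skip = 0"
| "growth (Assign x e) = increment e"
| "growth (Store a i e) = increment e"
| "growth (Seq c d) = growth c + growth d"
| "growth (If b c d) = growth c + growth d"
| "growth (While b c) = growth c"

fun com_cost :: "com \<Rightarrow> nat" where
  "com_cost Skip = 1"
| "com_cost (Assign x e) = 1 + acost e"
| "com_cost (Store a i e) = 1 + acost i + acost e"
| "com_cost (Seq c d) = 1 + com_cost c + com_cost d"
| "com_cost (If b c d) = 1 + bcost b + com_cost c + com_cost d"
| "com_cost (While b c) = 1 + bcost b + com_cost c"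

text \<open>Bounds all intermediate values of an evaluation, not only its result. Hence the extra
  summands: a product with a factor 0 must still account for the other factor, a difference for both
  operands, a \<open>Read\<close> for its index.\<close>

fun amax :: "aexp \<Rightarrow> nat \<Rightarrow> nat" where
  "amax (Const k) = (\<lambda>M. k)"
| "amax (Var x) = (\<lambda>M. M)"
| "amax (Read a e) = (\<lambda>M. M + amax e M)"
| "amax (Plus e f) = (\<lambda>M. amax e M + amax f M)"
| "amax (Minus e f) = (\<lambda>M. amax e M + amax f M)"
| "amax (Times e f) = (\<lambda>M. amax e M * amax f M + amax e M + amax f M)"

fun bmax :: "bexp \<Rightarrow> nat \<Rightarrow> nat" where
  "bmax (Less e f) = (\<lambda>M. amax e M + amax f M)"
| "bmax (Equal e f) = (\<lambda>M. amax e M + amax f M)"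
| "bmax (Not b) = bmax b"
| "bmax (And b c) = (\<lambda>M. bmax b M + bmax c M)"

fun cmax :: "com \<Rightarrow> nat \<Rightarrow> nat" where
  "cmax Skip = (\<lambda>M. 0)"
| "cmax (Assign x e) = amax e"
| "cmax (Store a i e) = (\<lambda>M. amax i M + amax e M)"
| "cmax (Seq c d) = (\<lambda>M. cmax c M + cmax d M)"
| "cmax (If b c d) = (\<lambda>M. bmax b M + cmax c M + cmax d M)"
| "cmax (While b c) = (\<lambda>M. bmax b M + cmax c M)"

lemma aval_le_amax: "bounded_state M s \<Longrightarrow> aval e s \<le> amax e M"
proof (induction e)
  case (Times e f)
  then have "aval e s * aval f s \<le> amax e M * amax f M"
    by (intro mult_mono) auto
  then show ?case by simp
qed (auto simp: bounded_state_def add_mono intro: trans_le_add1)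

lemma afits_amax: "bounded_state M s \<Longrightarrow> amax e M < W \<Longrightarrow> afits W e s"
proof (induction e)
  case (Read a e)
  moreover have "arrs s a (aval e s) \<le> M"
    using Read.prems by (auto simp: bounded_state_def)
  ultimately show ?case by auto
next
  case (Plus e f)
  then show ?case using aval_le_amax[of M s "Plus e f"] by simp
next
  case (Times e f)
  then show ?case using aval_le_amax[of M s "Times e f"] by simp
qed (auto simp: bounded_state_def intro: le_less_trans)

lemma bfits_bmax: "bounded_state M s \<Longrightarrow> bmax b M < W \<Longrightarrow> bfits W b s"
  by (induction b) (auto intro: afits_amax)

lemma bounded_state_assign:
  assumes "bounded_state V s" "v \<le> V'" "V \<le> V'"
  shows "bounded_state V' (s\<lparr>regs := (regs s)(x := v)\<rparr>)"
    and "bounded_state V' (s\<lparr>arrs := (arrs s)(a := (arrs s a)(i := v))\<rparr>)"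
  using assms unfolding bounded_state_def by (auto intro: le_trans)

text \<open>The iterations cut a run into \<open>1 + t\<close> loop-free stretches, each of which
  takes at most \<open>com_cost c\<close> steps and raises the largest stored value by at most
  \<open>growth c\<close>. \<open>M\<close> bounds the states met on the way, \<open>W\<close> the
  values computed in them.\<close>

lemma ex_exec:
  assumes "ex c s t s'" "tame c" "bounded_state V s" "V + growth c * (1 + t) \<le> M" "cmax c M < W"
  shows "(\<exists>t'. exec W c s t' s' \<and> t' \<le> com_cost c * (1 + t)) \<and>
    bounded_state (V + growth c * (1 + t)) s'"
  using assms
proof (induction arbitrary: V rule: ex.induct)
  case (Skip s)
  then show ?case by (auto intro: exec.Skip exI[of _ 1])
next
  case (Assign x e s)
  then have "bounded_state M s" by (auto intro: bounded_state_mono)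
  then have "afits W e s" using Assign by (auto intro: afits_amax)
  moreover have "aval e s \<le> V + increment e"
    using Assign by (auto intro: aval_le_increment)
  ultimately show ?case
    using Assign.prems exec.Assign[of W e s x]
      bounded_state_assign(1)[of V s "aval e s" "V + increment e"] by auto
next
  case (Store a i e s)
  then have "bounded_state M s" by (auto intro: bounded_state_mono)
  then have "afits W e s" "afits W i s" using Store by (auto intro: afits_amax)
  moreover have "aval e s \<le> V + increment e"
    using Store by (auto intro: aval_le_increment)
  ultimately show ?case
    using Store.prems exec.Store[of W i s e a]
      bounded_state_assign(2)[of V s "aval e s" "V + increment e"] by auto
next
  case (Seq c s t s' c' t' s'')
  let ?V = "V + growth c * (1 + t)"
  have b: "?V + growth c' * (1 + t') \<le> V + growth (com.Seq c c') * (1 + (t + t'))"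
    by (simp add: algebra_simps)
  have 1: "(\<exists>u. exec W c s u s' \<and> u \<le> com_cost c * (1 + t)) \<and> bounded_state ?V s'"
    using Seq.prems b by (intro Seq.IH(1)) auto
  then have 2: "(\<exists>u. exec W c' s' u s'' \<and> u \<le> com_cost c' * (1 + t')) \<and>
      bounded_state (?V + growth c' * (1 + t')) s''"
    using Seq.prems b by (intro Seq.IH(2)) auto
  from 1 2 obtain u u' where u: "exec W c s u s'" "u \<le> com_cost c * (1 + t)"
    "exec W c' s' u' s''" "u' \<le> com_cost c' * (1 + t')" by blast
  have "1 + u + u' \<le> com_cost (com.Seq c c') * (1 + (t + t'))"
    using u(2,4) by (simp add: algebra_simps)
  then show ?case using exec.Seq[OF u(1,3)] 2 b bounded_state_mono by blast
next
  case (IfTrue b s c t s' c')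
  have g: "V + growth c * (1 + t) \<le> V + growth (com.If b c c') * (1 + t)"
    by (simp add: algebra_simps)
  have fit: "bfits W b s" using IfTrue.prems
    by (intro bfits_bmax[of M]) (auto intro: bounded_state_mono)
  have "(\<exists>u. exec W c s u s' \<and> u \<le> com_cost c * (1 + t)) \<and> bounded_state (V + growth c * (1 + t)) s'"
    using IfTrue.prems g by (intro IfTrue.IH) auto
  then obtain u where u: "exec W c s u s'" "u \<le> com_cost c * (1 + t)"
    "bounded_state (V + growth c * (1 + t)) s'" by blast
  have "1 + bcost b + u \<le> com_cost (com.If b c c') * (1 + t)"
    using u(2) by (simp add: algebra_simps)
  then show ?case using exec.IfTrue[OF fit IfTrue.hyps(1) u(1), of c'] u(3) g bounded_state_mono by blast
next
  case (IfFalse b s c' t s' c)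
  have g: "V + growth c' * (1 + t) \<le> V + growth (com.If b c c') * (1 + t)"
    by (simp add: algebra_simps)
  have fit: "bfits W b s" using IfFalse.prems
    by (intro bfits_bmax[of M]) (auto intro: bounded_state_mono)
  have "(\<exists>u. exec W c' s u s' \<and> u \<le> com_cost c' * (1 + t)) \<and> bounded_state (V + growth c' * (1 + t)) s'"
    using IfFalse.prems g by (intro IfFalse.IH) auto
  then obtain u where u: "exec W c' s u s'" "u \<le> com_cost c' * (1 + t)"
    "bounded_state (V + growth c' * (1 + t)) s'" by blast
  have "1 + bcost b + u \<le> com_cost (com.If b c c') * (1 + t)"
    using u(2) by (simp add: algebra_simps)
  then show ?case using exec.IfFalse[OF fit IfFalse.hyps(1) u(1), of c] u(3) g bounded_state_mono by blast
next
  case (WhileFalse b s c)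
  have "bfits W b s" using WhileFalse.prems
    by (intro bfits_bmax[of M]) (auto intro: bounded_state_mono)
  from exec.WhileFalse[OF this WhileFalse.hyps, of c] show ?case
    using WhileFalse.prems(2) bounded_state_mono[of V s "V + growth c"]
    by (auto intro!: exI[of _ "Suc (bcost b)"])
next
  case (WhileTrue b s c t s' t' s'')
  let ?V = "V + growth c * (1 + t)"
  \<comment> \<open>The unit charged for an iteration makes the budget split exactly:
    \<open>(1 + t) + (1 + t') = 1 + (1 + t + t')\<close>.\<close>
  have b: "?V + growth c * (1 + t') \<le> V + growth (While b c) * (1 + (1 + t + t'))"
    by (simp add: algebra_simps)
  have fit: "bfits W b s" using WhileTrue.prems
    by (intro bfits_bmax[of M]) (auto intro: bounded_state_mono)
  have 1: "(\<exists>u. exec W c s u s' \<and> u \<le> com_cost c * (1 + t)) \<and> bounded_state ?V s'"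
    using WhileTrue.prems b by (intro WhileTrue.IH(1)) auto
  then have 2: "(\<exists>u. exec W (While b c) s' u s'' \<and> u \<le> com_cost (While b c) * (1 + t')) \<and>
      bounded_state (?V + growth (While b c) * (1 + t')) s''"
    using WhileTrue.prems b by (intro WhileTrue.IH(2)) auto
  from 1 2 obtain u u' where u: "exec W c s u s'" "u \<le> com_cost c * (1 + t)"
    "exec W (While b c) s' u' s''" "u' \<le> com_cost (While b c) * (1 + t')" by blast
  have "1 + bcost b + u + u' \<le> com_cost (While b c) * (1 + (1 + t + t'))"
    using u(2,4) by (simp add: algebra_simps)
  moreover have "exec W (While b c) s (1 + bcost b + u + u') s''"
    using exec.WhileTrue[OF fit WhileTrue.hyps(1) u(1,3)] .
  moreover have "bounded_state (V + growth (While b c) * (1 + (1 + t + t'))) s''"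
    using bounded_state_mono[of _ s''] 2 b by (metis growth.simps(6))
  ultimately show ?case by blast
qed

section \<open>Polynomial bounds on the computed values\<close>

definition polynomial_growth :: "(nat \<Rightarrow> nat) \<Rightarrow> bool" where
  "polynomial_growth f \<longleftrightarrow> (\<exists>k. \<forall>M. f M < (M + 2) ^ k)"

lemma polynomial_growth_const: "polynomial_growth (\<lambda>_. c)"
  unfolding polynomial_growth_def
proof (intro exI allI)
  fix M
  have "c < 2 ^ c" by (rule less_exp)
  also have "(2::nat) ^ c \<le> (M + 2) ^ c" by (intro power_mono) auto
  finally show "c < (M + 2) ^ c" .
qed

lemma polynomial_growth_id: "polynomial_growth (\<lambda>M. M)"
  unfolding polynomial_growth_def by (intro exI[of _ 1]) auto

text \<open>Strict power bounds multiply because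
  \<open>f * g + f + g + 1 = (f + 1) * (g + 1)\<close>. The expression dominates both the sum and
  the product, and it is the shape of \<open>amax\<close> at \<open>Times\<close>.\<close>

lemma polynomial_growth_mult_add:
  assumes "polynomial_growth f" "polynomial_growth g"
  shows "polynomial_growth (\<lambda>M. f M * g M + f M + g M)"
proof -
  obtain j k where jk: "\<And>M. f M < (M + 2) ^ j" "\<And>M. g M < (M + 2) ^ k"
    using assms unfolding polynomial_growth_def by blast
  have "f M * g M + f M + g M < (M + 2) ^ (j + k)" for M
  proof -
    have "(f M + 1) * (g M + 1) \<le> (M + 2) ^ j * (M + 2) ^ k"
      using jk[of M] by (intro mult_mono) auto
    then show ?thesis by (simp add: power_add algebra_simps)
  qed
  then show ?thesis unfolding polynomial_growth_def by blast
qed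

lemma polynomial_growth_le:
  "polynomial_growth g \<Longrightarrow> (\<And>M. f M \<le> g M) \<Longrightarrow> polynomial_growth f"
  unfolding polynomial_growth_def by (meson le_less_trans)

lemma polynomial_growth_add:
  "polynomial_growth f \<Longrightarrow> polynomial_growth g \<Longrightarrow> polynomial_growth (\<lambda>M. f M + g M)"
  by (rule polynomial_growth_le[OF polynomial_growth_mult_add[of f g]]) auto

lemma polynomial_growth_mult:
  "polynomial_growth f \<Longrightarrow> polynomial_growth g \<Longrightarrow> polynomial_growth (\<lambda>M. f M * g M)"
  by (rule polynomial_growth_le[OF polynomial_growth_mult_add[of f g]]) auto

lemmas polynomial_growth_intros = polynomial_growth_const polynomial_growth_id
  polynomial_growth_add polynomial_growth_mult

lemma polynomial_growth_compose:
  assumes "polynomial_growth f" "polynomial_growth g"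
  shows "\<exists>k. \<forall>n. f (g n) < (n + 2) ^ k"
proof -
  obtain j where j: "\<And>M. f M < (M + 2) ^ j"
    using assms(1) unfolding polynomial_growth_def by blast
  have "polynomial_growth (\<lambda>n. g n + 2)" by (intro polynomial_growth_intros assms)
  then obtain k where k: "\<And>n. g n + 2 < (n + 2) ^ k" unfolding polynomial_growth_def by blast
  have "f (g n) < (n + 2) ^ (k * j)" for n
  proof -
    have "f (g n) < (g n + 2) ^ j" by (rule j)
    also have "\<dots> \<le> ((n + 2) ^ k) ^ j" using k[of n] by (intro power_mono) auto
    finally show ?thesis by (simp add: power_mult)
  qed
  then show ?thesis by blast
qed

lemma polynomial_growth_amax: "polynomial_growth (amax e)"
  by (induction e) (simp_all add: polynomial_growth_intros)

lemma polynomial_growth_bmax: "polynomial_growth (bmax b)"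
  by (induction b) (simp_all add: polynomial_growth_intros polynomial_growth_amax)

lemma polynomial_growth_cmax: "polynomial_growth (cmax c)"
  by (induction c)
    (simp_all add: polynomial_growth_intros polynomial_growth_amax polynomial_growth_bmax)

section \<open>Total correctness with a budget of iterations\<close>

definition wp :: "com \<Rightarrow> state \<Rightarrow> nat \<Rightarrow> (state \<Rightarrow> bool) \<Rightarrow> bool" where
  "wp c s t Q \<longleftrightarrow> (\<exists>t' s'. ex c s t' s' \<and> t' \<le> t \<and> Q s')"

text \<open>The input is bounded by \<open>n + 1\<close>, hence all states of the run by a
  polynomial in \<open>n\<close>, and \<open>cmax P\<close> of that is again polynomial. So one
  exponent \<open>k\<close> serves all inputs.\<close>

lemma wp_exec:
  assumes "tame P" "polynomial_growth f"
    and "\<And>n G. good n G \<Longrightarrow> wp P (input_state n G) (f n) (Q n G)"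
  shows "\<exists>k. \<forall>n G. good n G \<longrightarrow>
    (\<exists>t s. exec ((n + 2) ^ k) P (input_state n G) t s \<and> t \<le> com_cost P * (1 + f n) \<and> Q n G s)"
proof -
  have "polynomial_growth (\<lambda>n. (n + 1) + growth P * (1 + f n))"
    by (intro polynomial_growth_intros assms)
  with polynomial_growth_compose[OF polynomial_growth_cmax]
  obtain k where k: "\<And>n. cmax P ((n + 1) + growth P * (1 + f n)) < (n + 2) ^ k" by blast
  have "\<exists>t s. exec ((n + 2) ^ k) P (input_state n G) t s \<and> t \<le> com_cost P * (1 + f n) \<and> Q n G s"
    if good: "good n G" for n G
  proof -
    obtain t s where ts: "ex P (input_state n G) t s" "t \<le> f n" "Q n G s"
      using assms(3)[OF good] unfolding wp_def by blast
    have b: "bounded_state (n + 1) (input_state n G)"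
      by (auto simp: bounded_state_def input_state_def)
    have le: "(1 + t) \<le> (1 + f n)" using ts(2) by simp
    have le': "(n + 1) + growth P * (1 + t) \<le> (n + 1) + growth P * (1 + f n)"
      by (intro add_left_mono mult_le_mono2 le)
    obtain u where u: "exec ((n + 2) ^ k) P (input_state n G) u s" "u \<le> com_cost P * (1 + t)"
      using ex_exec[OF ts(1) assms(1) b le' k] by blast
    have "u \<le> com_cost P * (1 + f n)"
      using u(2) mult_le_mono2[OF le] le_trans by blast
    then show ?thesis using u(1) ts(3) by blast
  qed
  then show ?thesis by blast
qed

abbreviation set_reg :: "nat \<Rightarrow> nat \<Rightarrow> state \<Rightarrow> state" where
  "set_reg r v s \<equiv> s\<lparr>regs := (regs s)(r := v)\<rparr>"

lemma wp_mono: "wp c s t Q \<Longrightarrow> t \<le> t' \<Longrightarrow> (\<And>s'. Q s' \<Longrightarrow> Q' s') \<Longrightarrow> wp c s t' Q'"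
  unfolding wp_def by (meson le_trans)

inductive_cases ex_SkipE: "ex Skip s t s'"
inductive_cases ex_AssignE: "ex (Assign x e) s t s'"
inductive_cases ex_StoreE: "ex (Store a i e) s t s'"
inductive_cases ex_SeqE: "ex (com.Seq c d) s t s'"
inductive_cases ex_IfE: "ex (com.If b c d) s t s'"

lemma wp_Skip [simp]: "wp Skip s t Q \<longleftrightarrow> Q s"
  unfolding wp_def by (metis ex.Skip ex_SkipE zero_le)

lemma wp_Assign [simp]:
  "wp (Assign x e) s t Q \<longleftrightarrow> Q (s\<lparr>regs := (regs s)(x := aval e s)\<rparr>)"
  unfolding wp_def by (metis ex.Assign ex_AssignE zero_le)

lemma wp_Store [simp]:
  "wp (Store a i e) s t Q \<longleftrightarrow> Q (s\<lparr>arrs := (arrs s)(a := (arrs s a)(aval i s := aval e s))\<rparr>)"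
  unfolding wp_def by (metis ex.Store ex_StoreE zero_le)

lemma wp_If [simp]: "wp (com.If b c d) s t Q \<longleftrightarrow> (if bval b s then wp c s t Q else wp d s t Q)"
  unfolding wp_def by (auto elim!: ex_IfE intro: ex.IfTrue ex.IfFalse)

lemma wp_Seq:
  assumes "wp c s t1 (\<lambda>s'. wp d s' t2 Q)" "t1 + t2 \<le> t"
  shows "wp (com.Seq c d) s t Q"
proof -
  from assms(1) obtain u1 s1 u2 s2 where
    "ex c s u1 s1" "u1 \<le> t1" "ex d s1 u2 s2" "u2 \<le> t2" "Q s2"
    unfolding wp_def by blast
  then show ?thesis using assms(2) unfolding wp_def
    by (intro exI[of _ "u1 + u2"] exI[of _ s2]) (auto intro: ex.Seq)
qed

lemma wp_SeqI:
  assumes "wp c s t1 R" "\<And>s'. R s' \<Longrightarrow> wp d s' t2 Q" "t1 + t2 \<le> t"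
  shows "wp (com.Seq c d) s t Q"
  using assms(1) by (intro wp_Seq[OF _ assms(3)] wp_mono[OF assms(1)]) (auto intro: assms(2))

text \<open>A loop-free command uses no budget and has a single outcome, so prefixing it gives an
  equivalence. As rewrite rules such equivalences execute straight-line code symbolically;
  \<open>wp_Seq_Seq\<close> and \<open>wp_Seq_If\<close> bring programs into the form they
  need.\<close>

lemma wp_Seq_loopfree:
  assumes "\<And>t s'. ex c s t s' \<longleftrightarrow> t = 0 \<and> s' = s1"
  shows "wp (com.Seq c d) s t Q \<longleftrightarrow> wp d s1 t Q"
proof
  assume "wp d s1 t Q"
  then obtain u s' where "ex d s1 u s'" "u \<le> t" "Q s'" unfolding wp_def by blast
  moreover from this have "ex (com.Seq c d) s (0 + u) s'" using assms by (intro ex.Seq) auto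
  ultimately show "wp (com.Seq c d) s t Q" unfolding wp_def by auto
next
  assume "wp (com.Seq c d) s t Q"
  then show "wp d s1 t Q" using assms unfolding wp_def by (fastforce elim!: ex_SeqE)
qed

lemma wp_Seq_Skip [simp]: "wp (com.Seq Skip d) s t Q \<longleftrightarrow> wp d s t Q"
  by (rule wp_Seq_loopfree) (auto elim: ex_SkipE intro: ex.Skip)

lemma wp_Seq_Assign [simp]: "wp (com.Seq (Assign x e) d) s t Q \<longleftrightarrow>
    wp d (s\<lparr>regs := (regs s)(x := aval e s)\<rparr>) t Q"
  by (rule wp_Seq_loopfree) (auto elim: ex_AssignE intro: ex.Assign)

lemma wp_Seq_Store [simp]: "wp (com.Seq (Store a i e) d) s t Q \<longleftrightarrow>
    wp d (s\<lparr>arrs := (arrs s)(a := (arrs s a)(aval i s := aval e s))\<rparr>) t Q"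
  by (rule wp_Seq_loopfree) (auto elim: ex_StoreE intro: ex.Store)

lemma wp_Seq_Seq [simp]:
  "wp (com.Seq (com.Seq c d) e) s t Q \<longleftrightarrow> wp (com.Seq c (com.Seq d e)) s t Q" (is "?l \<longleftrightarrow> ?r")
proof
  assume ?l
  then obtain t1 t2 t3 s1 s2 s3 where
    "ex c s t1 s1" "ex d s1 t2 s2" "ex e s2 t3 s3" "t1 + t2 + t3 \<le> t" "Q s3"
    unfolding wp_def by (auto elim!: ex_SeqE)
  then show ?r unfolding wp_def
    by (intro exI[of _ "t1 + (t2 + t3)"] exI[of _ s3]) (auto intro: ex.Seq)
next
  assume ?r
  then obtain t1 t2 t3 s1 s2 s3 where
    "ex c s t1 s1" "ex d s1 t2 s2" "ex e s2 t3 s3" "t1 + t2 + t3 \<le> t" "Q s3"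
    unfolding wp_def by (auto elim!: ex_SeqE)
  then show ?l unfolding wp_def
    by (intro exI[of _ "(t1 + t2) + t3"] exI[of _ s3]) (auto intro: ex.Seq)
qed

lemma wp_Seq_If [simp]: "wp (com.Seq (com.If b c d) e) s t Q \<longleftrightarrow>
    (if bval b s then wp (com.Seq c e) s t Q else wp (com.Seq d e) s t Q)"
  unfolding wp_def by (auto elim!: ex_SeqE ex_IfE) (blast intro: ex.Seq ex.IfTrue ex.IfFalse)+

lemma wp_While:
  assumes "I s"
    and "\<And>s. I s \<Longrightarrow> bval b s \<Longrightarrow> wp c s u (\<lambda>s'. I s' \<and> m s' < (m s :: nat))"
    and "\<And>s. I s \<Longrightarrow> \<not> bval b s \<Longrightarrow> Q s"
    and "m s * (1 + u) \<le> t"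
  shows "wp (While b c) s t Q"
proof -
  have "I s \<Longrightarrow> \<exists>t' s'. ex (While b c) s t' s' \<and> t' \<le> m s * (1 + u) \<and> Q s'" for s
  proof (induction "m s" arbitrary: s rule: less_induct)
    case less
    show ?case
    proof (cases "bval b s")
      case True
      obtain t1 s1 where 1: "ex c s t1 s1" "t1 \<le> u" "I s1" "m s1 < m s"
        using assms(2)[OF less.prems True] unfolding wp_def by blast
      obtain t2 s2 where 2: "ex (While b c) s1 t2 s2" "t2 \<le> m s1 * (1 + u)" "Q s2"
        using less.hyps[OF 1(4,3)] by blast
      have "1 + t1 + t2 \<le> Suc (m s1) * (1 + u)" using 1(2) 2(2) by simp
      also have "\<dots> \<le> m s * (1 + u)" using 1(4) by (intro mult_le_mono1) simp
      finally show ?thesis using ex.WhileTrue[OF True 1(1) 2(1)] 2(3) by blast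
    next
      case False
      then show ?thesis using ex.WhileFalse assms(3)[OF less.prems] by blast
    qed
  qed
  from this[OF assms(1)] assms(4) show ?thesis unfolding wp_def by (meson le_trans)
qed

definition For :: "nat \<Rightarrow> nat \<Rightarrow> com \<Rightarrow> com" where
  "For i h c = com.Seq (Assign i (Const 0))
     (While (Less (Var i) (Var h)) (com.Seq c (Assign i (Plus (Var i) (Const 1)))))"

lemma wp_For:
  assumes "I 0 (set_reg i 0 s)" "regs s h = N" "i \<noteq> h"
    and "\<And>k s. I k s \<Longrightarrow> regs s i = k \<Longrightarrow> regs s h = N \<Longrightarrow> k < N \<Longrightarrow>
      wp c s u (\<lambda>s'. I (Suc k) (set_reg i (Suc k) s') \<and> regs s' i = k \<and> regs s' h = N)"
    and "\<And>s. I N s \<Longrightarrow> regs s i = N \<Longrightarrow> regs s h = N \<Longrightarrow> Q s"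
    and "N * (1 + u) \<le> t"
  shows "wp (For i h c) s t Q"
  unfolding For_def wp_Seq_Assign
proof (rule wp_While[where I = "\<lambda>s. I (regs s i) s \<and> regs s i \<le> N \<and> regs s h = N"
      and m = "\<lambda>s. N - regs s i" and u = u])
  fix s assume s: "I (regs s i) s \<and> regs s i \<le> N \<and> regs s h = N" and "bval (Less (Var i) (Var h)) s"
  then have lt: "regs s i < N" by simp
  show "wp (com.Seq c (Assign i (Plus (Var i) (Const 1)))) s u
    (\<lambda>s'. (I (regs s' i) s' \<and> regs s' i \<le> N \<and> regs s' h = N) \<and> N - regs s' i < N - regs s i)"
    by (rule wp_SeqI[where ?t1.0 = u and ?t2.0 = 0, OF assms(4)[of "regs s i" s]]) (use s lt assms(3) in auto)
qed (use assms in auto)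

definition search :: "nat \<Rightarrow> nat \<Rightarrow> nat \<Rightarrow> bexp \<Rightarrow> com" where
  "search r lo h b = com.Seq (Assign r (Const lo))
     (While (And (Less (Var r) (Var h)) (bexp.Not b)) (Assign r (Plus (Var r) (Const 1))))"

text \<open>Only the register \<open>r\<close> changes, so the outcomes are the states
  \<open>set_reg r m s\<close>. Failure is recognised by \<open>regs s h \<le> m\<close>;
  \<open>m\<close> stays arbitrary because it exceeds the limit if \<open>lo\<close> does.\<close>

lemma wp_search:
  assumes "r \<noteq> h" "regs s h \<le> t"
    and "\<And>m. lo \<le> m \<Longrightarrow> m < regs s h \<Longrightarrow> bval b (set_reg r m s) \<Longrightarrow> Q (set_reg r m s)"
    and "\<And>m. regs s h \<le> m \<Longrightarrow> (\<And>c. lo \<le> c \<Longrightarrow> c < regs s h \<Longrightarrow> \<not> bval b (set_reg r c s)) \<Longrightarrow> 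
      Q (set_reg r m s)"
  shows "wp (search r lo h b) s t Q"
  unfolding search_def wp_Seq_Assign
proof (rule wp_While[where I = "\<lambda>s'. lo \<le> regs s' r \<and> s' = set_reg r (regs s' r) s \<and>
        (\<forall>c. lo \<le> c \<and> c < regs s' r \<longrightarrow> \<not> bval b (set_reg r c s))"
      and m = "\<lambda>s'. regs s h - regs s' r" and u = 0], goal_cases)
  case 1
  then show ?case by auto
next
  case (2 s')
  then have [simp]: "regs s' h = regs s h" using assms(1) by (metis fun_upd_other state.select_convs(1)
     state.surjective state.update_convs(1))
  from 2 have lt: "regs s' r < regs s h" by simp
  have "set_reg r (Suc (regs s' r)) s' = set_reg r (Suc (regs s' r)) s" using 2
    by (metis fun_upd_upd state.unfold_congs(1) state.select_convs(1) state.surjective state.update_convs(1))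
  then show ?case using 2 lt by (auto simp: less_Suc_eq)
next
  case (3 s')
  then have [simp]: "regs s' h = regs s h" using assms(1) by (metis fun_upd_other state.select_convs(1)
     state.surjective state.update_convs(1))
  show ?case
  proof (cases "regs s' r < regs s h")
    case True
    then have "bval b s'" using 3 by simp
    then show ?thesis using assms(3)[of "regs s' r"] 3 True by metis
  next
    case False
    then have "Q (set_reg r (regs s' r) s)" using 3 by (intro assms(4)) auto
    then show ?thesis using 3 by metis
  qed
next
  case 4
  then show ?case using assms(2) by simp
qed

section \<open>Fans and Kempe chains in multigraphs\<close>

locale multi_ends =
  fixes n :: nat and En :: "nat \<Rightarrow> nat set"
  assumes card_ends: "e < n \<Longrightarrow> card (En e) = 2"
    and zero_notin_ends: "e < n \<Longrightarrow> 0 \<notin> En e"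
begin

text \<open>Edges are numbered from 0 and colours from 1; colour 0 marks an uncoloured edge.\<close>

definition pcol :: "nat \<Rightarrow> (nat \<Rightarrow> nat) \<Rightarrow> bool" where
  "pcol K col \<longleftrightarrow> 0 < K \<and> (\<forall>e<n. col e < K) \<and>
    (\<forall>e<n. \<forall>f<n. e \<noteq> f \<longrightarrow> col e \<noteq> 0 \<longrightarrow> col e = col f \<longrightarrow> En e \<inter> En f = {})"

definition free :: "(nat \<Rightarrow> nat) \<Rightarrow> nat \<Rightarrow> nat \<Rightarrow> bool" where
  "free col v c \<longleftrightarrow> (\<forall>e<n. v \<in> En e \<longrightarrow> col e \<noteq> c)"

lemma pcol_unique:
  "pcol K col \<Longrightarrow> e < n \<Longrightarrow> f < n \<Longrightarrow> v \<in> En e \<Longrightarrow> v \<in> En f \<Longrightarrow> col e = col f \<Longrightarrow> col e \<noteq> 0 \<Longrightarrow> e = f"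
  unfolding pcol_def by blast

lemma pcol_set:
  "pcol K col \<Longrightarrow> c < K \<Longrightarrow> (\<And>v. v \<in> En e \<Longrightarrow> free col v c) \<Longrightarrow> pcol K (col(e := c))"
  unfolding pcol_def free_def by (simp add: disjoint_iff) blast

lemma pcol_unset: "pcol K col \<Longrightarrow> pcol K (col(e := 0))"
  unfolding pcol_def by auto

lemma pcol_mono: "pcol K col \<Longrightarrow> K \<le> K' \<Longrightarrow> pcol K' col"
  unfolding pcol_def by fastforce

lemma other_end:
  assumes "e < n" "x \<in> En e" obtains y where "En e = {x, y}" "y \<noteq> x"
proof -
  obtain a b where "En e = {a, b}" "a \<noteq> b"
    using card_ends[OF assms(1)] unfolding card_2_iff by auto
  then show thesis using that[of a] that[of b] assms(2) by (auto simp: insert_commute)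
qed

section \<open>Fans and shifts of colours along them\<close>

definition spoke :: "nat \<Rightarrow> nat \<Rightarrow> (nat \<Rightarrow> nat) \<Rightarrow> nat \<Rightarrow> nat \<Rightarrow> bool" where
  "spoke X Y col V G \<longleftrightarrow> V \<noteq> 0 \<and> G < n \<and> En G = {X, V} \<and> V \<noteq> X \<and> V \<noteq> Y \<and> col G \<noteq> 0"

text \<open>The value 0, which is no vertex, stands for an absent \<open>V2\<close> or
  \<open>V3\<close>, so that one predicate covers fans of every length that occurs.\<close>

definition fan :: "nat \<Rightarrow> nat \<Rightarrow> nat \<Rightarrow> nat \<Rightarrow> nat \<Rightarrow> nat \<Rightarrow> nat \<Rightarrow> (nat \<Rightarrow> nat) \<Rightarrow> bool" where
  "fan X Y E V2 G2 V3 G3 col \<longleftrightarrow> E < n \<and> En E = {X, Y} \<and> X \<noteq> Y \<and> col E = 0 \<and>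
     (V2 \<noteq> 0 \<longrightarrow> spoke X Y col V2 G2 \<and> free col Y (col G2)) \<and>
     (V3 \<noteq> 0 \<longrightarrow> V2 \<noteq> 0 \<and> spoke X Y col V3 G3 \<and> V3 \<noteq> V2 \<and>
        (free col Y (col G3) \<or> free col V2 (col G3)))"

definition ready2 :: "nat \<Rightarrow> nat \<Rightarrow> nat \<Rightarrow> nat \<Rightarrow> (nat \<Rightarrow> nat) \<Rightarrow> nat \<Rightarrow> bool" where
  "ready2 X Y V2 G2 col c \<longleftrightarrow> free col X c \<and>
     (free col Y c \<or> spoke X Y col V2 G2 \<and> free col V2 c \<and> free col Y (col G2))"

text \<open>Under \<open>ready2\<close> at most one shift makes some colour available for
  \<open>E\<close>, here at most two. Demanding that \<open>V2\<close> does not miss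
  \<open>c\<close> puts the branch of the third vertex after the others, in the order of the tests
  made by \<open>finish\<close>.\<close>

definition ready3 ::
  "nat \<Rightarrow> nat \<Rightarrow> nat \<Rightarrow> nat \<Rightarrow> nat \<Rightarrow> nat \<Rightarrow> (nat \<Rightarrow> nat) \<Rightarrow> nat \<Rightarrow> bool" where
  "ready3 X Y V2 G2 V3 G3 col c \<longleftrightarrow> ready2 X Y V2 G2 col c \<or> free col X c \<and>
     spoke X Y col V3 G3 \<and> V3 \<noteq> V2 \<and> free col V3 c \<and> (V2 = 0 \<or> \<not> free col V2 c) \<and>
     (free col Y (col G3) \<or> spoke X Y col V2 G2 \<and> free col V2 (col G3) \<and> free col Y (col G2))"

text \<open>In a proper colouring \<open>G\<close> is the only edge at \<open>X\<close> with its
  colour, so moving \<open>G\<close> to \<open>c\<close> makes the old colour missing at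
  \<open>X\<close>.\<close>

lemma spoke_shift:
  assumes "pcol K col" "spoke X Y col V G" "0 < c" "c < K" "free col X c" "free col V c"
  shows "pcol K (col(G := c))" "\<And>v. v \<in> En G \<Longrightarrow> free (col(G := 0)) v c"
    "free (col(G := c)) X (col G)" "v \<noteq> X \<Longrightarrow> v \<noteq> V \<Longrightarrow> free (col(G := c)) v d = free col v d"
proof -
  have G: "G < n" "En G = {X, V}" "col G \<noteq> 0" using assms(2) by (auto simp: spoke_def)
  show "pcol K (col(G := c))" using assms G by (intro pcol_set) auto
  show "\<And>v. v \<in> En G \<Longrightarrow> free (col(G := 0)) v c"
    using G assms by (auto simp: free_def)
  have "col G \<noteq> c" using assms(5) G unfolding free_def by auto
  then show "free (col(G := c)) X (col G)"
    unfolding free_def using pcol_unique[OF assms(1) _ G(1)] G by auto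
  show "v \<noteq> X \<Longrightarrow> v \<noteq> V \<Longrightarrow> free (col(G := c)) v d = free col v d"
    using G unfolding free_def by auto
qed

text \<open>The old colour of \<open>G3\<close> becomes the next target: it is now missing at
  \<open>X\<close>, and by the fan condition at \<open>Y\<close> or at \<open>V2\<close>. Nothing
  changes at \<open>Y\<close> or \<open>V2\<close>, so the shorter fan still works.\<close>

lemma ready3_shift:
  assumes "pcol K col" "ready3 X Y V2 G2 V3 G3 col c" "0 < c" "c < K" "X \<noteq> Y"
    "\<not> free col Y c" "V2 = 0 \<or> \<not> free col V2 c"
  shows "spoke X Y col V3 G3" "free col X c" "free col V3 c"
    "ready2 X Y V2 G2 (col(G3 := c)) (col G3)"
proof -
  show *: "spoke X Y col V3 G3" "free col X c" "free col V3 c"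
    using assms unfolding ready3_def ready2_def spoke_def by auto
  note sh = spoke_shift[OF assms(1) *(1) assms(3,4) *(2,3)]
  have V2: "V3 \<noteq> V2" "free col Y (col G3) \<or> spoke X Y col V2 G2 \<and> free col V2 (col G3) \<and> free col Y (col G2)"
    using assms unfolding ready3_def ready2_def spoke_def by auto
  have "V3 \<noteq> Y" "V3 \<noteq> 0" using * unfolding spoke_def by auto
  then have Y: "free (col(G3 := c)) Y d = free col Y d" for d
    using sh(4)[of Y] assms(5) by auto
  show "ready2 X Y V2 G2 (col(G3 := c)) (col G3)"
    using V2(2)
  proof
    assume "free col Y (col G3)"
    then show ?thesis unfolding ready2_def using sh(3) Y by auto
  next
    assume a: "spoke X Y col V2 G2 \<and> free col V2 (col G3) \<and> free col Y (col G2)"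
    then have "G2 \<noteq> G3" using V2(1) *(1) unfolding spoke_def by (auto simp: doubleton_eq_iff)
    then show ?thesis unfolding ready2_def using a sh(3) Y sh(4)[of V2] V2(1)
      unfolding spoke_def by auto
  qed
qed

lemma ready2_shift:
  assumes "pcol K col" "ready2 X Y V2 G2 col c" "0 < c" "c < K" "X \<noteq> Y" "\<not> free col Y c"
  shows "spoke X Y col V2 G2" "free col X c" "free col V2 c"
    "free (col(G2 := c)) X (col G2)" "free (col(G2 := c)) Y (col G2)"
proof -
  show *: "spoke X Y col V2 G2" "free col X c" "free col V2 c"
    using assms unfolding ready2_def by auto
  note sh = spoke_shift[OF assms(1) *(1) assms(3,4) *(2,3)]
  show "free (col(G2 := c)) X (col G2)" by (rule sh(3))
  have "V2 \<noteq> Y" using * unfolding spoke_def by auto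
  then show "free (col(G2 := c)) Y (col G2)"
    using sh(4)[of Y] assms unfolding ready2_def by auto
qed

text \<open>The Kempe change at \<open>X\<close>, where \<open>\<alpha>\<close> is missing and \<open>c\<close> is not, seen only through what the fan argument
  needs: besides \<open>X\<close> at most one vertex, the other end \<open>t\<close> of the chain, stops missing \<open>c\<close>.\<close>

definition kempe_swap :: "nat \<Rightarrow> nat \<Rightarrow> nat \<Rightarrow> nat \<Rightarrow> (nat \<Rightarrow> nat) \<Rightarrow> (nat \<Rightarrow> nat) \<Rightarrow> bool" where
  "kempe_swap K X \<alpha> c col col' \<longleftrightarrow> pcol K col' \<and> (\<forall>e<n. col' e = 0 \<longleftrightarrow> col e = 0) \<and> free col' X c \<and>
     (\<exists>t. \<forall>p. p \<noteq> X \<longrightarrow> free col p c \<longrightarrow> (if p = t then free col' p \<alpha> else free col' p c)) \<and>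
     (\<forall>d p. d \<noteq> \<alpha> \<longrightarrow> d \<noteq> c \<longrightarrow> free col' p d = free col p d) \<and>
     (\<forall>e<n. col e \<noteq> \<alpha> \<longrightarrow> col e \<noteq> c \<longrightarrow> col' e = col e) \<and>
     (\<forall>e<n. X \<in> En e \<longrightarrow> col e = c \<longrightarrow> col' e = \<alpha>)"

lemma ready3_unswapped:
  assumes "fan X Y E V2 G2 V3 G3 col" "free col X c"
    "free col Y c \<or> V2 \<noteq> 0 \<and> free col V2 c \<or> V3 \<noteq> 0 \<and> free col V3 c"
  shows "ready3 X Y V2 G2 V3 G3 col c"
  using assms unfolding fan_def ready3_def ready2_def by blast

text \<open>Of two fan vertices missing \<open>c\<close> the change spoils at most one, so some fan
  vertex still misses \<open>c\<close>, and \<open>X\<close> now misses it too. The target is the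
  first such vertex in the order \<open>Y\<close>, \<open>V2\<close>, \<open>V3\<close>; the
  vertices before it do not miss \<open>c\<close>, and this keeps their fan conditions
  alive.\<close>

lemma ready3_swapped:
  assumes "fan X Y E V2 G2 V3 G3 col" "free col X \<alpha>" "0 < \<alpha>" "0 < c" "kempe_swap K X \<alpha> c col col'"
    "free col Y c \<and> V2 \<noteq> 0 \<and> free col V2 c \<or> free col Y c \<and> V3 \<noteq> 0 \<and> free col V3 c \<or>
      V2 \<noteq> 0 \<and> free col V2 c \<and> V3 \<noteq> 0 \<and> free col V3 c"
  shows "ready3 X Y V2 G2 V3 G3 col' c"
proof -
  obtain t where t: "\<And>p. p \<noteq> X \<Longrightarrow> free col p c \<Longrightarrow> (if p = t then free col' p \<alpha> else free col' p c)"
    using assms(5) unfolding kempe_swap_def by auto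
  have Xc: "free col' X c" using assms(5) unfolding kempe_swap_def by auto
  \<comment> \<open>The danger to the fan is a spoke of colour \<open>c\<close>, which turns into
    \<open>\<alpha>\<close>. Its witness \<open>p\<close> missed \<open>c\<close>; if
    \<open>p\<close> no longer does, it is the far end of the chain and now misses
    \<open>\<alpha>\<close>, the new colour of the spoke.\<close>
  have par: "free col' p c \<or> free col' p (col' G)"
    if "p \<noteq> X" "free col p (col G)" "spoke X Y col V G" for p V G
  proof (cases "col G = c")
    case True
    then have "col' G = \<alpha>" using that(3) assms(5) unfolding spoke_def kempe_swap_def by auto
    then show ?thesis using t[of p] True that by metis
  next
    case False
    moreover have "col G \<noteq> \<alpha>" using assms(2) that(3) unfolding free_def spoke_def by auto
    ultimately show ?thesis using assms(5) that unfolding kempe_swap_def spoke_def by metis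
  qed
  have sp: "spoke X Y col V G \<Longrightarrow> spoke X Y col' V G" for V G
    using assms(5) unfolding kempe_swap_def spoke_def by auto
  have XY: "Y \<noteq> X" using assms(1) unfolding fan_def by auto
  have f2: "V2 \<noteq> 0 \<Longrightarrow> spoke X Y col V2 G2 \<and> free col Y (col G2) \<and> V2 \<noteq> X"
    and f3: "V3 \<noteq> 0 \<Longrightarrow> V2 \<noteq> 0 \<and> spoke X Y col V3 G3 \<and> V3 \<noteq> V2 \<and> V3 \<noteq> Y \<and> V3 \<noteq> X \<and>
        (free col Y (col G3) \<or> free col V2 (col G3))"
    using assms(1) unfolding fan_def spoke_def by auto
  have f2': "V2 \<noteq> Y" if "V2 \<noteq> 0" using f2[OF that] by (auto simp: spoke_def)
  show ?thesis
  proof (cases "free col' Y c")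
    case True
    then show ?thesis unfolding ready3_def ready2_def using Xc by blast
  next
    case nY: False
    have p2: "V2 \<noteq> 0 \<Longrightarrow> free col' Y (col' G2)" using f2 par[OF XY] nY by blast
    show ?thesis
    proof (cases "V2 \<noteq> 0 \<and> free col' V2 c")
      case True
      then show ?thesis unfolding ready3_def ready2_def using Xc sp f2 p2 by blast
    next
      case n2: False
      have "V3 \<noteq> 0" using assms(6) t[of Y] t[of V2] nY n2 XY f2 f2' by metis
      moreover have "free col' V3 c"
        using assms(6) t[of Y] t[of V2] t[of V3] nY n2 XY f2 f2' f3 by metis
      moreover have "free col' Y (col' G3) \<or> free col' V2 (col' G3)"
        using par[OF XY, of G3 V3] par[of V2 G3 V3] f2 f3 calculation(1) nY n2 by blast
      ultimately show ?thesis
        unfolding ready3_def using Xc f2 f3 sp p2 n2 by blast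
    qed
  qed
qed

text \<open>\<open>D\<close> is the part of the \<open>\<alpha>\<close>-\<open>c\<close>-chain from \<open>X\<close> that has been swapped; the next edge \<open>F\<close> of the chain,
  at its current end \<open>Z\<close>, has lost its colour \<open>P\<close> and is about to receive \<open>Q\<close>.\<close>

definition chain_inv :: "nat \<Rightarrow> (nat \<Rightarrow> nat) \<Rightarrow> nat \<Rightarrow> nat \<Rightarrow> nat \<Rightarrow> nat set \<Rightarrow> nat \<Rightarrow> nat \<Rightarrow> nat \<Rightarrow> nat \<Rightarrow>
    (nat \<Rightarrow> nat) \<Rightarrow> bool" where
  "chain_inv K col0 X \<alpha> c D Z P Q F col \<longleftrightarrow> pcol K col0 \<and> 0 < \<alpha> \<and> \<alpha> < K \<and> 0 < c \<and> c < K \<and> \<alpha> \<noteq> c \<and>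
     free col0 X \<alpha> \<and> F < n \<and> F \<notin> D \<and> Z \<in> En F \<and> col0 F = P \<and>
     (P = \<alpha> \<and> Q = c \<or> P = c \<and> Q = \<alpha>) \<and> (\<forall>e\<in>D. e < n \<and> (col0 e = \<alpha> \<or> col0 e = c)) \<and>
     col = (\<lambda>e. if e = F then 0 else if e \<in> D then (if col0 e = \<alpha> then c else \<alpha>) else col0 e) \<and>
     pcol K col \<and>
     (if Z = X then D = {} \<and> P = c
      else (\<exists>e\<in>D. Z \<in> En e \<and> col0 e = Q) \<and> (\<exists>e\<in>D. X \<in> En e \<and> col0 e = c)) \<and>
     (\<forall>u. u \<noteq> X \<longrightarrow> u \<noteq> Z \<longrightarrow> (\<exists>e\<in>D. u \<in> En e) \<longrightarrow>
        (\<exists>e\<in>D. u \<in> En e \<and> col0 e = \<alpha>) \<and> (\<exists>e\<in>D. u \<in> En e \<and> col0 e = c))"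

lemma chain_inv_init:
  assumes "pcol K col" "0 < \<alpha>" "\<alpha> < K" "0 < c" "c < K" "free col X \<alpha>" "F < n" "X \<in> En F" "col F = c"
  shows "chain_inv K col X \<alpha> c {} X c \<alpha> F (col(F := 0))"
proof -
  have "\<alpha> \<noteq> c" using assms(6-9) unfolding free_def by auto
  then show ?thesis using assms pcol_unset[OF assms(1)] unfolding chain_inv_def
    by (auto simp: fun_eq_iff)
qed

text \<open>In the colours \<open>\<alpha>\<close> and \<open>c\<close> every vertex has at most two
  edges and \<open>X\<close> only one, so the chain is a path that returns neither to
  \<open>X\<close> nor to an inner vertex. At its new end \<open>y\<close> either \<open>Q\<close>
  is missing and the change is complete, or the edge of colour \<open>Q\<close> at \<open>y\<close>
  comes next.\<close>

lemma chain_inv_step: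
  assumes inv: "chain_inv K col0 X \<alpha> c D Z P Q F col" and y: "En F = {Z, y}" "y \<noteq> Z"
  shows "free col Z Q" "y \<noteq> X"
    and "free col y Q \<Longrightarrow> kempe_swap K X \<alpha> c col0 (col(F := Q))"
    and "F2 < n \<Longrightarrow> y \<in> En F2 \<Longrightarrow> col F2 = Q \<Longrightarrow>
      chain_inv K col0 X \<alpha> c (insert F D) y Q P F2 (col(F2 := 0, F := Q))"
    and "F2 < n \<Longrightarrow> y \<in> En F2 \<Longrightarrow> col F2 = Q \<Longrightarrow> free (col(F2 := 0)) y Q"
    and "F2 < n \<Longrightarrow> y \<in> En F2 \<Longrightarrow> col F2 = Q \<Longrightarrow> free (col(F2 := 0)) Z Q"
proof -
  note pc0 = inv[unfolded chain_inv_def, THEN conjunct1]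
  have "0 < \<alpha>" "0 < c" "\<alpha> \<noteq> c" "\<alpha> < K" "c < K"
    and Xa: "free col0 X \<alpha>" and F: "F < n" "F \<notin> D" "Z \<in> En F" "col0 F = P"
    and PQ: "P = \<alpha> \<and> Q = c \<or> P = c \<and> Q = \<alpha>"
    and D: "\<And>e. e \<in> D \<Longrightarrow> e < n \<and> (col0 e = \<alpha> \<or> col0 e = c)"
    and col: "\<And>e. col e = (if e = F then 0 else if e \<in> D then (if col0 e = \<alpha> then c else \<alpha>) else col0 e)"
    and pc: "pcol K col"
    and Z: "if Z = X then D = {} \<and> P = c
      else (\<exists>e\<in>D. Z \<in> En e \<and> col0 e = Q) \<and> (\<exists>e\<in>D. X \<in> En e \<and> col0 e = c)"
    and both: "\<And>u e. u \<noteq> X \<Longrightarrow> u \<noteq> Z \<Longrightarrow> e \<in> D \<Longrightarrow> u \<in> En e \<Longrightarrow>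
        (\<exists>e\<in>D. u \<in> En e \<and> col0 e = \<alpha>) \<and> (\<exists>e\<in>D. u \<in> En e \<and> col0 e = c)"
    using inv unfolding chain_inv_def by auto
  note ac = \<open>0 < \<alpha>\<close> \<open>0 < c\<close> \<open>\<alpha> \<noteq> c\<close> \<open>\<alpha> < K\<close> \<open>c < K\<close>
  have uq: "e = f" if "e < n" "f < n" "v \<in> En e" "v \<in> En f" "col0 e = col0 f" "col0 e = \<alpha> \<or> col0 e = c"
    for e f v using pcol_unique[OF pc0 that(1-5)] that(6) ac by auto
  have Q: "0 < Q" "Q < K" "P \<noteq> Q" using PQ ac by auto
  \<comment> \<open>\<open>X\<close> misses \<open>\<alpha>\<close>, and its only edge of colour
    \<open>c\<close> is already in \<open>D\<close>.\<close>
  show yX: "y \<noteq> X"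
  proof
    assume "y = X"
    then have "Z \<noteq> X" using y by auto
    then obtain e where e: "e \<in> D" "X \<in> En e" "col0 e = c" using Z by auto
    have "X \<in> En F" using y \<open>y = X\<close> by auto
    then have "col0 F = c" using Xa F PQ unfolding free_def by auto
    then have "e = F" using uq[of e F X] e D[OF e(1)] F \<open>X \<in> En F\<close> by auto
    then show False using e F by auto
  qed
  show ZQ: "free col Z Q"
    unfolding free_def
  proof (intro allI impI notI)
    fix e assume e: "e < n" "Z \<in> En e" "col e = Q"
    have eF: "e \<noteq> F" using e(3) Q col by auto
    show False
    proof (cases "e \<in> D")
      case True
      then have "col0 e = P" using e col[of e] D[OF True] eF PQ ac by (auto split: if_splits)
      then show False using uq[of e F Z] e F eF PQ by auto
    next
      case False
      then have c0: "col0 e = Q" using e col[of e] eF by auto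
      show False
      proof (cases "Z = X")
        case True
        then show False using Z PQ c0 e Xa ac unfolding free_def by auto
      next
        case ne: False
        then obtain f where f: "f \<in> D" "Z \<in> En f" "col0 f = Q" using Z by auto
        then have "f = e" using uq[of f e Z] D[OF f(1)] e c0 by auto
        then show False using f False by auto
      qed
    qed
  qed
  have yQ: "f \<notin> insert F D \<and> col0 f = Q" if f: "f < n" "y \<in> En f" "col f = Q" for f
  proof -
    have fF: "f \<noteq> F" using f(3) Q col by auto
    have "f \<notin> D"
    proof
      assume "f \<in> D"
      then have "col0 f = P" using f col[of f] D[of f] fF PQ ac by (auto split: if_splits)
      then show False using uq[of f F y] f F y fF PQ by auto
    qed
    then show ?thesis using f fF col[of f] by auto
  qed
  \<comment> \<open>With \<open>F\<close> swapped, \<open>Z\<close> turns into an inner vertex of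
    the path: its \<open>Q\<close>-edge is in \<open>D\<close> and its \<open>P\<close>-edge is
    \<open>F\<close>.\<close>
  have both': "(\<exists>e\<in>insert F D. u \<in> En e \<and> col0 e = \<alpha>) \<and> (\<exists>e\<in>insert F D. u \<in> En e \<and> col0 e = c)"
    if u: "u \<noteq> X" "u \<noteq> y" "e \<in> insert F D" "u \<in> En e" for u e
  proof (cases "u = Z")
    case True
    then have "Z \<noteq> X" using u by auto
    then obtain e where "e \<in> D" "Z \<in> En e" "col0 e = Q" using Z by auto
    then show ?thesis using True F PQ by auto
  next
    case False
    then have "e \<in> D" using u y by auto
    from both[OF u(1) False this u(4)] show ?thesis by auto
  qed
  have Xc: "\<exists>e\<in>insert F D. X \<in> En e \<and> col0 e = c"
    using Z F by (auto split: if_splits)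
  {
    assume fr: "free col y Q"
    let ?col = "col(F := Q)"
    let ?D = "insert F D"
    have pcF: "pcol K ?col" using fr ZQ y Q by (intro pcol_set[OF pc]) auto
    have co: "?col e = (if e \<in> ?D then (if col0 e = \<alpha> then c else \<alpha>) else col0 e)" for e
      using col[of e] F PQ ac by auto
    have D': "\<And>e. e \<in> ?D \<Longrightarrow> e < n \<and> (col0 e = \<alpha> \<or> col0 e = c)" using D F PQ by auto
    have noQ: "col0 e \<noteq> Q" if e: "e < n" "y \<in> En e" for e
    proof
      assume q: "col0 e = Q"
      show False
      proof (cases "e \<in> D")
        case True
        obtain f where f: "f \<in> D" "y \<in> En f" "col0 f = P"
          using both[OF yX y(2) True e(2)] PQ by auto
        then have "f = F" using uq[of f F y] D[OF f(1)] F y PQ by auto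
        then show False using f F by auto
      next
        case False
        then have "col e = Q" using col[of e] q Q F by auto
        then show False using fr e unfolding free_def by auto
      qed
    qed
    have frX: "free ?col X c"
      unfolding free_def
    proof (intro allI impI notI)
      fix e assume e: "e < n" "X \<in> En e" "?col e = c"
      obtain f where f: "f \<in> ?D" "X \<in> En f" "col0 f = c" using Xc by auto
      have "col0 e = c"
        using e co[of e] Xa ac D'[of e] unfolding free_def by (auto split: if_splits)
      then have "e = f" using uq[of e f X] e f D'[OF f(1)] by auto
      then show False using e co[of e] f ac by auto
    qed
    \<comment> \<open>The exceptional vertex is \<open>y\<close>. The inner vertices of the path
      have an edge of colour \<open>c\<close> and never missed it, and vertices off the path see no
      change.\<close>
    have ends: "if p = y then free ?col p \<alpha> else free ?col p c" if p: "p \<noteq> X" "free col0 p c" for p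
    proof (cases "p = y")
      case True
      have "P \<noteq> c" using p F y True unfolding free_def by auto
      then have P: "P = \<alpha>" "Q = c" using PQ by auto
      have "free ?col y \<alpha>" unfolding free_def
      proof (intro allI impI notI)
        fix e assume e: "e < n" "y \<in> En e" "?col e = \<alpha>"
        show False
        proof (cases "e \<in> ?D")
          case True
          then have "col0 e = c" using e co[of e] ac D'[OF True] by (auto split: if_splits)
          then show False using noQ e P by auto
        next
          case False
          then have "col0 e = \<alpha>" using e co[of e] by auto
          then have "e = F" using uq[of e F y] e F P y by auto
          then show False using False by auto
        qed
      qed
      then show ?thesis using True by auto
    next
      case False
      have "e \<notin> ?D" if pe: "p \<in> En e" for e
      proof
        assume "e \<in> ?D"
        then obtain f where "f \<in> ?D" "p \<in> En f" "col0 f = c"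
          using both'[OF p(1) False \<open>e \<in> ?D\<close> pe] by blast
        then show False using p D'[of f] unfolding free_def by auto
      qed
      then have "?col e = col0 e" if "p \<in> En e" for e using co that by metis
      then have "free ?col p c" using p(2) unfolding free_def by metis
      then show ?thesis using False by simp
    qed
    have oth: "free ?col p d = free col0 p d" if "d \<noteq> \<alpha>" "d \<noteq> c" for d p
    proof -
      have "?col e = d \<longleftrightarrow> col0 e = d" for e
      proof (cases "e \<in> ?D")
        case True
        then show ?thesis using co[of e] D'[OF True] that by auto
      next
        case False
        then show ?thesis using co[of e] by metis
      qed
      then show ?thesis unfolding free_def by blast
    qed
    show "kempe_swap K X \<alpha> c col0 (col(F := Q))"
      unfolding kempe_swap_def
    proof (intro conjI)
      show "\<forall>e<n. (?col e = 0) = (col0 e = 0)" using co D' ac by auto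
      show "\<exists>t. \<forall>p. p \<noteq> X \<longrightarrow> free col0 p c \<longrightarrow> (if p = t then free ?col p \<alpha> else free ?col p c)"
        using ends by blast
      show "\<forall>e<n. col0 e \<noteq> \<alpha> \<longrightarrow> col0 e \<noteq> c \<longrightarrow> ?col e = col0 e" using co D' by auto
      show "\<forall>e<n. X \<in> En e \<longrightarrow> col0 e = c \<longrightarrow> ?col e = \<alpha>"
      proof (intro allI impI)
        fix e assume e: "e < n" "X \<in> En e" "col0 e = c"
        obtain f where f: "f \<in> ?D" "X \<in> En f" "col0 f = c" using Xc by auto
        then have "e = f" using uq[of e f X] e D'[OF f(1)] by auto
        then show "?col e = \<alpha>" using e f co[of e] ac by auto
      qed
    qed (use pcF frX oth in auto)
  }
  {
    assume f2: "F2 < n" "y \<in> En F2" "col F2 = Q"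
    note q = yQ[OF f2]
    show yf: "free (col(F2 := 0)) y Q"
      unfolding free_def
    proof (intro allI impI notI)
      fix e assume e: "e < n" "y \<in> En e" "(col(F2 := 0)) e = Q"
      then have "e \<noteq> F2" "col e = col F2" using Q f2 by (auto split: if_splits)
      then show False using pcol_unique[OF pc e(1) f2(1) e(2) f2(2)] Q f2(3) by simp
    qed
    show zf: "free (col(F2 := 0)) Z Q" using ZQ Q unfolding free_def by auto
    have "pcol K (col(F2 := 0, F := Q))"
      using yf zf y Q by (intro pcol_set pcol_unset pc) auto
    moreover have "col(F2 := 0, F := Q) =
       (\<lambda>e. if e = F2 then 0 else if e \<in> insert F D then (if col0 e = \<alpha> then c else \<alpha>) else col0 e)"
      using q PQ ac F by (auto simp: fun_eq_iff col)
    moreover have "\<forall>e\<in>insert F D. e < n \<and> (col0 e = \<alpha> \<or> col0 e = c)" using D F PQ by auto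
    moreover have "\<exists>e\<in>insert F D. y \<in> En e \<and> col0 e = P" using F y by auto
    ultimately show "chain_inv K col0 X \<alpha> c (insert F D) y Q P F2 (col(F2 := 0, F := Q))"
      unfolding chain_inv_def using pc0 ac Xa f2 q PQ yX Xc both' by auto
  }
qed

section \<open>Degrees, multiplicities and missing colours\<close>

definition deg :: "nat \<Rightarrow> nat" where
  "deg v = card {e. e < n \<and> v \<in> En e}"

definition mult :: "nat set \<Rightarrow> nat" where
  "mult S = card {e. e < n \<and> En e = S}"

definition free_set :: "nat \<Rightarrow> (nat \<Rightarrow> nat) \<Rightarrow> nat \<Rightarrow> nat set" where
  "free_set K col v = {c. 0 < c \<and> c < K \<and> free col v c}"

lemma finite_free_set [simp]: "finite (free_set K col v)"
  unfolding free_set_def by (rule finite_subset[of _ "{..<K}"]) auto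

text \<open>Each of the \<open>K - 1\<close> colours that is not missing at \<open>v\<close> is worn
  by an edge at \<open>v\<close>. An uncoloured edge wears none, and this gains a unit on which the
  bound for three fan vertices depends.\<close>

lemma card_free_set:
  assumes "pcol K col"
  shows "K \<le> Suc (card (free_set K col v) + deg v)"
    and "E < n \<Longrightarrow> v \<in> En E \<Longrightarrow> col E = 0 \<Longrightarrow> K \<le> card (free_set K col v) + deg v"
proof -
  let ?A = "{e. e < n \<and> v \<in> En e \<and> col e \<noteq> 0}"
  let ?B = "{e. e < n \<and> v \<in> En e}"
  have "{0<..<K} \<subseteq> free_set K col v \<union> col ` ?A"
  proof
    fix c assume c: "c \<in> {0<..<K}"
    show "c \<in> free_set K col v \<union> col ` ?A"
    proof (cases "free col v c")
      case True
      then show ?thesis using c unfolding free_set_def by simp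
    next
      case False
      then obtain e where "e < n" "v \<in> En e" "col e = c" unfolding free_def by blast
      then show ?thesis using c by (intro UnI2 image_eqI[of _ _ e]) simp_all
    qed
  qed
  then have "card {0<..<K} \<le> card (free_set K col v \<union> col ` ?A)" by (intro card_mono) auto
  also have "\<dots> \<le> card (free_set K col v) + card (col ` ?A)" by (rule card_Un_le)
  also have "\<dots> \<le> card (free_set K col v) + card ?A" by (simp add: card_image_le)
  finally have *: "K \<le> Suc (card (free_set K col v) + card ?A)" by simp
  have "card ?A \<le> card ?B" by (intro card_mono) auto
  with * show "K \<le> Suc (card (free_set K col v) + deg v)" unfolding deg_def by simp
  assume E: "E < n" "v \<in> En E" "col E = 0"
  have "E \<in> ?B" "E \<notin> ?A" using E by simp_all
  then have "?A \<subset> ?B" by blast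
  then have "card ?A < card ?B" by (intro psubset_card_mono) simp_all
  with * show "K \<le> card (free_set K col v) + deg v" unfolding deg_def by simp
qed

lemma mult_le_deg:
  assumes "distinct vs"
  shows "(\<Sum>v\<leftarrow>vs. mult {x, v}) \<le> deg x"
proof -
  have "(\<Sum>v\<leftarrow>vs. mult {x, v}) = (\<Sum>v\<in>set vs. mult {x, v})"
    using assms by (simp add: sum_list_distinct_conv_sum_set)
  also have "\<dots> = card (\<Union>v\<in>set vs. {e. e < n \<and> En e = {x, v}})"
    unfolding mult_def by (subst card_UN_disjoint) (auto simp: doubleton_eq_iff)
  also have "\<dots> \<le> deg x" unfolding deg_def by (intro card_mono) auto
  finally show ?thesis .
qed

text \<open>Different colours sit on different parallel edges; an uncoloured one among these makes
  the count strict.\<close>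

lemma card_free_le_mult:
  fixes col :: "nat \<Rightarrow> nat"
  assumes "\<And>c. 0 < c \<Longrightarrow> c < K \<Longrightarrow> c \<in> S \<Longrightarrow> \<exists>e<n. En e = T \<and> col e = c"
    and "S \<subseteq> {0<..<K}"
  shows "card S \<le> mult T" "E < n \<Longrightarrow> En E = T \<Longrightarrow> col E = 0 \<Longrightarrow> card S < mult T"
proof -
  let ?A = "{e. e < n \<and> En e = T \<and> col e \<noteq> 0}"
  let ?B = "{e. e < n \<and> En e = T}"
  have "S \<subseteq> col ` ?A"
  proof
    fix c assume "c \<in> S"
    then have c: "0 < c" "c < K" using assms(2) by auto
    then obtain e where "e < n" "En e = T" "col e = c" using assms(1)[OF c] \<open>c \<in> S\<close> by blast
    then show "c \<in> col ` ?A" using c by (intro image_eqI[of _ _ e]) auto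
  qed
  then have "card S \<le> card (col ` ?A)" by (intro card_mono) auto
  also have "\<dots> \<le> card ?A" by (simp add: card_image_le)
  finally have 1: "card S \<le> card ?A" .
  moreover have "card ?A \<le> card ?B" by (intro card_mono) auto
  ultimately show "card S \<le> mult T" unfolding mult_def by simp
  assume E: "E < n" "En E = T" "col E = 0"
  have "E \<in> ?B" "E \<notin> ?A" using E by simp_all
  then have "?A \<subset> ?B" by blast
  then have "card ?A < card ?B" by (intro psubset_card_mono) simp_all
  with 1 show "card S < mult T" unfolding mult_def by simp
qed

definition disjoint_free :: "nat \<Rightarrow> (nat \<Rightarrow> nat) \<Rightarrow> nat \<Rightarrow> nat \<Rightarrow> bool" where
  "disjoint_free K col u v \<longleftrightarrow> (\<forall>c. 0 < c \<longrightarrow> c < K \<longrightarrow> \<not> (free col u c \<and> free col v c))"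

text \<open>Maximality of the fan \<open>Y\<close>, \<open>V\<close> at \<open>X\<close>.\<close>

definition closed_fan :: "nat \<Rightarrow> (nat \<Rightarrow> nat) \<Rightarrow> nat \<Rightarrow> nat \<Rightarrow> nat \<Rightarrow> bool" where
  "closed_fan K col X Y V \<longleftrightarrow> (\<forall>c e. 0 < c \<longrightarrow> c < K \<longrightarrow> free col Y c \<or> free col V c \<longrightarrow>
     e < n \<longrightarrow> X \<in> En e \<longrightarrow> col e = c \<longrightarrow> En e = {X, Y} \<or> En e = {X, V})"

text \<open>The colour occurs at \<open>X\<close> by disjointness, on an edge to \<open>Y\<close> or
  \<open>V\<close> by maximality, and not to \<open>V\<close>, where it is missing. So the number of
  colours missing at \<open>V\<close> is bounded by a multiplicity.\<close>

lemma closed_fan_edge: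
  assumes "closed_fan K col X Y V" "disjoint_free K col X V" "V \<noteq> X" "V \<noteq> Y" "0 < c" "c < K" "free col V c"
  shows "\<exists>e<n. En e = {X, Y} \<and> col e = c"
proof -
  have "\<not> free col X c" using assms unfolding disjoint_free_def by blast
  then obtain e where e: "e < n" "X \<in> En e" "col e = c" unfolding free_def by blast
  moreover have "V \<notin> En e" using e assms(7) unfolding free_def by blast
  ultimately show ?thesis using assms unfolding closed_fan_def by blast
qed

lemma closed_fan_edge':
  assumes "closed_fan K col X Y V" "disjoint_free K col X Y" "V \<noteq> X" "V \<noteq> Y" "0 < c" "c < K" "free col Y c"
  shows "\<exists>e<n. En e = {X, V} \<and> col e = c"
proof -
  have "\<not> free col X c" using assms unfolding disjoint_free_def by blast
  then obtain e where e: "e < n" "X \<in> En e" "col e = c" unfolding free_def by blast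
  moreover have "Y \<notin> En e" using e assms(7) unfolding free_def by blast
  ultimately show ?thesis using assms unfolding closed_fan_def by blast
qed

text \<open>In the end \<open>h\<close> gets \<open>col H\<close>, both \<open>H\<close> and
  \<open>G\<close> get \<open>c\<close>, and \<open>E\<close> gets \<open>col G\<close>. Uncolouring
  \<open>h\<close> releases \<open>c\<close> at \<open>X\<close> and \<open>Y\<close>, so
  \<open>G\<close> and \<open>H\<close> may take it, as \<open>V\<close> and \<open>W\<close> miss
  it and are different; \<open>H\<close> thereby releases its colour at \<open>Y\<close> for
  \<open>h\<close>, and \<open>G\<close> its colour at \<open>X\<close> for \<open>E\<close>. The
  intermediate colourings are recorded because the table changes one edge at a time.\<close>

lemma diamond_recolour:
  assumes pc: "pcol K col" and E: "E < n" "En E = {X, Y}" "X \<noteq> Y" "col E = 0"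
    and V: "spoke X Y col V G" "free col Y (col G)"
    and W: "spoke Y X col W H" "free col X (col H)"
    and VW: "V \<noteq> W" and c: "0 < c" "c < K" "free col V c" "free col W c"
    and h: "h < n" "En h = {X, Y}" "col h = c"
  shows "free (col(h := 0, H := 0, G := 0)) X (col H)" "free (col(h := 0, H := 0, G := 0)) Y (col H)"
    "pcol K (col(h := 0, H := 0, G := 0, h := col H))"
    "free (col(h := 0, H := 0, G := 0, h := col H)) Y c" "free (col(h := 0, H := 0, G := 0, h := col H)) W c"
    "pcol K (col(h := 0, H := 0, G := 0, h := col H, H := c))"
    "free (col(h := 0, H := 0, G := 0, h := col H, H := c)) X c"
    "free (col(h := 0, H := 0, G := 0, h := col H, H := c)) V c"
    "pcol K (col(h := 0, H := 0, G := 0, h := col H, H := c, G := c))"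
    "free (col(h := 0, H := 0, G := 0, h := col H, H := c, G := c)) X (col G)"
    "free (col(h := 0, H := 0, G := 0, h := col H, H := c, G := c)) Y (col G)"
    "pcol K (col(h := 0, H := 0, G := 0, h := col H, H := c, G := c, E := col G))"
proof -
  let ?c0 = "col(h := 0, H := 0, G := 0)"
  let ?c1 = "?c0(h := col H)"
  let ?c2 = "?c1(H := c)"
  let ?c3 = "?c2(G := c)"
  have G: "G < n" "En G = {X, V}" "V \<noteq> X" "V \<noteq> Y" "col G \<noteq> 0" "V \<noteq> 0"
    using V unfolding spoke_def by auto
  have H: "H < n" "En H = {Y, W}" "W \<noteq> X" "W \<noteq> Y" "col H \<noteq> 0" "W \<noteq> 0"
    using W unfolding spoke_def by auto
  have ne: "h \<noteq> G" "h \<noteq> H" "G \<noteq> H" "E \<noteq> h" "E \<noteq> G" "E \<noteq> H"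
  proof -
    have XY: "X \<in> En h" "Y \<in> En h" "X \<notin> En H" "Y \<notin> En G" "X \<in> En G" using G H h E by auto
    then show "h \<noteq> G" "h \<noteq> H" "G \<noteq> H" by metis+
    show "E \<noteq> h" "E \<noteq> G" "E \<noteq> H" using E(4) h(3) c(1) G(5) H(5) by auto
  qed
  have cc: "col G \<noteq> c" "col H \<noteq> c" "col G \<noteq> col H"
    using V(2) W(2) h c G H unfolding free_def by auto
  have lt: "col G < K" "col H < K" using pc G H unfolding pcol_def by auto
  have uq: "e = f" if "e < n" "f < n" "v \<in> En e" "v \<in> En f" "col e = col f" "col e \<noteq> 0"
    for e f v using pcol_unique[OF pc that] .
  have atX: "col e \<noteq> c" "col e \<noteq> col G" if "e < n" "X \<in> En e" "e \<noteq> h" "e \<noteq> G" for e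
    using that uq[of e h X] uq[of e G X] h G c by auto
  have atY: "col e \<noteq> c" "col e \<noteq> col H" if "e < n" "Y \<in> En e" "e \<noteq> h" "e \<noteq> H" for e
    using that uq[of e h Y] uq[of e H Y] h H c by auto
  have XE: "X \<notin> En H" "Y \<notin> En G" using G H E by auto
  have c0: "\<And>e. ?c0 e = (if e = h \<or> e = H \<or> e = G then 0 else col e)"
    and c1: "\<And>e. ?c1 e = (if e = h then col H else if e = H \<or> e = G then 0 else col e)"
    and c2: "\<And>e. ?c2 e = (if e = h then col H else if e = H then c else if e = G then 0 else col e)"
    and c3: "\<And>e. ?c3 e = (if e = h then col H else if e = H then c else if e = G then c else col e)"
    using ne by auto
  have p0: "pcol K ?c0" by (intro pcol_unset pc)
  show f1: "free ?c0 X (col H)" "free ?c0 Y (col H)"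
    unfolding free_def c0 using W(2)[unfolded free_def] atY(2) H(5) by auto
  then show p1: "pcol K ?c1" using lt h(2) by (intro pcol_set p0) auto
  show f2: "free ?c1 Y c" "free ?c1 W c"
    unfolding free_def c1 using atY(1) cc c(1) c(4)[unfolded free_def] by auto
  then show p2: "pcol K ?c2" using c(2) H(2) by (intro pcol_set p1) auto
  have "V \<notin> En H" using G H VW by auto
  then show f3: "free ?c2 X c" "free ?c2 V c"
    unfolding free_def c2 using atX(1) cc c(1) c(3)[unfolded free_def] XE by auto
  then show p3: "pcol K ?c3" using c(2) G(2) by (intro pcol_set p2) auto
  show f4: "free ?c3 X (col G)"
    unfolding free_def
  proof (intro allI impI)
    fix e assume "e < n" "X \<in> En e"
    then have "e = h \<or> e = G \<or> col e \<noteq> col G" using atX(2) by blast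
    then show "?c3 e \<noteq> col G" using cc c3[of e] by (auto split: if_splits)
  qed
  show f4': "free ?c3 Y (col G)"
    unfolding free_def
  proof (intro allI impI)
    fix e assume "e < n" "Y \<in> En e"
    then have "col e \<noteq> col G" using V(2) unfolding free_def by blast
    then show "?c3 e \<noteq> col G" using cc c3[of e] by (simp split: if_splits)
  qed
  show "pcol K (?c3(E := col G))"
  proof (rule pcol_set[OF p3 lt(1)])
    fix v assume "v \<in> En E"
    then have "v = X \<or> v = Y" using E(2) by blast
    then show "free ?c3 v (col G)" using f4 f4' by blast
  qed
qed

end

text \<open>All that the colouring argument uses of the bound: its values on two families of cliques
  of the line graph, the stars and the edges spanned by three vertices of the root.\<close>

locale gamma_ends = multi_ends +
  fixes \<Gamma> :: nat
  assumes degree_bound: "e < n \<Longrightarrow> En e = {u, v} \<Longrightarrow> 2 * deg u + deg v \<le> 2 * \<Gamma> + mult {u, v}"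
    and triangle_bound: "e < n \<Longrightarrow> En e = {u, v} \<Longrightarrow> w \<notin> {u, v} \<Longrightarrow>
      deg u + deg v + mult {u, w} + mult {v, w} \<le> 2 * \<Gamma>"
begin

text \<open>As \<open>mult {v, y} \<le> deg y\<close>, the degree bound gives
  \<open>deg v \<le> \<Gamma>\<close>. The lemma serves in the contrapositive: an end of
  \<open>E\<close> that misses no colour already proves \<open>K \<le> \<Gamma>\<close>.\<close>

lemma free_exists:
  assumes "pcol K col" "E < n" "v \<in> En E" "col E = 0" "\<Gamma> < K"
  shows "\<exists>c. 0 < c \<and> c < K \<and> free col v c"
proof -
  obtain y where y: "En E = {v, y}" "y \<noteq> v" using other_end[OF assms(2,3)] .
  have "mult {v, y} \<le> deg y" using mult_le_deg[of "[v]" y] by (simp add: insert_commute)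
  then have "deg v \<le> \<Gamma>" using degree_bound[OF assms(2) y(1)] by simp
  then have "card (free_set K col v) > 0"
    using card_free_set(2)[OF assms(1-4)] assms(5) by simp
  then have "free_set K col v \<noteq> {}" by (auto simp: card_gt_0_iff)
  then show ?thesis unfolding free_set_def by auto
qed

text \<open>Four disjoint sets of missing colours fit into \<open>K - 1\<close> colours, so
  \<open>3 * K\<close> is at most one more than the sum of the four degrees. Double this and apply
  the degree bound to the edges \<open>XY\<close>, \<open>XV2\<close>, \<open>XV3\<close> with the
  far end counted twice: of \<open>2 * deg X - 3 * deg X\<close> a term \<open>- deg X\<close>
  remains, which absorbs the three multiplicities, and
  \<open>6 * K \<le> 6 * \<Gamma> + 2\<close>.\<close>

lemma three_fan_bound:
  assumes "pcol K col" "fan X Y E V2 G2 V3 G3 col" "V3 \<noteq> 0"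
    and "disjoint_free K col X Y" "disjoint_free K col X V2" "disjoint_free K col X V3"
    "disjoint_free K col Y V2" "disjoint_free K col Y V3" "disjoint_free K col V2 V3"
  shows "K \<le> \<Gamma>"
proof -
  let ?F = "free_set K col"
  have E: "E < n" "En E = {X, Y}" "X \<noteq> Y" "col E = 0"
    and s: "spoke X Y col V2 G2" "spoke X Y col V3 G3" "V3 \<noteq> V2"
    using assms(2,3) unfolding fan_def by auto
  have d: "?F u \<inter> ?F v = {}" if "disjoint_free K col u v" for u v
    using that unfolding disjoint_free_def free_set_def by blast
  have "card (?F X \<union> ?F Y) = card (?F X) + card (?F Y)"
    by (rule card_Un_disjoint) (simp_all add: d assms(4))
  moreover have "card (?F X \<union> ?F Y \<union> ?F V2) = card (?F X \<union> ?F Y) + card (?F V2)"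
    by (rule card_Un_disjoint) (simp_all add: d assms(5,7) Int_Un_distrib2)
  moreover have "card (?F X \<union> ?F Y \<union> ?F V2 \<union> ?F V3) = card (?F X \<union> ?F Y \<union> ?F V2) + card (?F V3)"
    by (rule card_Un_disjoint) (simp_all add: d assms(6,8,9) Int_Un_distrib2)
  ultimately have "card (?F X) + card (?F Y) + card (?F V2) + card (?F V3) =
      card (?F X \<union> ?F Y \<union> ?F V2 \<union> ?F V3)" by simp
  also have "\<dots> \<le> card {0<..<K}" by (intro card_mono) (auto simp: free_set_def)
  finally have "card (?F X) + card (?F Y) + card (?F V2) + card (?F V3) \<le> K - 1" by simp
  moreover have "K \<le> card (?F X) + deg X" "K \<le> card (?F Y) + deg Y"
    using card_free_set(2)[OF assms(1) E(1)] E by auto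
  moreover have "K \<le> Suc (card (?F V2) + deg V2)" "K \<le> Suc (card (?F V3) + deg V3)"
    using card_free_set(1)[OF assms(1)] by auto
  moreover have "mult {X, Y} + mult {X, V2} + mult {X, V3} \<le> deg X"
    using mult_le_deg[of "[Y, V2, V3]" X] s unfolding spoke_def by auto
  moreover have "2 * deg Y + deg X \<le> 2 * \<Gamma> + mult {X, Y}"
    using degree_bound[of E Y X] E by (auto simp: insert_commute)
  moreover have "2 * deg V2 + deg X \<le> 2 * \<Gamma> + mult {X, V2}"
    using degree_bound[of G2 V2 X] s unfolding spoke_def by (auto simp: insert_commute)
  moreover have "2 * deg V3 + deg X \<le> 2 * \<Gamma> + mult {X, V3}"
    using degree_bound[of G3 V3 X] s unfolding spoke_def by (auto simp: insert_commute)
  ultimately show ?thesis by linarith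
qed

text \<open>The colours missing at \<open>Y\<close> sit on edges \<open>XV\<close>, those missing at
  \<open>V\<close> on edges \<open>XY\<close>, one of which is uncoloured. Adding the two counts
  gives \<open>2 * K \<le> deg Y + deg V + mult {X, V} + mult {X, Y}\<close>, which the triangle
  bound for the edge \<open>YV\<close> limits to \<open>2 * \<Gamma>\<close>.\<close>

lemma triangle_fan_bound:
  assumes "pcol K col" "E < n" "En E = {X, Y}" "X \<noteq> Y" "col E = 0" "V \<noteq> X" "V \<noteq> Y"
    and "closed_fan K col X Y V" "disjoint_free K col X Y" "disjoint_free K col X V"
    and "H < n" "En H = {Y, V}"
  shows "K \<le> \<Gamma>"
proof -
  let ?F = "free_set K col"
  have "card (?F Y) \<le> mult {X, V}"
    using closed_fan_edge'[OF assms(8,9,6,7)]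
    by (intro card_free_le_mult(1)[of K]) (auto simp: free_set_def)
  moreover have "card (?F V) < mult {X, Y}"
    using closed_fan_edge[OF assms(8,10,6,7)] assms(2,3,5)
    by (intro card_free_le_mult(2)[of K _ _ col]) (auto simp: free_set_def)
  moreover have "K \<le> card (?F Y) + deg Y"
    using card_free_set(2)[OF assms(1,2)] assms by auto
  moreover have "K \<le> Suc (card (?F V) + deg V)"
    using card_free_set(1)[OF assms(1)] by auto
  moreover have "deg Y + deg V + mult {X, Y} + mult {X, V} \<le> 2 * \<Gamma>"
    using triangle_bound[OF assms(11,12), of X] assms(4,6) by (auto simp: insert_commute)
  ultimately show ?thesis by linarith
qed

text \<open>The colours missing at \<open>V\<close> and those missing at \<open>W\<close> all sit on
  coloured edges \<open>XY\<close>, so these two disjoint sets have fewer than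
  \<open>mult {X, Y}\<close> members together. The degree bounds of \<open>XV\<close> and
  \<open>YW\<close> turn this into \<open>4 * K \<le> 4 * \<Gamma> + 2\<close>.\<close>

lemma two_fans_bound:
  assumes "pcol K col" "E < n" "En E = {X, Y}" "X \<noteq> Y" "col E = 0"
    and V: "spoke X Y col V G" and W: "spoke Y X col W H"
    and "closed_fan K col X Y V" "closed_fan K col Y X W"
    and "disjoint_free K col X V" "disjoint_free K col Y W" "disjoint_free K col V W"
  shows "K \<le> \<Gamma>"
proof -
  let ?F = "free_set K col"
  have v: "G < n" "En G = {X, V}" "V \<noteq> X" "V \<noteq> Y" using V unfolding spoke_def by auto
  have w: "H < n" "En H = {Y, W}" "W \<noteq> X" "W \<noteq> Y" using W unfolding spoke_def by auto
  have "card (?F V \<union> ?F W) < mult {X, Y}"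
    using closed_fan_edge[OF assms(8,10) v(3,4)] closed_fan_edge[OF assms(9,11) w(4,3)] assms(2,3,5)
    by (intro card_free_le_mult(2)[of K _ _ col]) (auto simp: free_set_def insert_commute)
  moreover have "card (?F V \<union> ?F W) = card (?F V) + card (?F W)"
    using assms(12) unfolding disjoint_free_def by (subst card_Un_disjoint) (auto simp: free_set_def)
  moreover have "K \<le> Suc (card (?F V) + deg V)" "K \<le> Suc (card (?F W) + deg W)"
    using card_free_set(1)[OF assms(1)] by auto
  moreover have "2 * deg V + deg X \<le> 2 * \<Gamma> + mult {X, V}"
    using degree_bound[of G V X] v by (auto simp: insert_commute)
  moreover have "2 * deg W + deg Y \<le> 2 * \<Gamma> + mult {Y, W}"
    using degree_bound[of H W Y] w by (auto simp: insert_commute)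
  moreover have "mult {X, Y} + mult {X, V} \<le> deg X"
    using mult_le_deg[of "[Y, V]" X] v by auto
  moreover have "mult {X, Y} + mult {Y, W} \<le> deg Y"
    using mult_le_deg[of "[X, W]" Y] w by (auto simp: insert_commute)
  ultimately show ?thesis by linarith
qed

end

section \<open>Reconstructing a root of a line graph\<close>

definition root_on :: "nat set \<Rightarrow> (nat \<Rightarrow> nat \<Rightarrow> bool) \<Rightarrow> (nat \<Rightarrow> nat set) \<Rightarrow> bool" where
  "root_on R ad r \<longleftrightarrow> (\<forall>e\<in>R. card (r e) = 2) \<and> inj_on r R \<and>
     (\<forall>e\<in>R. \<forall>f\<in>R. ad e f \<longleftrightarrow> e \<noteq> f \<and> r e \<inter> r f \<noteq> {})"

text \<open>The labels \<open>1, \<dots>, L\<close> name root vertices via \<open>\<phi>\<close>; \<open>a e\<close> and \<open>b e\<close> are the labels of the ends of \<open>e\<close>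
  that have been named so far, 0 standing for none.\<close>

definition labelled ::
  "nat set \<Rightarrow> (nat \<Rightarrow> nat set) \<Rightarrow> (nat \<Rightarrow> nat) \<Rightarrow> nat \<Rightarrow> (nat \<Rightarrow> nat) \<Rightarrow> (nat \<Rightarrow> nat) \<Rightarrow> bool" where
  "labelled R r \<phi> L a b \<longleftrightarrow> inj_on \<phi> {1..L} \<and> (\<forall>e\<in>R. a e \<le> L \<and> b e \<le> L \<and>
     (a e = 0 \<longrightarrow> b e = 0) \<and> (a e \<noteq> 0 \<longrightarrow> a e \<noteq> b e) \<and>
     (\<forall>j\<in>{1..L}. a e = j \<or> b e = j \<longleftrightarrow> \<phi> j \<in> r e))"

text \<open>The root is quantified anew at each stage: a step may exchange it for another, as long
  as the labels given so far stay correct.\<close>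

definition partial_root ::
  "nat set \<Rightarrow> (nat \<Rightarrow> nat \<Rightarrow> bool) \<Rightarrow> nat \<Rightarrow> (nat \<Rightarrow> nat) \<Rightarrow> (nat \<Rightarrow> nat) \<Rightarrow> bool" where
  "partial_root R ad L a b \<longleftrightarrow> (\<exists>r \<phi>. root_on R ad r \<and> labelled R r \<phi> L a b)"

definition label_first :: "nat set \<Rightarrow> nat \<Rightarrow> (nat \<Rightarrow> nat) \<Rightarrow> nat \<Rightarrow> nat" where
  "label_first S l a g = (if g \<in> S \<and> a g = 0 then l else a g)"

definition label_second :: "nat set \<Rightarrow> nat \<Rightarrow> (nat \<Rightarrow> nat) \<Rightarrow> (nat \<Rightarrow> nat) \<Rightarrow> nat \<Rightarrow> nat" where
  "label_second S l a b g = (if g \<in> S \<and> a g \<noteq> 0 then l else b g)"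

lemma card_2_third:
  assumes "card S = 2" "x \<in> S" "y \<in> S" "z \<in> S" "x \<noteq> y" shows "z = x \<or> z = y"
  using assms unfolding card_2_iff by auto

lemma card_2_other:
  assumes "card S = 2" "x \<in> S" obtains y where "S = {x, y}" "y \<noteq> x"
proof -
  obtain a b where "S = {a, b}" "a \<noteq> b" using assms(1) unfolding card_2_iff by auto
  then show thesis using that[of a] that[of b] assms(2) by (auto simp: insert_commute)
qed

lemma labelledD:
  assumes "labelled R r \<phi> L a b" "e \<in> R"
  shows "a e \<le> L" "b e \<le> L" "a e = 0 \<Longrightarrow> b e = 0" "a e \<noteq> 0 \<Longrightarrow> a e \<noteq> b e"
    "1 \<le> j \<Longrightarrow> j \<le> L \<Longrightarrow> a e = j \<or> b e = j \<longleftrightarrow> \<phi> j \<in> r e"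
  using assms unfolding labelled_def by (blast, blast, blast, blast, simp)

lemma labelled_full:
  assumes "labelled R r \<phi> L a b" "root_on R ad r" "e \<in> R" "a e \<noteq> 0" "b e \<noteq> 0"
  shows "r e = {\<phi> (a e), \<phi> (b e)}" "\<phi> (a e) \<noteq> \<phi> (b e)"
proof -
  have 1: "a e \<in> {1..L}" "b e \<in> {1..L}" "a e \<noteq> b e"
    using labelledD[OF assms(1,3)] assms(4,5) by auto
  then have 2: "\<phi> (a e) \<in> r e" "\<phi> (b e) \<in> r e"
    using labelledD(5)[OF assms(1,3), of "a e"] labelledD(5)[OF assms(1,3), of "b e"] by auto
  show ne: "\<phi> (a e) \<noteq> \<phi> (b e)"
    using assms(1) 1 unfolding labelled_def inj_on_def by blast
  have "card (r e) = 2" using assms unfolding root_on_def by auto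
  then show "r e = {\<phi> (a e), \<phi> (b e)}" using card_2_third[OF _ 2] ne 2 by blast
qed

lemma labelled_none:
  assumes "labelled R r \<phi> L a b" "e \<in> R" "a e = 0" shows "r e \<inter> \<phi> ` {1..L} = {}"
proof -
  have "\<phi> j \<notin> r e" if "j \<in> {1..L}" for j
  proof -
    have "b e = 0" "a e = j \<or> b e = j \<longleftrightarrow> \<phi> j \<in> r e"
      using assms that unfolding labelled_def by blast+
    then show ?thesis using assms(3) that by auto
  qed
  then show ?thesis by auto
qed

text \<open>An edge with two labels has both its ends named and cannot contain the unnamed vertex
  \<open>y\<close>, so every edge in the star of \<open>y\<close> still has an empty slot.\<close>

lemma partial_root_add:
  assumes root: "root_on R ad r" and lab: "labelled R r \<phi> L a b" and y: "y \<notin> \<phi> ` {1..L}"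
    and S: "{g \<in> R. y \<in> r g} = {g \<in> R. g \<in> S}"
  shows "partial_root R ad (Suc L) (label_first S (Suc L) a) (label_second S (Suc L) a b)"
proof -
  let ?\<phi> = "\<phi>(Suc L := y)"
  let ?a = "label_first S (Suc L) a" and ?b = "label_second S (Suc L) a b"
  have S': "g \<in> S \<longleftrightarrow> y \<in> r g" if "g \<in> R" for g using S that by blast
  have b0: "b g = 0" if g: "g \<in> R" "y \<in> r g" for g
  proof (rule ccontr)
    assume "b g \<noteq> 0"
    moreover from this have "a g \<noteq> 0" using lab g unfolding labelled_def by metis
    ultimately have "r g = {\<phi> (a g), \<phi> (b g)}" "a g \<in> {1..L}" "b g \<in> {1..L}"
      using labelled_full(1)[OF lab root g(1)] lab g(1) unfolding labelled_def by auto
    then show False using y g(2) by auto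
  qed
  have "inj_on ?\<phi> {1..Suc L}"
  proof -
    have "inj_on ?\<phi> {1..L}" using lab y unfolding labelled_def by (blast intro: inj_on_fun_updI)
    then show ?thesis using y by (simp add: atLeastAtMostSuc_conv)
  qed
  moreover have "?a e \<le> Suc L \<and> ?b e \<le> Suc L \<and> (?a e = 0 \<longrightarrow> ?b e = 0) \<and> (?a e \<noteq> 0 \<longrightarrow> ?a e \<noteq> ?b e) \<and>
     (\<forall>j\<in>{1..Suc L}. ?a e = j \<or> ?b e = j \<longleftrightarrow> ?\<phi> j \<in> r e)" if e: "e \<in> R" for e
  proof -
    have l: "a e \<le> L" "b e \<le> L" "a e = 0 \<longrightarrow> b e = 0" "a e \<noteq> 0 \<longrightarrow> a e \<noteq> b e"
      and l': "\<And>j. j \<in> {1..L} \<Longrightarrow> a e = j \<or> b e = j \<longleftrightarrow> \<phi> j \<in> r e"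
      using lab e unfolding labelled_def by blast+
    have "?a e = j \<or> ?b e = j \<longleftrightarrow> ?\<phi> j \<in> r e" if j: "j \<in> {1..Suc L}" for j
    proof (cases "j = Suc L")
      case True
      then show ?thesis using l S'[OF e] unfolding label_first_def label_second_def by auto
    next
      case False
      then have "j \<in> {1..L}" "j \<noteq> 0" using j by auto
      then show ?thesis using l'[of j] b0[OF e] S'[OF e] False
        unfolding label_first_def label_second_def by auto
    qed
    moreover have "?a e \<le> Suc L \<and> ?b e \<le> Suc L \<and> (?a e = 0 \<longrightarrow> ?b e = 0) \<and> (?a e \<noteq> 0 \<longrightarrow> ?a e \<noteq> ?b e)"
      using l unfolding label_first_def label_second_def by auto
    ultimately show ?thesis by blast
  qed
  ultimately have "labelled R r ?\<phi> (Suc L) ?a ?b" unfolding labelled_def by blast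
  then show ?thesis using root unfolding partial_root_def by blast
qed

text \<open>The root is simple, so an edge containing both ends of \<open>F\<close> is
  \<open>F\<close>. The other edges at the unnamed end are thus the neighbours of \<open>F\<close>
  that avoid the named end, and labels suffice to recognise them.\<close>

lemma partial_root_extend:
  assumes "partial_root R ad L a b" "F \<in> R" "a F \<noteq> 0" "b F = 0"
    and S: "\<And>g. g \<in> R \<Longrightarrow> g \<in> S \<longleftrightarrow> g = F \<or> ad F g \<and> a g \<noteq> a F \<and> b g \<noteq> a F"
  shows "partial_root R ad (Suc L) (label_first S (Suc L) a) (label_second S (Suc L) a b)"
proof -
  obtain r \<phi> where root: "root_on R ad r" and lab: "labelled R r \<phi> L a b"
    using assms(1) unfolding partial_root_def by blast
  let ?x = "\<phi> (a F)"
  have aF: "a F \<in> {1..L}" using labelledD(1)[OF lab assms(2)] assms(3) by auto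
  then have at: "g \<in> R \<Longrightarrow> a g = a F \<or> b g = a F \<longleftrightarrow> ?x \<in> r g" for g
    using labelledD(5)[OF lab, of g "a F"] by auto
  then have xF: "?x \<in> r F" using assms(2) by auto
  have c2: "card (r F) = 2" using root assms(2) unfolding root_on_def by auto
  obtain y where y: "r F = {?x, y}" "y \<noteq> ?x" using card_2_other[OF c2 xF] .
  have "y \<notin> \<phi> ` {1..L}"
  proof
    assume "y \<in> \<phi> ` {1..L}"
    then obtain j where j: "j \<in> {1..L}" "y = \<phi> j" by auto
    then have "a F = j \<or> b F = j" using labelledD(5)[OF lab assms(2), of j] y by auto
    then show False using j y(2) assms(4) by auto
  qed
  moreover have "{g \<in> R. y \<in> r g} = {g \<in> R. g \<in> S}"
  proof (intro Collect_cong conj_cong refl)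
    fix g assume g: "g \<in> R"
    have "y \<in> r g \<longleftrightarrow> g = F \<or> ad F g \<and> ?x \<notin> r g"
    proof
      assume yg: "y \<in> r g"
      show "g = F \<or> ad F g \<and> ?x \<notin> r g"
      proof (cases "g = F")
        case False
        have "?x \<notin> r g"
        proof
          assume "?x \<in> r g"
          moreover have "card (r g) = 2" using root g unfolding root_on_def by auto
          ultimately have "r g = r F" using y yg card_2_third[of "r g" ?x y] by auto
          then show False using root g assms(2) False unfolding root_on_def inj_on_def by auto
        qed
        moreover have "ad F g" using root g assms(2) False y yg unfolding root_on_def by auto
        ultimately show ?thesis by blast
      qed simp
    next
      assume "g = F \<or> ad F g \<and> ?x \<notin> r g"
      then show "y \<in> r g" using root g assms(2) y unfolding root_on_def by auto
    qed
    then show "y \<in> r g \<longleftrightarrow> g \<in> S" using S[OF g] at[OF g] by auto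
  qed
  ultimately show ?thesis by (rule partial_root_add[OF root lab])
qed

text \<open>Since \<open>card (A \<union> B) + card (A \<inter> B) = 4\<close>, two pairs cover the
  four points iff they are disjoint. Complementation is the symmetry of the line graph of the
  complete graph on four vertices that exchanges its stars and triangles.\<close>

lemma card_complement_root:
  fixes A B V :: "nat set"
  assumes "card V = 4" "A \<subseteq> V" "B \<subseteq> V" "card A = 2" "card B = 2"
  shows "card (V - A) = 2" "(V - A) \<inter> (V - B) = {} \<longleftrightarrow> A \<inter> B = {}"
proof -
  have fin: "finite V" "finite A" "finite B"
    using assms card_ge_0_finite by (metis zero_less_numeral)+
  show "card (V - A) = 2" using assms fin by (simp add: card_Diff_subset)
  have "(V - A) \<inter> (V - B) = V - (A \<union> B)" by auto
  moreover have "V - (A \<union> B) = {} \<longleftrightarrow> A \<union> B = V" using assms by auto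
  moreover have "A \<union> B = V \<longleftrightarrow> card (A \<union> B) = 4"
  proof
    assume "card (A \<union> B) = 4"
    then show "A \<union> B = V" using card_subset_eq[OF fin(1), of "A \<union> B"] assms(1-3) by simp
  qed (simp add: assms(1))
  moreover have "card (A \<union> B) + card (A \<inter> B) = 4" using card_Un_Int[of A B] fin assms by simp
  moreover have "card (A \<inter> B) = 0 \<longleftrightarrow> A \<inter> B = {}" using fin by auto
  ultimately show "(V - A) \<inter> (V - B) = {} \<longleftrightarrow> A \<inter> B = {}"
    by (metis add_cancel_right_right)
qed

text \<open>No edge leaves \<open>V\<close>, so only intersections inside \<open>V\<close> are
  affected, and there complementation preserves them.\<close>

lemma root_on_complement:
  assumes root: "root_on R ad r" and V: "card V = 4"
    and comp: "\<And>g. g \<in> R \<Longrightarrow> r g \<subseteq> V \<or> r g \<inter> V = {}"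
  shows "root_on R ad (\<lambda>g. if r g \<subseteq> V then V - r g else r g)" (is "root_on R ad ?r")
proof -
  have c2: "card (r g) = 2" if "g \<in> R" for g using root that unfolding root_on_def by auto
  have ne: "r g \<noteq> {}" if "g \<in> R" for g using c2[OF that] by auto
  have out: "\<not> r g \<subseteq> V \<Longrightarrow> r g \<inter> V = {}" if "g \<in> R" for g using comp that by auto
  have int: "?r e \<inter> ?r f = {} \<longleftrightarrow> r e \<inter> r f = {}" if ef: "e \<in> R" "f \<in> R" for e f
  proof (cases "r e \<subseteq> V"; cases "r f \<subseteq> V")
    assume "r e \<subseteq> V" "r f \<subseteq> V"
    then show ?thesis using card_complement_root(2)[OF V] c2 ef by simp
  next
    assume "r e \<subseteq> V" "\<not> r f \<subseteq> V"
    then show ?thesis using out[OF ef(2)] by auto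
  next
    assume "\<not> r e \<subseteq> V" "r f \<subseteq> V"
    then show ?thesis using out[OF ef(1)] by auto
  qed auto
  have c2': "card (?r g) = 2" if "g \<in> R" for g
    using card_complement_root(1)[OF V _ _ c2[OF that] c2[OF that]] c2[OF that] by auto
  have "inj_on ?r R"
  proof (rule inj_onI)
    fix e f assume ef: "e \<in> R" "f \<in> R" "?r e = ?r f"
    have "r e \<subseteq> V \<longleftrightarrow> ?r e \<subseteq> V" "r f \<subseteq> V \<longleftrightarrow> ?r f \<subseteq> V" by auto
    then have "r e = r f" using ef by (auto split: if_splits)
    then show "e = f" using root ef unfolding root_on_def inj_on_def by auto
  qed
  moreover have "\<forall>e\<in>R. \<forall>f\<in>R. ad e f \<longleftrightarrow> e \<noteq> f \<and> ?r e \<inter> ?r f \<noteq> {}"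
    using root int unfolding root_on_def by (metis (no_types, lifting))
  ultimately show ?thesis unfolding root_on_def using c2' by blast
qed

definition cadj :: "(nat \<Rightarrow> nat \<Rightarrow> bool) \<Rightarrow> nat \<Rightarrow> nat \<Rightarrow> bool" where
  "cadj ad e f \<longleftrightarrow> e = f \<or> ad e f"

text \<open>The odd triangles of van Rooij and Wilf. \<open>u\<close> may also run over the triangle
  itself: each member is adjacent to the two others, an even count.\<close>

definition odd_triangle :: "nat set \<Rightarrow> (nat \<Rightarrow> nat \<Rightarrow> bool) \<Rightarrow> nat \<Rightarrow> nat \<Rightarrow> nat \<Rightarrow> bool" where
  "odd_triangle R ad F P Q \<longleftrightarrow>
     (\<exists>u\<in>R. odd (of_bool (ad F u) + of_bool (ad P u) + of_bool (ad Q u) :: nat))"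

lemma root_on_cadj:
  assumes "root_on R ad r" "e \<in> R" "f \<in> R" shows "cadj ad e f \<longleftrightarrow> r e \<inter> r f \<noteq> {}"
proof -
  have "card (r e) = 2" using assms unfolding root_on_def by blast
  then have "r e \<noteq> {}" by auto
  then show ?thesis using assms unfolding root_on_def cadj_def by auto
qed

lemma root_on_eq: "root_on R ad r \<Longrightarrow> e \<in> R \<Longrightarrow> f \<in> R \<Longrightarrow> r e = r f \<Longrightarrow> e = f"
  unfolding root_on_def inj_on_def by blast

lemma root_on_card2: "root_on R ad r \<Longrightarrow> e \<in> R \<Longrightarrow> card (r e) = 2"
  unfolding root_on_def by blast

lemma root_on_adjacent_pair:
  assumes "root_on R ad r" "F \<in> R" "P \<in> R" "ad F P"
  obtains u v w where "r F = {u, v}" "r P = {u, w}" "u \<noteq> v" "u \<noteq> w" "v \<noteq> w"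
proof -
  have ne: "F \<noteq> P" and int: "r F \<inter> r P \<noteq> {}" using assms unfolding root_on_def by auto
  from int obtain u where u: "u \<in> r F" "u \<in> r P" by auto
  obtain v where v: "r F = {u, v}" "v \<noteq> u"
    using card_2_other[OF root_on_card2[OF assms(1,2)] u(1)] .
  obtain w where w: "r P = {u, w}" "w \<noteq> u"
    using card_2_other[OF root_on_card2[OF assms(1,3)] u(2)] .
  have "v \<noteq> w" using root_on_eq[OF assms(1-3)] v w ne by auto
  then show thesis using that v w by auto
qed

lemma odd_triangle_star:
  assumes root: "root_on R ad r" and F: "F \<in> R" and P: "P \<in> R" "ad F P" and Q: "Q \<in> R" "ad F Q" "ad P Q"
    and odd: "odd_triangle R ad F P Q"
  shows "\<exists>y\<in>r F. {g \<in> R. y \<in> r g} = {g \<in> R. cadj ad F g \<and> cadj ad P g \<and> cadj ad Q g}"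
proof -
  obtain u v w where uvw: "r F = {u, v}" "r P = {u, w}" "u \<noteq> v" "u \<noteq> w" "v \<noteq> w"
    using root_on_adjacent_pair[OF root F P] .
  have ad: "ad e f \<longleftrightarrow> e \<noteq> f \<and> r e \<inter> r f \<noteq> {}" if "e \<in> R" "f \<in> R" for e f
    using root that unfolding root_on_def by auto
  have QFP: "r Q \<inter> {u, v} \<noteq> {}" "r Q \<inter> {u, w} \<noteq> {}" "Q \<noteq> F" "Q \<noteq> P"
    using ad[OF F Q(1)] ad[OF P(1) Q(1)] Q uvw by auto
  \<comment> \<open>Otherwise the three edges form a triangle on \<open>u\<close>, \<open>v\<close>,
    \<open>w\<close>. Any further edge has at most one of these ends and so meets none or two of the
    sides, while each side meets the two others; nothing could witness oddness.\<close>
  have uQ: "u \<in> r Q"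
  proof (rule ccontr)
    assume "u \<notin> r Q"
    then have vw: "v \<in> r Q" "w \<in> r Q" using QFP by auto
    have rQ: "r Q = {v, w}"
      using card_2_third[OF root_on_card2[OF root Q(1)] vw _ uvw(5)] vw by auto
    obtain g where g: "g \<in> R" "odd (of_bool (ad F g) + of_bool (ad P g) + of_bool (ad Q g) :: nat)"
      using odd unfolding odd_triangle_def by blast
    have g2: "card (r g) = 2" using root_on_card2[OF root g(1)] .
    obtain s t where st: "r g = {s, t}" "s \<noteq> t" using g2 unfolding card_2_iff by auto
    have eqs: "r g = r F \<Longrightarrow> g = F" "r g = r P \<Longrightarrow> g = P" "r g = r Q \<Longrightarrow> g = Q"
      using root_on_eq[OF root g(1)] F P Q by auto
    have adg: "ad F g \<longleftrightarrow> F \<noteq> g \<and> (s \<in> {u, v} \<or> t \<in> {u, v})" "ad P g \<longleftrightarrow> P \<noteq> g \<and> (s \<in> {u, w} \<or> t \<in> {u, w})"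
       "ad Q g \<longleftrightarrow> Q \<noteq> g \<and> (s \<in> {v, w} \<or> t \<in> {v, w})"
      using ad[OF F g(1)] ad[OF P(1) g(1)] ad[OF Q(1) g(1)] uvw rQ st by auto
    have "F \<noteq> P" "Q \<noteq> F" "Q \<noteq> P" using QFP ad[OF F P(1)] P by auto
    consider "g = F" | "g = P" | "g = Q" | "g \<noteq> F" "g \<noteq> P" "g \<noteq> Q" by blast
    then show False
    proof cases
      case 4
      then have "{s, t} \<noteq> {u, v}" "{s, t} \<noteq> {u, w}" "{s, t} \<noteq> {v, w}"
        using eqs st uvw rQ by auto
      then have n: "\<not> (s = u \<and> t = v)" "\<not> (s = v \<and> t = u)" "\<not> (s = u \<and> t = w)"
        "\<not> (s = w \<and> t = u)" "\<not> (s = v \<and> t = w)" "\<not> (s = w \<and> t = v)"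
        by (auto simp: insert_commute)
      have xor: "ad Q g \<longleftrightarrow> (ad F g \<longleftrightarrow> ad P g)"
        using g(2) by (cases "ad F g"; cases "ad P g"; cases "ad Q g") simp_all
      have a: "ad F g \<longleftrightarrow> s = u \<or> s = v \<or> t = u \<or> t = v" "ad P g \<longleftrightarrow> s = u \<or> s = w \<or> t = u \<or> t = w"
        "ad Q g \<longleftrightarrow> s = v \<or> s = w \<or> t = v \<or> t = w"
        using 4 unfolding adg by blast+
      consider "s = u" | "s = v" | "s = w" | "s \<noteq> u" "s \<noteq> v" "s \<noteq> w" by blast
      then show False
      proof cases
        case 1
        then have "t \<noteq> v" "t \<noteq> w" using n by auto
        with 1 show False using xor a uvw(3-5) by metis
      next
        case 2
        then have "t \<noteq> u" "t \<noteq> w" using n by auto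
        with 2 show False using xor a uvw(3-5) by metis
      next
        case 3
        then have "t \<noteq> u" "t \<noteq> v" using n by auto
        with 3 show False using xor a uvw(3-5) by metis
      next
        case 4
        then show False using xor a uvw(3-5) by metis
      qed
    next
      case 1
      then have "ad F g = False" "ad P g = True" "ad Q g = True"
        using ad[OF F g(1)] ad[OF P(1) g(1)] ad[OF Q(1) g(1)] uvw(1,2) rQ \<open>F \<noteq> P\<close> \<open>Q \<noteq> F\<close> by auto
      then show False using g(2) by simp
    next
      case 2
      then have "ad F g = True" "ad P g = False" "ad Q g = True"
        using ad[OF F g(1)] ad[OF P(1) g(1)] ad[OF Q(1) g(1)] uvw(1,2) rQ \<open>F \<noteq> P\<close> \<open>Q \<noteq> P\<close> by auto
      then show False using g(2) by simp
    next
      case 3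
      then have "ad F g = True" "ad P g = True" "ad Q g = False"
        using ad[OF F g(1)] ad[OF P(1) g(1)] ad[OF Q(1) g(1)] uvw(1,2) rQ \<open>Q \<noteq> F\<close> \<open>Q \<noteq> P\<close> by auto
      then show False using g(2) by simp
    qed
  qed
  obtain x where x: "r Q = {u, x}" "x \<noteq> u"
    using card_2_other[OF root_on_card2[OF root Q(1)] uQ] .
  have xne: "x \<noteq> v" "x \<noteq> w" using x uvw QFP root_on_eq[OF root Q(1) F] root_on_eq[OF root Q(1) P(1)] by auto
  \<comment> \<open>An edge that avoids \<open>u\<close> but meets all three would need the three
    distinct ends \<open>v\<close>, \<open>w\<close>, \<open>x\<close>.\<close>
  have "{g \<in> R. u \<in> r g} = {g \<in> R. cadj ad F g \<and> cadj ad P g \<and> cadj ad Q g}"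
  proof (intro Collect_cong conj_cong refl)
    fix g assume g: "g \<in> R"
    obtain s t where st: "r g = {s, t}" "s \<noteq> t" 
      using root_on_card2[OF root g] unfolding card_2_iff by auto
    show "u \<in> r g \<longleftrightarrow> cadj ad F g \<and> cadj ad P g \<and> cadj ad Q g"
      using root_on_cadj[OF root F g] root_on_cadj[OF root P(1) g] root_on_cadj[OF root Q(1) g]
        uvw x xne st by auto
  qed
  then show ?thesis using uvw by blast
qed

text \<open>If an even triangle is a star in \<open>r\<close>, its four vertices span a component, within which every edge
  may be replaced by the complementary pair; this turns the star into a triangle.\<close>

lemma even_triangle_star:
  assumes root: "root_on R ad r" and F: "F \<in> R" and P: "P \<in> R" "ad F P" and Q: "Q \<in> R" "ad F Q" "ad P Q"
    and even: "\<not> odd_triangle R ad F P Q"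
  shows "\<exists>r' y. root_on R ad r' \<and> y \<in> r' F \<and>
    {g \<in> R. y \<in> r' g} = {g \<in> R. cadj ad F g \<and> cadj ad P g \<and> g \<noteq> Q} \<and>
    (\<forall>z g. z \<notin> r F \<longrightarrow> z \<notin> r P \<longrightarrow> z \<notin> r Q \<longrightarrow> g \<in> R \<longrightarrow> (z \<in> r' g \<longleftrightarrow> z \<in> r g))"
proof -
  have tri: "\<exists>y\<in>r' F. {g \<in> R. y \<in> r' g} = {g \<in> R. cadj ad F g \<and> cadj ad P g \<and> g \<noteq> Q}"
    if root': "root_on R ad r'" and dis: "r' F \<inter> r' P \<inter> r' Q = {}" for r'
  proof -
    obtain u v w where uvw: "r' F = {u, v}" "r' P = {u, w}" "u \<noteq> v" "u \<noteq> w" "v \<noteq> w"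
      using root_on_adjacent_pair[OF root' F P] .
    have uQ: "u \<notin> r' Q" using dis uvw by auto
    then have "v \<in> r' Q" "w \<in> r' Q"
      using root' F P Q uvw unfolding root_on_def by auto
    then have rQ: "r' Q = {v, w}"
      using card_2_third[OF root_on_card2[OF root' Q(1)], of v w] uvw(5) by auto
    have "{g \<in> R. u \<in> r' g} = {g \<in> R. cadj ad F g \<and> cadj ad P g \<and> g \<noteq> Q}"
    proof (intro Collect_cong conj_cong refl)
      fix g assume g: "g \<in> R"
      obtain s t where st: "r' g = {s, t}" "s \<noteq> t"
        using root_on_card2[OF root' g] unfolding card_2_iff by auto
      have "g = Q \<longleftrightarrow> {s, t} = {v, w}" using root_on_eq[OF root' g Q(1)] rQ st by auto
      then show "u \<in> r' g \<longleftrightarrow> cadj ad F g \<and> cadj ad P g \<and> g \<noteq> Q"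
        using root_on_cadj[OF root' F g] root_on_cadj[OF root' P(1) g] uvw st
        by (auto simp: doubleton_eq_iff)
    qed
    then show ?thesis using uvw by blast
  qed
  show ?thesis
  proof (cases "r F \<inter> r P \<inter> r Q = {}")
    case True
    then show ?thesis using tri[OF root] root by blast
  next
    case False
    then obtain y where y: "y \<in> r F" "y \<in> r P" "y \<in> r Q" by auto
    obtain v where v: "r F = {y, v}" "v \<noteq> y"
      using card_2_other[OF root_on_card2[OF root F] y(1)] .
    obtain w where w: "r P = {y, w}" "w \<noteq> y"
      using card_2_other[OF root_on_card2[OF root P(1)] y(2)] .
    obtain x where x: "r Q = {y, x}" "x \<noteq> y"
      using card_2_other[OF root_on_card2[OF root Q(1)] y(3)] .
    have "F \<noteq> P" "F \<noteq> Q" "P \<noteq> Q" using root F P Q unfolding root_on_def by blast+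
    then have ne: "v \<noteq> w" "v \<noteq> x" "w \<noteq> x"
      using v w x root_on_eq[OF root F P(1)] root_on_eq[OF root F Q(1)] root_on_eq[OF root P(1) Q(1)] by auto
    have root_ad: "ad e f \<longleftrightarrow> e \<noteq> f \<and> r e \<inter> r f \<noteq> {}" if "e \<in> R" "f \<in> R" for e f
      using root that unfolding root_on_def by blast
    let ?V = "{y, v, w, x}"
    have V: "card ?V = 4" using ne v w x by auto
    \<comment> \<open>Apart from \<open>F\<close>, \<open>P\<close>, \<open>Q\<close>, an edge at
      \<open>y\<close> would meet all three and be an odd witness. An edge avoiding \<open>y\<close>
      meets as many of them as it has ends among \<open>v\<close>, \<open>w\<close>,
      \<open>x\<close>, so it has none or two of these.\<close>
    have comp: "r g \<subseteq> ?V \<or> r g \<inter> ?V = {}" if g: "g \<in> R" for g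
    proof (cases "g \<in> {F, P, Q}")
      case True
      then show ?thesis using v w x by auto
    next
      case gn: False
      obtain s t where st: "r g = {s, t}" "s \<noteq> t"
        using root_on_card2[OF root g] unfolding card_2_iff by auto
      have ev: "even (of_bool (ad F g) + of_bool (ad P g) + of_bool (ad Q g) :: nat)"
        using even g unfolding odd_triangle_def by blast
      have adg: "ad F g \<longleftrightarrow> s \<in> {y, v} \<or> t \<in> {y, v}" "ad P g \<longleftrightarrow> s \<in> {y, w} \<or> t \<in> {y, w}"
         "ad Q g \<longleftrightarrow> s \<in> {y, x} \<or> t \<in> {y, x}"
        using root_ad[OF F g] root_ad[OF P(1) g] root_ad[OF Q(1) g] gn v(1) w(1) x(1) st(1) by auto
      have xor: "ad Q g \<longleftrightarrow> (ad F g \<longleftrightarrow> \<not> ad P g)"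
        using ev by (cases "ad F g"; cases "ad P g"; cases "ad Q g") simp_all
      have y': "s \<noteq> y" "t \<noteq> y" using xor adg by blast+
      then have "s = x \<or> t = x \<longleftrightarrow> ((s = v \<or> t = v) \<longleftrightarrow> \<not> (s = w \<or> t = w))"
        using xor unfolding adg by simp
      then have "s \<in> ?V \<longleftrightarrow> t \<in> ?V" using st(2) y' ne by (smt (verit) insert_iff empty_iff)
      then show ?thesis using st by auto
    qed
    let ?r = "\<lambda>g. if r g \<subseteq> ?V then ?V - r g else r g"
    have root': "root_on R ad ?r" by (rule root_on_complement[OF root V comp])
    have "?r F = {w, x}" "?r P = {v, x}" "?r Q = {v, w}"
      using v(1) w(1) x(1) ne v(2)[symmetric] w(2)[symmetric] x(2)[symmetric] by auto
    then have "?r F \<inter> ?r P \<inter> ?r Q = {}" using ne by auto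
    from tri[OF root' this] obtain z where z: "z \<in> ?r F"
      "{g \<in> R. z \<in> ?r g} = {g \<in> R. cadj ad F g \<and> cadj ad P g \<and> g \<noteq> Q}" by blast
    have "z' \<in> ?r g \<longleftrightarrow> z' \<in> r g" if "z' \<notin> r F" "z' \<notin> r P" "z' \<notin> r Q" for z' g
    proof -
      have "z' \<notin> ?V" using that v(1) w(1) x(1) by blast
      then show ?thesis by auto
    qed
    then show ?thesis using root' z by blast
  qed
qed

text \<open>No edge is half named, so a neighbour of \<open>F\<close> with a named end would have
  both ends named and could not meet \<open>F\<close>, whose ends are unnamed. Hence
  \<open>F\<close> and its neighbours have only unnamed ends, and exchanging the root around a
  triangle on \<open>F\<close> preserves all labels.\<close>

lemma partial_root_start:
  assumes "partial_root R ad L a b" "F \<in> R" "a F = 0"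
    and full: "\<And>g. g \<in> R \<Longrightarrow> a g \<noteq> 0 \<Longrightarrow> b g \<noteq> 0"
    and P: "P \<in> R \<and> ad F P \<or> P = F \<and> (\<forall>g\<in>R. \<not> ad F g)"
    and Q: "Q \<in> R \<and> ad F Q \<and> ad P Q \<or> Q \<notin> R \<and> (\<forall>g\<in>R. \<not> (ad F g \<and> ad P g))"
    and S: "\<And>g. g \<in> R \<Longrightarrow> g \<in> S \<longleftrightarrow> cadj ad F g \<and> cadj ad P g \<and>
      (if Q \<in> R \<and> odd_triangle R ad F P Q then cadj ad Q g else g \<noteq> Q)"
  shows "partial_root R ad (Suc L) (label_first S (Suc L) a) (label_second S (Suc L) a b)"
proof -
  obtain r \<phi> where root: "root_on R ad r" and lab: "labelled R r \<phi> L a b"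
    using assms(1) unfolding partial_root_def by blast
  note F = assms(2)
  have ad: "ad e f \<longleftrightarrow> e \<noteq> f \<and> r e \<inter> r f \<noteq> {}" if "e \<in> R" "f \<in> R" for e f
    using root that unfolding root_on_def by auto
  have F0: "r F \<inter> \<phi> ` {1..L} = {}" by (rule labelled_none[OF lab F assms(3)])
  have nb0: "r g \<inter> \<phi> ` {1..L} = {}" if g: "g \<in> R" "ad F g" for g
  proof (cases "a g = 0")
    case False
    then have "b g \<noteq> 0" using full g by auto
    moreover have "a g \<in> {1..L}" "b g \<in> {1..L}" using lab g False calculation unfolding labelled_def by auto
    ultimately have "r g \<subseteq> \<phi> ` {1..L}" using labelled_full(1)[OF lab root g(1) False] by auto
    then show ?thesis using F0 ad[OF F g(1)] g(2) by auto
  qed (use labelled_none[OF lab g(1)] in auto)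
  have "\<exists>r' y. root_on R ad r' \<and> labelled R r' \<phi> L a b \<and> y \<notin> \<phi> ` {1..L} \<and> {g \<in> R. y \<in> r' g} = {g \<in> R. g \<in> S}"
  proof (cases "Q \<in> R")
    case noQ: False
    then have S': "g \<in> R \<Longrightarrow> g \<in> S \<longleftrightarrow> cadj ad F g \<and> cadj ad P g" for g using S by auto
    have "\<exists>y\<in>r F. {g \<in> R. y \<in> r g} = {g \<in> R. g \<in> S}"
    proof (cases "\<forall>g\<in>R. \<not> ad F g")
      case True
      then have "P = F" using P by auto
      obtain y where y: "y \<in> r F" using root_on_card2[OF root F] by fastforce
      have "y \<in> r g \<longleftrightarrow> g \<in> S" if g: "g \<in> R" for g
        using S'[OF g] \<open>P = F\<close> True g ad[OF F g] y unfolding cadj_def by auto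
      then show ?thesis using y by blast
    next
      case False
      then have P': "P \<in> R" "ad F P" using P by auto
      obtain u v w where uvw: "r F = {u, v}" "r P = {u, w}" "u \<noteq> v" "u \<noteq> w" "v \<noteq> w"
        using root_on_adjacent_pair[OF root F P'] .
      \<comment> \<open>Without a common neighbour of \<open>F\<close> and \<open>P\<close>, their
        shared end carries just these two edges.\<close>
      have "u \<in> r g \<longleftrightarrow> g \<in> S" if g: "g \<in> R" for g
      proof -
        have "\<not> (ad F g \<and> ad P g)" using Q noQ g by auto
        moreover have "ad P F" using ad[OF P'(1) F] ad[OF F P'(1)] P'(2) by auto
        ultimately have "g \<in> S \<longleftrightarrow> g = F \<or> g = P" using S'[OF g] P' unfolding cadj_def by auto
        moreover have "u \<in> r g \<Longrightarrow> g = F \<or> g = P"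
          using \<open>\<not> (ad F g \<and> ad P g)\<close> ad[OF F g] ad[OF P'(1) g] uvw by auto
        ultimately show ?thesis using uvw by auto
      qed
      then show ?thesis using uvw by blast
    qed
    then show ?thesis using root lab F0 by blast
  next
    case True
    then have Q': "Q \<in> R" "ad F Q" "ad P Q" using Q by auto
    then have P': "P \<in> R" "ad F P" using P by auto
    show ?thesis
    proof (cases "odd_triangle R ad F P Q")
      case True
      have "\<exists>y\<in>r F. {g \<in> R. y \<in> r g} = {g \<in> R. g \<in> S}"
        using odd_triangle_star[OF root F P' Q' True] S True Q' by auto
      then show ?thesis using root lab F0 by blast
    next
      case False
      obtain r' y where r': "root_on R ad r'" "y \<in> r' F"
        "{g \<in> R. y \<in> r' g} = {g \<in> R. cadj ad F g \<and> cadj ad P g \<and> g \<noteq> Q}"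
        and same: "\<And>z g. z \<notin> r F \<Longrightarrow> z \<notin> r P \<Longrightarrow> z \<notin> r Q \<Longrightarrow> g \<in> R \<Longrightarrow> (z \<in> r' g \<longleftrightarrow> z \<in> r g)"
        using even_triangle_star[OF root F P' Q' False] by blast
      have same': "\<phi> j \<in> r' g \<longleftrightarrow> \<phi> j \<in> r g" if "j \<in> {1..L}" "g \<in> R" for j g
        using same[of "\<phi> j" g] F0 nb0 P' Q' that by blast
      then have lab': "labelled R r' \<phi> L a b"
        using lab unfolding labelled_def by simp
      have "y \<notin> \<phi> ` {1..L}"
        using labelled_none[OF lab' F assms(3)] r'(2) by blast
      moreover have "{g \<in> R. y \<in> r' g} = {g \<in> R. g \<in> S}" using r'(3) S False by auto
      ultimately show ?thesis using r'(1) lab' by blast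
    qed
  qed
  then show ?thesis using partial_root_add by blast
qed

text \<open>\<open>\<phi>\<close> is injective, so the labels themselves can take the place of the
  vertices of the unknown root.\<close>

lemma partial_root_complete:
  assumes "partial_root R ad L a b" "\<And>g. g \<in> R \<Longrightarrow> a g \<noteq> 0 \<and> b g \<noteq> 0"
    and "e \<in> R" "f \<in> R"
  shows "a e \<noteq> b e" "ad e f \<longleftrightarrow> e \<noteq> f \<and> {a e, b e} \<inter> {a f, b f} \<noteq> {}"
proof -
  obtain r \<phi> where root: "root_on R ad r" and lab: "labelled R r \<phi> L a b"
    using assms(1) unfolding partial_root_def by blast
  show "a e \<noteq> b e" using lab assms unfolding labelled_def by auto
  have r: "r g = {\<phi> (a g), \<phi> (b g)}" "a g \<in> {1..L}" "b g \<in> {1..L}" if "g \<in> R" for g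
    using labelled_full(1)[OF lab root that] lab assms(2)[OF that] that unfolding labelled_def by auto
  have inj: "\<phi> i = \<phi> j \<longleftrightarrow> i = j" if "i \<in> {1..L}" "j \<in> {1..L}" for i j
    using lab that unfolding labelled_def inj_on_def by blast
  have "r e \<inter> r f \<noteq> {} \<longleftrightarrow> {a e, b e} \<inter> {a f, b f} \<noteq> {}"
    using r[OF assms(3)] r[OF assms(4)] inj by auto
  then show "ad e f \<longleftrightarrow> e \<noteq> f \<and> {a e, b e} \<inter> {a f, b f} \<noteq> {}"
    using root assms unfolding root_on_def by auto
qed

section \<open>Twins and the bound\<close>

lemma two_le_gamma_l:
  assumes "finite (verts G)" "v \<in> verts G"
  shows "degree G v + 1 + omega G v \<le> 2 * gamma_l G"
proof -
  let ?f = "\<lambda>v. nat \<lceil>(1 / 2 :: real) * (real (degree G v) + 1 + real (omega G v))\<rceil>"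
  have "?f v \<le> gamma_l G"
    unfolding gamma_l_def using assms by (intro cSUP_upper) auto
  then have "real (?f v) \<le> real (gamma_l G)" by (rule of_nat_mono)
  then have "(1 / 2 :: real) * (real (degree G v) + 1 + real (omega G v)) \<le> real (gamma_l G)"
    by (rule order_trans[OF real_nat_ceiling_ge])
  then have "real (degree G v + 1 + omega G v) \<le> real (2 * gamma_l G)" by simp
  then show ?thesis by (simp only: of_nat_le_iff)
qed

lemma card_le_omega:
  assumes "finite (verts G)" "clique G S" "v \<in> S"
  shows "card S \<le> omega G v"
proof -
  have "{card K | K. clique G K \<and> v \<in> K} \<subseteq> card ` Pow (verts G)" unfolding clique_def by auto
  then have "finite {card K | K. clique G K \<and> v \<in> K}" by (rule finite_subset) (use assms in auto)
  then show ?thesis unfolding omega_def using assms(2,3) by (intro Max_ge) auto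
qed

text \<open>An edge \<open>uv\<close> has \<open>deg u + deg v - mult {u, v} - 1\<close> neighbours.
  Bounding \<open>omega\<close> from below by the star of \<open>u\<close> gives the degree bound;
  bounding it by the edges spanned by \<open>u\<close>, \<open>v\<close>, \<open>w\<close>, where
  \<open>mult {u, v}\<close> cancels, gives the triangle bound.\<close>

lemma gamma_ends_line_graph:
  assumes G: "verts G = {..<n}"
    and E2: "\<And>e. e < n \<Longrightarrow> card (En e) = 2" and E0: "\<And>e. e < n \<Longrightarrow> 0 \<notin> En e"
    and ad: "\<And>e f. e < n \<Longrightarrow> f < n \<Longrightarrow> adj G e f \<longleftrightarrow> e \<noteq> f \<and> En e \<inter> En f \<noteq> {}"
  shows "gamma_ends n En (gamma_l G)"
proof -
  interpret multi_ends n En using E2 E0 by unfold_locales auto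
  have fin: "finite (verts G)" using G by simp
  have dg: "degree G e + 1 + mult {u, v} = deg u + deg v" if e: "e < n" "En e = {u, v}" for e u v
  proof -
    have uv: "u \<noteq> v" using E2[OF e(1)] e(2) by auto
    let ?U = "{f. f < n \<and> u \<in> En f}" and ?V = "{f. f < n \<and> v \<in> En f}"
    have "{f \<in> verts G. adj G e f} = (?U \<union> ?V) - {e}"
      using G ad[OF e(1)] e(2) by auto
    then have "degree G e + 1 = card (?U \<union> ?V)"
      unfolding degree_def using e card_Suc_Diff1[of "?U \<union> ?V" e] by simp
    moreover have "{f. f < n \<and> En f = {u, v}} = ?U \<inter> ?V"
      using card_2_third[OF E2, of _ u v] uv by auto
    ultimately show ?thesis
      unfolding mult_def deg_def using card_Un_Int[of ?U ?V] by simp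
  qed
  show ?thesis
  proof
    fix e u v assume e: "e < n" "En e = {u, v}"
    have "clique G {f. f < n \<and> u \<in> En f}"
      unfolding clique_def using G ad by auto
    then have "deg u \<le> omega G e"
      unfolding deg_def using card_le_omega[OF fin] e by auto
    then show "2 * deg u + deg v \<le> 2 * gamma_l G + mult {u, v}"
      using dg[OF e] two_le_gamma_l[OF fin, of e] e G by auto
  next
    fix e u v w assume e: "e < n" "En e = {u, v}" and w: "w \<notin> {u, v}"
    have uv: "u \<noteq> v" using E2[OF e(1)] e(2) by auto
    let ?T = "\<lambda>S. {f. f < n \<and> En f = S}"
    let ?K = "?T {u, v} \<union> ?T {u, w} \<union> ?T {v, w}"
    have "clique G ?K"
      unfolding clique_def using G ad by (auto simp: insert_commute)
    then have "card ?K \<le> omega G e"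
      using card_le_omega[OF fin] e by auto
    moreover have "card ?K = mult {u, v} + mult {u, w} + mult {v, w}"
      unfolding mult_def using uv w
      by (subst card_Un_disjoint, simp, simp, force simp: doubleton_eq_iff)
        (subst card_Un_disjoint, auto simp: doubleton_eq_iff)
    ultimately show "deg u + deg v + mult {u, w} + mult {v, w} \<le> 2 * gamma_l G"
      using dg[OF e] two_le_gamma_l[OF fin, of e] e G by auto
  qed
qed

lemma line_graph_ends:
  assumes "line_graph G" "verts G = {..<n}"
  shows "\<exists>r :: nat \<Rightarrow> nat set. (\<forall>e<n. card (r e) = 2) \<and>
    (\<forall>e<n. \<forall>f<n. adj G e f \<longleftrightarrow> e \<noteq> f \<and> r e \<inter> r f \<noteq> {})"
proof -
  obtain H :: "(nat, nat) multigraph" where H: "finite_multigraph H" "isomorphic G (line_graph_of H)"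
    using assms(1) unfolding line_graph_def by blast
  obtain h where h: "bij_betw h (verts G) (medges H)"
    "\<And>u v. u \<in> verts G \<Longrightarrow> v \<in> verts G \<Longrightarrow> adj G u v \<longleftrightarrow> adj (line_graph_of H) (h u) (h v)"
    using H(2) unfolding isomorphic_def line_graph_of_def by auto
  have hm: "h e \<in> medges H" if "e < n" for e
    using h(1) assms(2) that bij_betwE by blast
  have hi: "h e = h f \<longleftrightarrow> e = f" if "e < n" "f < n" for e f
    using h(1) assms(2) that unfolding bij_betw_def inj_on_def by auto
  show ?thesis
  proof (intro exI[of _ "\<lambda>e. ends H (h e)"] conjI allI impI)
    show "card (ends H (h e)) = 2" if "e < n" for e
      using H(1) hm[OF that] unfolding finite_multigraph_def by auto
    show "adj G e f \<longleftrightarrow> e \<noteq> f \<and> ends H (h e) \<inter> ends H (h f) \<noteq> {}" if "e < n" "f < n" for e f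
      using h(2)[of e f] hm[OF that(1)] hm[OF that(2)] hi[OF that] assms(2) that
      unfolding line_graph_of_def by auto
  qed
qed

section \<open>Twin classes\<close>

definition twins :: "nat \<Rightarrow> (nat \<Rightarrow> nat \<Rightarrow> bool) \<Rightarrow> nat \<Rightarrow> nat \<Rightarrow> bool" where
  "twins n ad e f \<longleftrightarrow> (\<forall>x<n. cadj ad e x \<longleftrightarrow> cadj ad f x)"

definition twin_rep :: "nat \<Rightarrow> (nat \<Rightarrow> nat \<Rightarrow> bool) \<Rightarrow> (nat \<Rightarrow> nat) \<Rightarrow> bool" where
  "twin_rep n ad rep \<longleftrightarrow> (\<forall>e<n. rep e < n \<and> rep (rep e) = rep e) \<and>
     (\<forall>e<n. \<forall>f<n. rep e = rep f \<longleftrightarrow> twins n ad e f)"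

text \<open>Parallel edges have equal closed neighbourhoods and are twins, so representatives have
  distinct pairs of ends. Twins that are not parallel just make the reduced graph smaller.\<close>

lemma twin_rep_root:
  assumes rep: "twin_rep n ad rep" and r2: "\<And>e. e < n \<Longrightarrow> card (r e) = 2"
    and r: "\<And>e f. e < n \<Longrightarrow> f < n \<Longrightarrow> ad e f \<longleftrightarrow> e \<noteq> f \<and> r e \<inter> r f \<noteq> {}"
  shows "root_on {e. e < n \<and> rep e = e} ad r"
proof -
  have "inj_on r {e. e < n \<and> rep e = e}"
  proof (rule inj_onI)
    fix e f assume ef: "e \<in> {e. e < n \<and> rep e = e}" "f \<in> {e. e < n \<and> rep e = e}" "r e = r f"
    have "cadj ad e x \<longleftrightarrow> cadj ad f x" if x: "x < n" for x
    proof -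
      have "r e \<inter> r x \<noteq> {}" if "x = e \<or> x = f"
        using that r2[of e] ef by fastforce
      then show ?thesis using r[of e x] r[of f x] ef x unfolding cadj_def by auto
    qed
    then have "rep e = rep f" using rep ef unfolding twin_rep_def twins_def by blast
    then show "e = f" using ef by auto
  qed
  then show ?thesis unfolding root_on_def using r2 r by auto
qed

text \<open>Whether two distinct vertices are adjacent depends only on their twin classes, so all
  twins may receive the ends of their representative, as parallel edges.\<close>

lemma twin_rep_ends:
  assumes rep: "twin_rep n ad rep" and sym: "\<And>e f. ad e f \<Longrightarrow> ad f e"
    and root: "partial_root {e. e < n \<and> rep e = e} ad L a b"
      "\<And>g. g < n \<Longrightarrow> rep g = g \<Longrightarrow> a g \<noteq> 0 \<and> b g \<noteq> 0"
    and irr: "\<And>e. \<not> ad e e" and e: "e < n" and f: "f < n"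
  shows "ad e f \<longleftrightarrow> e \<noteq> f \<and> {a (rep e), b (rep e)} \<inter> {a (rep f), b (rep f)} \<noteq> {}"
proof -
  let ?R = "{e. e < n \<and> rep e = e}"
  have R: "rep e \<in> ?R" "rep f \<in> ?R" using rep e f unfolding twin_rep_def by auto
  have tw: "cadj ad g x \<longleftrightarrow> cadj ad (rep g) x" if "g < n" "x < n" for g x
    using rep that unfolding twin_rep_def twins_def by metis
  have cs: "cadj ad g x \<longleftrightarrow> cadj ad x g" for g x unfolding cadj_def using sym by auto
  have "cadj ad e f \<longleftrightarrow> cadj ad (rep e) (rep f)"
    using tw[OF e f] tw[OF f, of "rep e"] R cs by auto
  also have "\<dots> \<longleftrightarrow> {a (rep e), b (rep e)} \<inter> {a (rep f), b (rep f)} \<noteq> {}"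
    using partial_root_complete(2)[OF root(1) _ R] root(2) unfolding cadj_def by auto
  finally show ?thesis unfolding cadj_def using irr by auto
qed

lemma (in multi_ends) pcol_proper_colouring:
  assumes "pcol K col" "\<And>e. e < n \<Longrightarrow> col e \<noteq> 0" "verts G = {..<n}"
    and "\<And>e f. e < n \<Longrightarrow> f < n \<Longrightarrow> adj G e f \<longleftrightarrow> e \<noteq> f \<and> En e \<inter> En f \<noteq> {}"
  shows "proper_colouring G col" "card (col ` verts G) \<le> K - 1"
proof -
  show "proper_colouring G col"
    unfolding proper_colouring_def
  proof (intro ballI impI)
    fix u v assume uv: "u \<in> verts G" "v \<in> verts G" "adj G u v"
    then obtain x where "x \<in> En u" "x \<in> En v" "u \<noteq> v" using assms(3,4) by auto
    then show "col u \<noteq> col v" using pcol_unique[OF assms(1), of u v x] assms(2,3) uv by auto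
  qed
  have "col ` verts G \<subseteq> {0<..<K}" using assms unfolding pcol_def by auto
  then show "card (col ` verts G) \<le> K - 1" using card_mono[of "{0<..<K}" "col ` verts G"] by simp
qed

section \<open>Colour tables and Kempe chains on the word RAM\<close>

declare One_nat_def [simp del] Suc_eq_plus1 [symmetric, simp]

text \<open>Array 1 holds the colours, arrays 2 and 3 the ends of the edges, and cell \<open>v (n + 1) + c\<close> of array 4
  holds \<open>e + 1\<close> if \<open>e\<close> is the edge of colour \<open>c\<close> at the vertex \<open>v\<close>, or 0. Vertices are numbered from 1;
  the row of the dummy vertex 0 is filled with ones, so that 0 never misses a colour.\<close>

abbreviation (input) rE :: nat where "rE \<equiv> 2"
abbreviation (input) rX :: nat where "rX \<equiv> 3"
abbreviation (input) rY :: nat where "rY \<equiv> 4"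
abbreviation (input) rA :: nat where "rA \<equiv> 5"
abbreviation (input) rB :: nat where "rB \<equiv> 6"
abbreviation (input) rV :: nat where "rV \<equiv> 7"
abbreviation (input) rG :: nat where "rG \<equiv> 8"
abbreviation (input) rV' :: nat where "rV' \<equiv> 9"
abbreviation (input) rG' :: nat where "rG' \<equiv> 10"
abbreviation (input) rC :: nat where "rC \<equiv> 11"
abbreviation (input) rH :: nat where "rH \<equiv> 12"
abbreviation (input) rW :: nat where "rW \<equiv> 13"
abbreviation (input) rWG :: nat where "rWG \<equiv> 14"
abbreviation (input) rN :: nat where "rN \<equiv> 15"
abbreviation (input) rK :: nat where "rK \<equiv> 16"
abbreviation (input) tZ :: nat where "tZ \<equiv> 20"
abbreviation (input) tP :: nat where "tP \<equiv> 21"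
abbreviation (input) tQ :: nat where "tQ \<equiv> 22"
abbreviation (input) tF :: nat where "tF \<equiv> 23"
abbreviation (input) tF' :: nat where "tF' \<equiv> 24"
abbreviation (input) tY :: nat where "tY \<equiv> 25"
abbreviation (input) tC :: nat where "tC \<equiv> 26"
abbreviation (input) tGo :: nat where "tGo \<equiv> 27"

abbreviation seq :: "com \<Rightarrow> com \<Rightarrow> com" (infixr ";;" 60) where "c ;; d \<equiv> com.Seq c d"

definition cell :: "aexp \<Rightarrow> aexp \<Rightarrow> aexp" where
  "cell v c = Plus (Times v (Var rN)) c"

lemma aval_cell [simp]: "aval (cell v c) s = aval v s * regs s rN + aval c s"
  by (simp add: cell_def)

abbreviation is_free :: "nat \<Rightarrow> nat \<Rightarrow> bexp" where
  "is_free v c \<equiv> Equal (Read 4 (cell (Var v) (Var c))) (Const 0)"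

definition set_colour :: "nat \<Rightarrow> nat \<Rightarrow> com" where
  "set_colour e c = Store 4 (cell (Read 2 (Var e)) (Var c)) (Plus (Var e) (Const 1)) ;;
     Store 4 (cell (Read 3 (Var e)) (Var c)) (Plus (Var e) (Const 1)) ;; Store 1 (Var e) (Var c)"

definition unset_colour :: "nat \<Rightarrow> com" where
  "unset_colour e = Store 4 (cell (Read 2 (Var e)) (Read 1 (Var e))) (Const 0) ;;
     Store 4 (cell (Read 3 (Var e)) (Read 1 (Var e))) (Const 0) ;; Store 1 (Var e) (Const 0)"

definition other_endpoint :: "nat \<Rightarrow> nat \<Rightarrow> nat \<Rightarrow> com" where
  "other_endpoint d e v = com.If (Equal (Read 2 (Var e)) (Var v)) (Assign d (Read 3 (Var e)))
     (Assign d (Read 2 (Var e)))"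

abbreviation colouring :: "state \<Rightarrow> nat \<Rightarrow> nat" where
  "colouring s \<equiv> arrs s 1"

definition upd_col :: "(nat \<Rightarrow> nat) \<Rightarrow> (nat \<Rightarrow> nat) \<Rightarrow> state \<Rightarrow> state" where
  "upd_col col T s = s\<lparr>arrs := (arrs s)(1 := col, 4 := T)\<rparr>"

lemma upd_col_simps [simp]:
  "regs (upd_col col T s) = regs s"
  "arrs (upd_col col T s) 1 = col"
  "arrs (upd_col col T s) 4 = T"
  "a \<noteq> 1 \<Longrightarrow> a \<noteq> 4 \<Longrightarrow> arrs (upd_col col T s) a = arrs s a"
  by (simp_all add: upd_col_def)

text \<open>The next edge of the chain loses its colour before the current one takes it: the table
  has a single entry for each vertex and colour, which must be vacant when it is set.
  \<open>tGo\<close> is 0 once the chain has ended.\<close>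

definition kempe :: com where
  "kempe = Assign tZ (Var rX) ;; Assign tP (Var rC) ;; Assign tQ (Var rA) ;;
     Assign tF (Minus (Read 4 (cell (Var rX) (Var rC))) (Const 1)) ;; Assign tGo (Const 1) ;;
     unset_colour tF ;;
     While (bexp.Not (Equal (Var tGo) (Const 0)))
      (other_endpoint tY tF tZ ;;
       Assign tGo (Read 4 (cell (Var tY) (Var tQ))) ;;
       Assign tF' (Minus (Var tGo) (Const 1)) ;;
       com.If (Equal (Var tGo) (Const 0)) Skip (unset_colour tF') ;;
       set_colour tF tQ ;;
       Assign tZ (Var tY) ;; Assign tF (Var tF') ;;
       Assign tC (Var tP) ;; Assign tP (Var tQ) ;; Assign tQ (Var tC))"

context multi_ends
begin

definition represents :: "state \<Rightarrow> bool" where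
  "represents s \<longleftrightarrow> regs s rN = Suc n \<and> (\<forall>e<n. En e = {arrs s 2 e, arrs s 3 e}) \<and>
     (\<forall>v c e. 0 < v \<longrightarrow> 0 < c \<longrightarrow> c \<le> n \<longrightarrow>
        (arrs s 4 (v * regs s rN + c) = Suc e \<longleftrightarrow> e < n \<and> v \<in> En e \<and> colouring s e = c)) \<and>
     (\<forall>c. 0 < c \<longrightarrow> c \<le> n \<longrightarrow> arrs s 4 c \<noteq> 0)"

lemma represents_regs [simp]:
  "r rN = regs s rN \<Longrightarrow> represents (s\<lparr>regs := r\<rparr>) \<longleftrightarrow> represents s"
  by (simp add: represents_def)

lemma represents_regs_arrs [simp]:
  "r rN = regs s rN \<Longrightarrow> represents (s\<lparr>regs := r, arrs := A\<rparr>) \<longleftrightarrow> represents (s\<lparr>arrs := A\<rparr>)"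
  by (simp add: represents_def)

lemma represents_rN: "represents s \<Longrightarrow> regs s rN = Suc n"
  by (simp add: represents_def)

lemma represents_ends: "represents s \<Longrightarrow> e < n \<Longrightarrow> En e = {arrs s 2 e, arrs s 3 e}"
  by (simp add: represents_def)

lemma represents_cell:
  "represents s \<Longrightarrow> 0 < v \<Longrightarrow> 0 < c \<Longrightarrow> c \<le> n \<Longrightarrow>
    arrs s 4 (v * regs s rN + c) = Suc e \<longleftrightarrow> e < n \<and> v \<in> En e \<and> colouring s e = c"
  unfolding represents_def by blast

text \<open>Thanks to the filled row of the dummy vertex, one read decides both whether the vertex
  is present and whether it misses the colour; absent fan vertices thus need no case distinction in
  the programs.\<close>

lemma represents_free:
  assumes "represents s" "0 < c" "c \<le> n"
  shows "arrs s 4 (v * regs s rN + c) = 0 \<longleftrightarrow> 0 < v \<and> free (colouring s) v c"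
proof (cases "v = 0")
  case True
  then show ?thesis using assms unfolding represents_def by auto
next
  case False
  then show ?thesis using represents_cell[OF assms(1) _ assms(2,3), of v] unfolding free_def
    by (metis gr0_conv_Suc not_gr_zero old.nat.distinct(1))
qed

lemma cell_inj:
  fixes c c' v v' :: nat
  assumes "c < m" "c' < m"
  shows "v * m + c = v' * m + c' \<longleftrightarrow> v = v' \<and> c = c'"
proof
  assume eq: "v * m + c = v' * m + c'"
  have "(v * m + c) div m = v" "(v' * m + c') div m = v'" using assms by auto
  then have "v = v'" using eq by metis
  then show "v = v' \<and> c = c'" using eq by simp
qed simp

lemma wp_set_colour:
  assumes rep: "represents s" and e: "regs s e = f" "f < n" and c: "0 < regs s c" "regs s c \<le> n"
    and "colouring s f = 0" and fr: "\<And>v. v \<in> En f \<Longrightarrow> free (colouring s) v (regs s c)"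
    and Q: "\<And>T. represents (upd_col ((colouring s)(f := regs s c)) T s) \<Longrightarrow>
      Q (upd_col ((colouring s)(f := regs s c)) T s)"
  shows "wp (set_colour e c) s t Q"
proof -
  let ?c = "regs s c" and ?a = "arrs s 2 f" and ?b = "arrs s 3 f"
  let ?T = "(arrs s 4)(?a * regs s rN + ?c := Suc f, ?b * regs s rN + ?c := Suc f)"
  let ?s = "upd_col ((colouring s)(f := ?c)) ?T s"
  have N: "regs s rN = Suc n" using represents_rN[OF rep] .
  have E: "En f = {?a, ?b}" using represents_ends[OF rep e(2)] .
  have pos: "?a \<noteq> 0" "?b \<noteq> 0" using zero_notin_ends[OF e(2)] E by auto
  have "represents ?s"
    unfolding represents_def
  proof (intro conjI allI impI)
    fix v d g :: nat assume v: "0 < v" "0 < d" "d \<le> n"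
    show "arrs ?s 4 (v * regs ?s rN + d) = Suc g \<longleftrightarrow> g < n \<and> v \<in> En g \<and> colouring ?s g = d"
    proof (cases "d = ?c \<and> v \<in> En f")
      case True
      then have "g < n \<and> v \<in> En g \<longrightarrow> colouring s g \<noteq> d" using fr unfolding free_def by auto
      moreover have "arrs ?s 4 (v * regs ?s rN + d) = Suc f" using True E by auto
      ultimately show ?thesis using True e by auto
    next
      case False
      then have "arrs ?s 4 (v * regs ?s rN + d) = arrs s 4 (v * regs s rN + d)"
        using E cell_inj[of d "regs s rN" ?c v] v(3) c(2) N by auto
      then show ?thesis using represents_cell[OF rep v] False assms(6) v(2) by auto
    qed
  next
    fix d assume d: "0 < d" "d \<le> n"
    have "d \<noteq> ?a * regs s rN + ?c" "d \<noteq> ?b * regs s rN + ?c"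
      using cell_inj[of d "regs s rN" ?c 0] d(2) c(2) N pos by auto
    then show "arrs ?s 4 d \<noteq> 0" using rep d unfolding represents_def by auto
  qed (use rep in \<open>auto simp: represents_def\<close>)
  then have "Q ?s" by (rule Q)
  then show ?thesis using e c represents_rN[OF rep]
    by (simp add: set_colour_def upd_col_def fun_upd_twist)
qed

lemma wp_unset_colour:
  assumes rep: "represents s" and e: "regs s e = f" "f < n" and c: "0 < colouring s f" "colouring s f \<le> n"
    and pc: "pcol K (colouring s)"
    and Q: "\<And>T. represents (upd_col ((colouring s)(f := 0)) T s) \<Longrightarrow> Q (upd_col ((colouring s)(f := 0)) T s)"
  shows "wp (unset_colour e) s t Q"
proof -
  let ?c = "colouring s f" and ?a = "arrs s 2 f" and ?b = "arrs s 3 f"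
  let ?T = "(arrs s 4)(?a * regs s rN + ?c := 0, ?b * regs s rN + ?c := 0)"
  let ?s = "upd_col ((colouring s)(f := 0)) ?T s"
  have N: "regs s rN = Suc n" using represents_rN[OF rep] .
  have E: "En f = {?a, ?b}" using represents_ends[OF rep e(2)] .
  have pos: "?a \<noteq> 0" "?b \<noteq> 0" using zero_notin_ends[OF e(2)] E by auto
  have "represents ?s"
    unfolding represents_def
  proof (intro conjI allI impI)
    fix v d g :: nat assume v: "0 < v" "0 < d" "d \<le> n"
    show "arrs ?s 4 (v * regs ?s rN + d) = Suc g \<longleftrightarrow> g < n \<and> v \<in> En g \<and> colouring ?s g = d"
    proof (cases "d = ?c \<and> v \<in> En f")
      case True
      \<comment> \<open>Properness makes \<open>f\<close> the only owner of the cell, so clearing it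
        loses no other edge.\<close>
      then have "g < n \<and> v \<in> En g \<longrightarrow> g \<noteq> f \<longrightarrow> colouring s g \<noteq> d"
        using pcol_unique[OF pc, of g f v] e c by auto
      moreover have "arrs ?s 4 (v * regs ?s rN + d) = 0" using True E by auto
      ultimately show ?thesis using True v by auto
    next
      case False
      then have "arrs ?s 4 (v * regs ?s rN + d) = arrs s 4 (v * regs s rN + d)"
        using E cell_inj[of d "regs s rN" ?c v] v(3) c(2) N by auto
      then show ?thesis using represents_cell[OF rep v] False v(2) by auto
    qed
  next
    fix d assume d: "0 < d" "d \<le> n"
    have "d \<noteq> ?a * regs s rN + ?c" "d \<noteq> ?b * regs s rN + ?c"
      using cell_inj[of d "regs s rN" ?c 0] d(2) c(2) N pos by auto
    then show "arrs ?s 4 d \<noteq> 0" using rep d unfolding represents_def by auto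
  qed (use rep in \<open>auto simp: represents_def\<close>)
  then have "Q ?s" by (rule Q)
  then show ?thesis using e c represents_rN[OF rep]
    by (simp add: unset_colour_def upd_col_def fun_upd_twist)
qed

lemma wp_set_colour_Seq:
  assumes "represents s" "regs s e = f" "f < n" "0 < regs s c" "regs s c \<le> n"
    and "colouring s f = 0" "\<And>v. v \<in> En f \<Longrightarrow> free (colouring s) v (regs s c)"
    and "\<And>T. represents (upd_col ((colouring s)(f := regs s c)) T s) \<Longrightarrow>
      wp d (upd_col ((colouring s)(f := regs s c)) T s) t Q"
  shows "wp (set_colour e c ;; d) s t Q"
  by (rule wp_Seq[where ?t1.0 = 0 and ?t2.0 = t], rule wp_set_colour[OF assms(1-7)])
    (auto intro: assms(8))

lemma wp_unset_colour_Seq: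
  assumes "represents s" "regs s e = f" "f < n" "0 < colouring s f" "colouring s f \<le> n"
    and "pcol K (colouring s)"
    and "\<And>T. represents (upd_col ((colouring s)(f := 0)) T s) \<Longrightarrow>
      wp d (upd_col ((colouring s)(f := 0)) T s) t Q"
  shows "wp (unset_colour e ;; d) s t Q"
  by (rule wp_Seq[where ?t1.0 = 0 and ?t2.0 = t], rule wp_unset_colour[OF assms(1-6)])
    (auto intro: assms(7))

lemma wp_other_endpoint:
  assumes "represents s" "regs s e < n" "En (regs s e) = {regs s v, y}" "y \<noteq> regs s v"
  shows "wp (other_endpoint d e v) s t Q \<longleftrightarrow> Q (set_reg d y s)"
    and "wp (other_endpoint d e v ;; c) s t Q \<longleftrightarrow> wp c (set_reg d y s) t Q"
  using represents_ends[OF assms(1,2)] assms(3,4)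
  by (auto simp: other_endpoint_def doubleton_eq_iff)

definition same_env :: "state \<Rightarrow> state \<Rightarrow> bool" where
  "same_env s s' \<longleftrightarrow> (\<forall>x<20. regs s' x = regs s x) \<and> (\<forall>a. a \<noteq> 1 \<longrightarrow> a \<noteq> 4 \<longrightarrow> arrs s' a = arrs s a)"

text \<open>The swapped set \<open>D\<close> is stored nowhere; together with \<open>F\<close> it is
  recovered from the state as the set of edges whose colour differs from the initial one. This
  allows a loop variant that is a function of the state.\<close>

lemma chain_changed:
  assumes "chain_inv K col0 X \<alpha> c D Z P Q F col"
  shows "{e. e < n \<and> col e \<noteq> col0 e} = insert F D"
  using assms unfolding chain_inv_def by auto

lemma wp_kempe:
  assumes rep: "represents s" and pc: "pcol K (colouring s)" and K: "K \<le> Suc n"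
    and A: "0 < regs s rA" "regs s rA < K" "free (colouring s) (regs s rX) (regs s rA)"
    and C: "0 < regs s rC" "regs s rC < K" "\<not> free (colouring s) (regs s rX) (regs s rC)"
    and X: "0 < regs s rX" and t: "Suc n \<le> t"
    and Q: "\<And>s'. represents s' \<Longrightarrow> same_env s s' \<Longrightarrow>
        kempe_swap K (regs s rX) (regs s rA) (regs s rC) (colouring s) (colouring s') \<Longrightarrow> Q s'"
  shows "wp kempe s t Q"
proof -
  let ?X = "regs s rX" and ?\<alpha> = "regs s rA" and ?c = "regs s rC" and ?col = "colouring s"
  define I where "I s' \<longleftrightarrow> represents s' \<and> same_env s s' \<and>
     (if regs s' tGo = 0 then kempe_swap K ?X ?\<alpha> ?c ?col (colouring s')
      else \<exists>D. chain_inv K ?col ?X ?\<alpha> ?c D (regs s' tZ) (regs s' tP) (regs s' tQ) (regs s' tF) (colouring s'))" for s'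
  \<comment> \<open>At most \<open>n\<close> edges change, and each round but the last adds one to
    them. The last round adds none, but it sets \<open>tGo\<close> to 0 and hence the variant as
    well.\<close>
  define m where "m s' = (if regs s' tGo = 0 then 0 else Suc n - card {e. e < n \<and> colouring s' e \<noteq> ?col e})" for s'
  obtain f where f: "f < n" "?X \<in> En f" "?col f = ?c" using C(3) unfolding free_def by auto
  then have M: "arrs s 4 (?X * regs s rN + ?c) = Suc f"
    using represents_cell[OF rep X C(1)] C(2) K by auto
  have Xn: "?X \<noteq> 0" using X by simp
  have body: "wp (other_endpoint tY tF tZ ;;
       Assign tGo (Read 4 (cell (Var tY) (Var tQ))) ;;
       Assign tF' (Minus (Var tGo) (Const 1)) ;;
       com.If (Equal (Var tGo) (Const 0)) Skip (unset_colour tF') ;;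
       set_colour tF tQ ;;
       Assign tZ (Var tY) ;; Assign tF (Var tF') ;;
       Assign tC (Var tP) ;; Assign tP (Var tQ) ;; Assign tQ (Var tC)) s' 0 (\<lambda>s''. I s'' \<and> m s'' < m s')"
    if I: "I s'" and go: "regs s' tGo \<noteq> 0" for s'
  proof -
    let ?Z = "regs s' tZ" and ?P = "regs s' tP" and ?Q = "regs s' tQ" and ?F = "regs s' tF"
    let ?cs = "colouring s'"
    obtain D where inv: "chain_inv K ?col ?X ?\<alpha> ?c D ?Z ?P ?Q ?F ?cs"
      and rep': "represents s'" and env: "same_env s s'" using I go unfolding I_def by auto
    have F: "?F < n" "?Z \<in> En ?F" "?cs ?F = 0" "?F \<notin> D" and Qr: "0 < ?Q" "?Q < K" and pc': "pcol K ?cs"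
      and Dn: "D \<subseteq> {..<n}"
      using inv unfolding chain_inv_def by auto
    obtain y where y: "En ?F = {?Z, y}" "y \<noteq> ?Z" using other_end[OF F(1,2)] .
    have y0: "0 < y" using zero_notin_ends[OF F(1)] y(1) by auto
    note st = chain_inv_step[OF inv y]
    have ch: "{e. e < n \<and> ?cs e \<noteq> ?col e} = insert ?F D" by (rule chain_changed[OF inv])
    have fin: "finite D" using Dn finite_subset by blast
    have "insert ?F D \<subseteq> {..<n}" using Dn F(1) by auto
    from card_mono[OF _ this] have "card (insert ?F D) \<le> n" by simp
    then have m: "m s' = n - card D" "card D < n"
      unfolding m_def using go ch F(4) fin by auto
    have fin_post: "I s'' \<and> m s'' < m s'" if "represents s''" "same_env s' s''"
      "regs s'' tGo = 0" "kempe_swap K ?X ?\<alpha> ?c ?col (colouring s'')" for s''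
      unfolding I_def m_def[of s''] using that env m by (auto simp: same_env_def)
    have step_post: "I s'' \<and> m s'' < m s'" if "represents s''" "same_env s' s''"
      "chain_inv K ?col ?X ?\<alpha> ?c (insert ?F D) (regs s'' tZ) (regs s'' tP) (regs s'' tQ) (regs s'' tF) (colouring s'')"
      "regs s'' tGo \<noteq> 0" for s''
    proof -
      have "{e. e < n \<and> colouring s'' e \<noteq> ?col e} = insert (regs s'' tF) (insert ?F D)"
        by (rule chain_changed[OF that(3)])
      moreover have "regs s'' tF \<notin> insert ?F D" using that(3) unfolding chain_inv_def by auto
      ultimately have "m s'' = n - card (insert ?F D)" unfolding m_def using that(4) fin by auto
      then have "m s'' < m s'" using m F(4) fin by auto
      moreover have "I s''" unfolding I_def using that env by (auto simp: same_env_def)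
      ultimately show ?thesis by blast
    qed
    let ?v = "arrs s' 4 (y * regs s' rN + ?Q)"
    show ?thesis
    proof (cases "?v = 0")
      case True
      then have fr: "free ?cs y ?Q" using represents_free[OF rep' Qr(1), of y] Qr(2) K by auto
      show ?thesis using True
        apply (simp add: wp_other_endpoint[OF rep' F(1) y])
        apply (rule wp_set_colour_Seq)
        using rep' F Qr K fr st(1) y apply auto[7]
        apply (simp, rule fin_post)
        using st(3)[OF fr] by (auto simp: same_env_def)
    next
      case False
      then obtain g where vg: "?v = Suc g" by (cases ?v) auto
      then have g: "g < n" "y \<in> En g" "?cs g = ?Q" using represents_cell[OF rep' y0 Qr(1), of g] Qr(2) K by auto
      have gF: "g \<noteq> ?F" using g F Qr by auto
      have fr: "free (?cs(g := 0)) v ?Q" if "v \<in> En ?F" for v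
        using st(5,6)[OF g] that y by auto
      show ?thesis using vg
        apply (simp add: wp_other_endpoint[OF rep' F(1) y])
        apply (rule wp_unset_colour_Seq[where K = K])
        using rep' g Qr K pc' apply auto[6]
        apply (rule wp_set_colour_Seq)
        using F gF Qr K fr y apply auto[7]
        apply (simp, rule step_post)
        using st(4)[OF g] by (auto simp: same_env_def)
    qed
  qed
  have init: "I (upd_col (?col(f := 0)) T (s\<lparr>regs := (regs s)(tZ := ?X, tP := ?c, tQ := ?\<alpha>, tF := f, tGo := 1)\<rparr>))"
    (is "I ?s") if "represents (upd_col (?col(f := 0)) T (s\<lparr>regs := (regs s)(tZ := ?X, tP := ?c, tQ := ?\<alpha>, tF := f, tGo := 1)\<rparr>))" for T
    unfolding I_def using that chain_inv_init[OF pc A(1,2) C(1,2) A(3) f(1,2,3)]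
    by (auto simp: same_env_def)
  show ?thesis
    unfolding kempe_def using M
    apply simp
    apply (rule wp_unset_colour_Seq[where K = K])
    using rep f C(1,2) K pc apply auto[6]
    apply (rule wp_While[where I = I and m = m and u = 0])
       apply (simp, rule init, simp)
      apply (rule body, assumption, simp)
     apply (rule Q)
    using t by (auto simp: I_def m_def split: if_splits)
qed

end

section \<open>Extending a colouring to one more edge\<close>

definition shift_spoke :: "nat \<Rightarrow> com" where
  "shift_spoke g = Assign tC (Read 1 (Var g)) ;; unset_colour g ;; set_colour g rC ;; Assign rC (Var tC)"

text \<open>Each shift leaves in \<open>rC\<close> the colour it has released, so the same test with
  the new \<open>rC\<close> decides about the next shift: \<open>ready3\<close> turns into
  \<open>ready2\<close>, and \<open>ready2\<close> into a colour missing at both ends of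
  \<open>E\<close>.\<close>

definition finish :: com where
  "finish = com.If (And (bexp.Not (is_free rY rC)) (bexp.Not (is_free rV rC))) (shift_spoke rG') Skip ;;
     com.If (bexp.Not (is_free rY rC)) (shift_spoke rG) Skip ;; set_colour rE rC"

text \<open>By truncation, \<open>lacks v c\<close> is 1 if the cell is 0, and 0 otherwise.\<close>

abbreviation lacks :: "nat \<Rightarrow> nat \<Rightarrow> aexp" where
  "lacks v c \<equiv> Minus (Const 1) (Read 4 (cell (Var v) (Var c)))"

definition attempt :: com where
  "attempt = search rC 1 rK (Less (Const 1) (Plus (Plus (lacks rX rC) (lacks rY rC)) (Plus (lacks rV rC) (lacks rV' rC)))) ;;
     com.If (Less (Var rC) (Var rK)) (com.If (is_free rX rC) Skip kempe ;; finish) Skip"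

context multi_ends
begin

definition extended :: "nat \<Rightarrow> state \<Rightarrow> state \<Rightarrow> bool" where
  "extended K s s' \<longleftrightarrow> represents s' \<and> pcol K (colouring s') \<and>
     (\<forall>e<n. colouring s' e = 0 \<longleftrightarrow> colouring s e = 0 \<and> e \<noteq> regs s rE) \<and>
     regs s' 0 = regs s 0 \<and> regs s' rE = regs s rE \<and> regs s' rN = regs s rN \<and> regs s' rK = regs s rK"

lemma wp_shift_spoke_Seq:
  assumes rep: "represents s" and pc: "pcol K (colouring s)" and K: "K \<le> Suc n"
    and sp: "spoke X Y (colouring s) V (regs s g)"
    and c: "0 < regs s rC" "regs s rC < K" "free (colouring s) X (regs s rC)" "free (colouring s) V (regs s rC)"
    and g: "g \<noteq> rC" "g \<noteq> tC"
    and Q: "\<And>s'. represents s' \<Longrightarrow> colouring s' = (colouring s)(regs s g := regs s rC) \<Longrightarrow>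
        regs s' = (regs s)(tC := colouring s (regs s g), rC := colouring s (regs s g)) \<Longrightarrow> wp d s' t Q"
  shows "wp (shift_spoke g ;; d) s t Q"
proof -
  let ?G = "regs s g" and ?c = "regs s rC" and ?col = "colouring s"
  have G: "?G < n" "En ?G = {X, V}" "?col ?G \<noteq> 0" using sp unfolding spoke_def by auto
  have lt: "?col ?G \<le> n" using pc G K unfolding pcol_def by auto
  note sh = spoke_shift[OF pc sp c]
  show ?thesis
    unfolding shift_spoke_def
    apply simp
    apply (rule wp_unset_colour_Seq[where K = K])
    using rep G lt pc g apply auto[6]
    apply (simp only: wp_Seq_Seq)
    apply (rule wp_set_colour_Seq)
    using G c K g sh(2) apply auto[7]
    apply simp
    apply (rule Q)
    using g by (simp_all add: upd_col_def)
qed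

lemma wp_finish:
  assumes rep: "represents s" and pc: "pcol K (colouring s)" and K: "K \<le> Suc n"
    and E: "regs s rE < n" "En (regs s rE) = {regs s rX, regs s rY}" "regs s rX \<noteq> regs s rY"
      "colouring s (regs s rE) = 0"
    and c: "0 < regs s rC" "regs s rC < K"
    and ready: "ready3 (regs s rX) (regs s rY) (regs s rV) (regs s rG) (regs s rV') (regs s rG')
      (colouring s) (regs s rC)"
  shows "wp finish s t (extended K s)"
proof -
  have last: "wp (set_colour rE rC) s' t (extended K s)"
    if s': "represents s'" "pcol K (colouring s')" "regs s' rE = regs s rE" "regs s' 0 = regs s 0"
      "regs s' rN = regs s rN" "regs s' rK = regs s rK" "0 < regs s' rC" "regs s' rC < K"
      "\<forall>e<n. colouring s' e = 0 \<longleftrightarrow> colouring s e = 0"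
      "free (colouring s') (regs s rX) (regs s' rC)" "free (colouring s') (regs s rY) (regs s' rC)" for s'
  proof (rule wp_set_colour)
    show "extended K s (upd_col ((colouring s')(regs s rE := regs s' rC)) T s')"
      if "represents (upd_col ((colouring s')(regs s rE := regs s' rC)) T s')" for T
      unfolding extended_def using s' that E by (auto intro!: pcol_set)
  qed (use s' E K in auto)
  have Y0: "0 < regs s rY" using zero_notin_ends[OF E(1)] E(2) by auto
  have mid: "wp (com.If (bexp.Not (is_free rY rC)) (shift_spoke rG) Skip ;; set_colour rE rC) s' t (extended K s)"
    if s': "represents s'" "pcol K (colouring s')" "regs s' rE = regs s rE" "regs s' 0 = regs s 0"
      "regs s' rN = regs s rN" "regs s' rK = regs s rK" "0 < regs s' rC" "regs s' rC < K"
      "regs s' rX = regs s rX" "regs s' rY = regs s rY" "regs s' rV = regs s rV" "regs s' rG = regs s rG"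
      "\<forall>e<n. colouring s' e = 0 \<longleftrightarrow> colouring s e = 0"
      and r2: "ready2 (regs s rX) (regs s rY) (regs s rV) (regs s rG) (colouring s') (regs s' rC)" for s'
  proof (cases "free (colouring s') (regs s rY) (regs s' rC)")
    case True
    then have "arrs s' 4 (regs s' rY * regs s' rN + regs s' rC) = 0"
      using represents_free[OF s'(1)] s' K Y0 by auto
    then show ?thesis using last[OF s'(1-8,13)] True r2 unfolding ready2_def by simp
  next
    case False
    then have "arrs s' 4 (regs s' rY * regs s' rN + regs s' rC) \<noteq> 0"
      using represents_free[OF s'(1)] s' K by auto
    note r = ready2_shift[OF s'(2) r2 s'(7,8) E(3) False]
    have G: "regs s rG < n" "colouring s' (regs s rG) \<noteq> 0" using r(1) unfolding spoke_def by auto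
    then have lt: "colouring s' (regs s rG) < K" using s'(2) unfolding pcol_def by auto
    have "wp (shift_spoke rG ;; set_colour rE rC) s' t (extended K s)"
    proof (rule wp_shift_spoke_Seq[where X = "regs s rX" and Y = "regs s rY" and V = "regs s rV" and K = K], goal_cases)
      case (11 s'')
      then show ?case
        using s' r G lt spoke_shift(1)[OF s'(2) r(1) s'(7,8) r(2,3)] by (intro last) auto
    qed (use s' r K in auto)
    then show ?thesis using \<open>arrs s' 4 _ \<noteq> 0\<close> by simp
  qed
  show ?thesis
  proof (cases "free (colouring s) (regs s rY) (regs s rC) \<or> regs s rV \<noteq> 0 \<and> free (colouring s) (regs s rV) (regs s rC)")
    case True
    then have "arrs s 4 (regs s rY * regs s rN + regs s rC) = 0 \<or> arrs s 4 (regs s rV * regs s rN + regs s rC) = 0"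
      using represents_free[OF rep] c K Y0 by auto
    moreover have "ready2 (regs s rX) (regs s rY) (regs s rV) (regs s rG) (colouring s) (regs s rC)"
      using ready True unfolding ready3_def ready2_def by blast
    ultimately show ?thesis unfolding finish_def using mid[of s] rep pc c by auto
  next
    case False
    then have M: "arrs s 4 (regs s rY * regs s rN + regs s rC) \<noteq> 0" "arrs s 4 (regs s rV * regs s rN + regs s rC) \<noteq> 0"
      using represents_free[OF rep] c K by auto
    have F: "\<not> free (colouring s) (regs s rY) (regs s rC)" "regs s rV = 0 \<or> \<not> free (colouring s) (regs s rV) (regs s rC)"
      using False by auto
    note r = ready3_shift[OF pc ready c E(3) F]
    have G: "regs s rG' < n" "colouring s (regs s rG') \<noteq> 0" using r(1) unfolding spoke_def by auto
    then have lt: "colouring s (regs s rG') < K" using pc unfolding pcol_def by auto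
    have "wp (shift_spoke rG' ;; com.If (bexp.Not (is_free rY rC)) (shift_spoke rG) Skip ;; set_colour rE rC) s t (extended K s)"
    proof (rule wp_shift_spoke_Seq[where X = "regs s rX" and Y = "regs s rY" and V = "regs s rV'" and K = K], goal_cases)
      case (11 s'')
      then show ?case
        using c r G lt spoke_shift(1)[OF pc r(1) c r(2,3)] by (intro mid) auto
    qed (use rep pc r K c in auto)
    then show ?thesis unfolding finish_def using M by simp
  qed
qed

lemma at_most_one_of_four:
  "\<not> 1 < of_bool a + of_bool b + (of_bool c + of_bool d :: nat) \<Longrightarrow>
    \<not> (a \<and> b) \<and> \<not> (a \<and> c) \<and> \<not> (b \<and> c) \<and> \<not> (a \<and> d) \<and> \<not> (b \<and> d) \<and> \<not> (c \<and> d)"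
  by (cases a; cases b; cases c; cases d) simp_all

definition fan_state :: "nat \<Rightarrow> state \<Rightarrow> bool" where
  "fan_state K s \<longleftrightarrow> represents s \<and> pcol K (colouring s) \<and> K \<le> Suc n \<and> regs s rK = K \<and>
     fan (regs s rX) (regs s rY) (regs s rE) (regs s rV) (regs s rG) (regs s rV') (regs s rG') (colouring s) \<and>
     0 < regs s rA \<and> regs s rA < K \<and> free (colouring s) (regs s rX) (regs s rA)"

definition no_conflict :: "nat \<Rightarrow> state \<Rightarrow> bool" where
  "no_conflict K s \<longleftrightarrow> disjoint_free K (colouring s) (regs s rX) (regs s rY) \<and>
     (regs s rV \<noteq> 0 \<longrightarrow> disjoint_free K (colouring s) (regs s rX) (regs s rV) \<and>
        disjoint_free K (colouring s) (regs s rY) (regs s rV)) \<and>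
     (regs s rV' \<noteq> 0 \<longrightarrow> disjoint_free K (colouring s) (regs s rX) (regs s rV') \<and>
        disjoint_free K (colouring s) (regs s rY) (regs s rV') \<and>
        (regs s rV \<noteq> 0 \<longrightarrow> disjoint_free K (colouring s) (regs s rV) (regs s rV')))"

lemma wp_attempt:
  assumes fs: "fan_state K s" and t: "2 * n + 2 \<le> t"
    and Q1: "\<And>s'. extended K s s' \<Longrightarrow> Q s'"
    and Q2: "\<And>m. no_conflict K s \<Longrightarrow> Q (set_reg rC m s)"
  shows "wp attempt s t Q"
proof -
  let ?X = "regs s rX" and ?Y = "regs s rY" and ?V = "regs s rV" and ?V' = "regs s rV'" and ?col = "colouring s"
  have rep: "represents s" and pc: "pcol K ?col" and K: "K \<le> Suc n" "regs s rK = K"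
    and fan: "fan ?X ?Y (regs s rE) ?V (regs s rG) ?V' (regs s rG') ?col"
    and A: "0 < regs s rA" "regs s rA < K" "free ?col ?X (regs s rA)"
    using fs unfolding fan_state_def by auto
  have E: "regs s rE < n" "En (regs s rE) = {?X, ?Y}" "?X \<noteq> ?Y" "?col (regs s rE) = 0"
    using fan unfolding fan_def by auto
  have XY: "0 < ?X" "0 < ?Y" using zero_notin_ends[OF E(1)] E(2) by auto
  let ?l = "\<lambda>v m. 1 - arrs s 4 (v * regs s rN + m)"
  have l: "?l v m = of_bool (0 < v \<and> free ?col v m)" if "0 < m" "m < K" for v m
    using represents_free[OF rep, of m v] that K by auto
  show ?thesis
    unfolding attempt_def
  proof (rule wp_Seq[where ?t1.0 = "Suc n" and ?t2.0 = "Suc n"], rule wp_search, goal_cases)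
    case (3 m)
    then have m: "0 < m" "m < K" using K by auto
    let ?s = "set_reg rC m s"
    have rep': "represents ?s" using rep by simp
    have gt: "1 < of_bool (free ?col ?X m) + of_bool (free ?col ?Y m) +
        (of_bool (0 < ?V \<and> free ?col ?V m) + of_bool (0 < ?V' \<and> free ?col ?V' m) :: nat)"
      using 3(3) l[OF m] XY by (simp del: of_bool_conj)
    show ?case
    proof (cases "free ?col ?X m")
      case True
      then have "ready3 ?X ?Y ?V (regs s rG) ?V' (regs s rG') ?col m"
        using gt by (intro ready3_unswapped[OF fan]) (auto split: if_splits simp: of_bool_def)
      then have "wp finish ?s (Suc n) (extended K ?s)"
        using rep' pc K E m by (intro wp_finish) auto
      then have "wp finish ?s (Suc n) Q"
        by (rule wp_mono) (auto simp: extended_def intro: Q1)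
      moreover have "arrs s 4 (?X * regs s rN + m) = 0" using represents_free[OF rep] m K XY True by auto
      ultimately show ?thesis using m K by simp
    next
      case False
      have "wp (kempe ;; finish) ?s (Suc n) Q"
      proof (rule wp_Seq[where ?t1.0 = "Suc n" and ?t2.0 = 0], rule wp_kempe[where K = K])
        fix s' assume s': "represents s'" "same_env ?s s'" and
          sw: "kempe_swap K (regs ?s rX) (regs ?s rA) (regs ?s rC) (colouring ?s) (colouring s')"
        have r3: "ready3 ?X ?Y ?V (regs s rG) ?V' (regs s rG') (colouring s') m"
          using gt False sw A m by (intro ready3_swapped[OF fan A(3,1) m(1)]) (auto split: if_splits simp: of_bool_def)
        have eq: "regs s' x = regs s x" if "x < 20" "x \<noteq> rC" for x
          using s'(2) that unfolding same_env_def by auto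
        have cm: "regs s' rC = m" using s'(2) unfolding same_env_def by auto
        have k: "pcol K (colouring s')" "\<forall>e<n. colouring s' e = 0 \<longleftrightarrow> ?col e = 0"
          using sw unfolding kempe_swap_def by auto
        have "wp finish s' 0 (extended K s')"
          using s'(1) K E m k r3 by (intro wp_finish) (auto simp: eq cm)
        then show "wp finish s' 0 Q"
          by (rule wp_mono) (use k in \<open>auto simp: extended_def eq intro!: Q1\<close>)
      qed (use rep' pc K A m XY False in auto)
      moreover have "arrs s 4 (?X * regs s rN + m) \<noteq> 0" using represents_free[OF rep] m K False by auto
      ultimately show ?thesis using m K by simp
    qed
  next
    case (4 m)
    have no: "\<not> 1 < of_bool (0 < ?X \<and> free ?col ?X c) + of_bool (0 < ?Y \<and> free ?col ?Y c) +
        (of_bool (0 < ?V \<and> free ?col ?V c) + of_bool (0 < ?V' \<and> free ?col ?V' c) :: nat)"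
      if c: "0 < c" "c < K" for c
      using 4(2)[of c] l[OF c] c K by (simp del: of_bool_conj)
    have pw: "\<not> (free ?col ?X c \<and> free ?col ?Y c)" "?V \<noteq> 0 \<Longrightarrow> \<not> (free ?col ?X c \<and> free ?col ?V c)"
      "?V \<noteq> 0 \<Longrightarrow> \<not> (free ?col ?Y c \<and> free ?col ?V c)" "?V' \<noteq> 0 \<Longrightarrow> \<not> (free ?col ?X c \<and> free ?col ?V' c)"
      "?V' \<noteq> 0 \<Longrightarrow> \<not> (free ?col ?Y c \<and> free ?col ?V' c)"
      "?V \<noteq> 0 \<Longrightarrow> ?V' \<noteq> 0 \<Longrightarrow> \<not> (free ?col ?V c \<and> free ?col ?V' c)" if c: "0 < c" "c < K" for c
    proof -
      note four = at_most_one_of_four[OF no[OF c]]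
      have "0 < ?V" if "?V \<noteq> 0" using that by simp
      have "0 < ?V'" if "?V' \<noteq> 0" using that by simp
      show "\<not> (free ?col ?X c \<and> free ?col ?Y c)" using four XY by blast
      show "?V \<noteq> 0 \<Longrightarrow> \<not> (free ?col ?X c \<and> free ?col ?V c)" using four XY \<open>?V \<noteq> 0 \<Longrightarrow> 0 < ?V\<close> by blast
      show "?V \<noteq> 0 \<Longrightarrow> \<not> (free ?col ?Y c \<and> free ?col ?V c)" using four XY \<open>?V \<noteq> 0 \<Longrightarrow> 0 < ?V\<close> by blast
      show "?V' \<noteq> 0 \<Longrightarrow> \<not> (free ?col ?X c \<and> free ?col ?V' c)" using four XY \<open>?V' \<noteq> 0 \<Longrightarrow> 0 < ?V'\<close> by blast
      show "?V' \<noteq> 0 \<Longrightarrow> \<not> (free ?col ?Y c \<and> free ?col ?V' c)" using four XY \<open>?V' \<noteq> 0 \<Longrightarrow> 0 < ?V'\<close> by blast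
      show "?V \<noteq> 0 \<Longrightarrow> ?V' \<noteq> 0 \<Longrightarrow> \<not> (free ?col ?V c \<and> free ?col ?V' c)"
        using four \<open>?V \<noteq> 0 \<Longrightarrow> 0 < ?V\<close> \<open>?V' \<noteq> 0 \<Longrightarrow> 0 < ?V'\<close> by blast
    qed
    have "no_conflict K s"
      unfolding no_conflict_def disjoint_free_def by (intro conjI impI allI; rule pw; assumption)
    then have "Q (set_reg rC m s)" by (rule Q2)
    moreover have "\<not> m < regs s rK" using 4(1) by simp
    ultimately show ?case by simp
  qed (use K t in auto)
qed

end

section \<open>Growing fans at both ends of an edge\<close>

abbreviation uncoloured :: bexp where
  "uncoloured \<equiv> Equal (Read 1 (Var rE)) (Const 0)"

text \<open>The other end of the edge of colour \<open>rH\<close> at \<open>X\<close> is written as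
  the sum of both ends minus \<open>X\<close>, so that it can stand in a search condition. For a
  colour missing at \<open>X\<close> this reads the unrelated edge 0; after a failed attempt such a
  colour is missing at neither \<open>Y\<close> nor \<open>V\<close>, and the first conjunct rejects
  it.\<close>

definition fan_third :: com where
  "fan_third = search rH 1 rK
     (And (Less (Const 0) (Plus (lacks rY rH) (lacks rV rH)))
       (And (bexp.Not (Equal (Minus (Plus (Read 2 (Minus (Read 4 (cell (Var rX) (Var rH))) (Const 1)))
            (Read 3 (Minus (Read 4 (cell (Var rX) (Var rH))) (Const 1)))) (Var rX)) (Var rY)))
         (bexp.Not (Equal (Minus (Plus (Read 2 (Minus (Read 4 (cell (Var rX) (Var rH))) (Const 1)))
            (Read 3 (Minus (Read 4 (cell (Var rX) (Var rH))) (Const 1)))) (Var rX)) (Var rV))))) ;;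
     com.If (Less (Var rH) (Var rK))
       (Assign rG' (Minus (Read 4 (cell (Var rX) (Var rH))) (Const 1)) ;; other_endpoint rV' rG' rX ;; attempt)
       Skip"

text \<open>After the first failed attempt no colour is missing at both ends of \<open>E\<close>. So
  \<open>rB\<close>, missing at \<open>Y\<close>, occurs at \<open>X\<close>, on an edge that leads
  to a vertex other than \<open>Y\<close>.\<close>

definition fan_second :: com where
  "fan_second = Assign rG (Minus (Read 4 (cell (Var rX) (Var rB))) (Const 1)) ;;
     other_endpoint rV rG rX ;; attempt ;; com.If uncoloured fan_third Skip"

definition fan_search :: com where
  "fan_search = Assign rV (Const 0) ;; Assign rV' (Const 0) ;; attempt ;; com.If uncoloured fan_second Skip"

definition diamond :: com where
  "diamond = search rC 1 rK (And (is_free rV rC) (is_free rW rC)) ;;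
     com.If (Less (Var rC) (Var rK))
      (Assign tF (Minus (Read 4 (cell (Var rY) (Var rC))) (Const 1)) ;;
       unset_colour tF ;; unset_colour rWG ;; unset_colour rG ;;
       set_colour tF rA ;; set_colour rWG rC ;; set_colour rG rC ;; set_colour rE rB) Skip"

text \<open>Exchanging \<open>rX\<close> with \<open>rY\<close> and \<open>rA\<close> with
  \<open>rB\<close> lets \<open>fan_search\<close> work at the other end, while \<open>rW\<close>
  and \<open>rWG\<close> keep the first fan. Each second fan vertex is reached by the chosen colour
  missing at the opposite end, so afterwards the edges in \<open>rG\<close> and \<open>rWG\<close>
  have the colours \<open>rB\<close> and \<open>rA\<close>, which \<open>diamond\<close>
  reuses.\<close>

definition opposite_fan :: com where
  "opposite_fan = Assign rW (Var rV) ;; Assign rWG (Var rG) ;;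
     Assign tZ (Var rX) ;; Assign rX (Var rY) ;; Assign rY (Var tZ) ;;
     Assign tZ (Var rA) ;; Assign rA (Var rB) ;; Assign rB (Var tZ) ;; fan_search ;;
     com.If (And uncoloured (And (Equal (Var rV') (Const 0)) (bexp.Not (Equal (Var rV) (Var rW))))) diamond Skip"

definition both_fans :: com where
  "both_fans = fan_search ;; com.If (And uncoloured (Equal (Var rV') (Const 0))) opposite_fan Skip"

definition new_colour :: com where
  "new_colour = com.If uncoloured
     (Assign rC (Var rK) ;; set_colour rE rC ;; Assign rK (Plus (Var rK) (Const 1))) Skip"

definition insert_edge :: com where
  "insert_edge = Assign rX (Read 2 (Var rE)) ;; Assign rY (Read 3 (Var rE)) ;;
     search rA 1 rK (is_free rX rA) ;; search rB 1 rK (is_free rY rB) ;;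
     com.If (And (Less (Var rA) (Var rK)) (Less (Var rB) (Var rK))) both_fans Skip ;; new_colour"

context multi_ends
begin

lemma represents_cong:
  "arrs s' = arrs s \<Longrightarrow> regs s' rN = regs s rN \<Longrightarrow> represents s' = represents s"
  unfolding represents_def by simp

lemma extendedE_uncoloured:
  assumes "extended K s s'" "colouring s (regs s rE) = 0" "regs s rE < n"
  shows "colouring s' (regs s' rE) \<noteq> 0"
  using assms unfolding extended_def by auto

lemma extended_regs:
  assumes "extended K s s'" "colouring s = colouring s0" "regs s 0 = regs s0 0" "regs s rE = regs s0 rE"
    "regs s rN = regs s0 rN" "regs s rK = regs s0 rK"
  shows "extended K s0 s'"
  using assms unfolding extended_def by simp

lemma edge_of_colour:
  assumes rep: "represents s" and c: "0 < c" "c \<le> n" and X: "0 < X" and "\<not> free (colouring s) X c"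
  obtains g v where "g < n" "En g = {X, v}" "v \<noteq> X" "v \<noteq> 0" "colouring s g = c"
    "arrs s 4 (X * regs s rN + c) = Suc g"
proof -
  obtain g where g: "g < n" "X \<in> En g" "colouring s g = c" using assms(5) unfolding free_def by auto
  obtain v where v: "En g = {X, v}" "v \<noteq> X" using other_end[OF g(1,2)] .
  have "v \<noteq> 0" using zero_notin_ends[OF g(1)] v(1) by auto
  moreover have "arrs s 4 (X * regs s rN + c) = Suc g" using represents_cell[OF rep X c] g by auto
  ultimately show thesis using that g v by blast
qed

text \<open>The evidence left by a failed fan search, from which \<open>K \<le> \<Gamma>\<close>
  will be derived: the fan reaches \<open>V\<close>, and it is maximal unless it has a third
  vertex.\<close>

definition stuck :: "nat \<Rightarrow> state \<Rightarrow> state \<Rightarrow> bool" where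
  "stuck K s s' \<longleftrightarrow> arrs s' = arrs s \<and> (\<forall>x. x \<notin> {7, 8, 9, 10, 11, 12} \<longrightarrow> regs s' x = regs s x) \<and>
     no_conflict K s' \<and> regs s' rV \<noteq> 0 \<and> colouring s' (regs s' rG) = regs s rB \<and>
     fan (regs s rX) (regs s rY) (regs s rE) (regs s' rV) (regs s' rG) (regs s' rV') (regs s' rG') (colouring s) \<and>
     (regs s' rV' = 0 \<longrightarrow> closed_fan K (colouring s) (regs s rX) (regs s rY) (regs s' rV))"

lemma wp_fan_third:
  assumes fs: "fan_state K s" and V: "regs s rV \<noteq> 0" "regs s rV' = 0" and nc: "no_conflict K s"
    and B: "colouring s (regs s rG) = regs s rB" and t: "3 * n + 3 \<le> t"
    and Q1: "\<And>s'. extended K s s' \<Longrightarrow> Q s'"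
    and Q2: "\<And>s'. stuck K s s' \<Longrightarrow> Q s'"
  shows "wp fan_third s t Q"
proof -
  let ?X = "regs s rX" and ?Y = "regs s rY" and ?V = "regs s rV" and ?col = "colouring s"
  have rep: "represents s" and pc: "pcol K ?col" and K: "K \<le> Suc n" "regs s rK = K"
    and fan: "fan ?X ?Y (regs s rE) ?V (regs s rG) 0 (regs s rG') ?col"
    and A: "0 < regs s rA" "regs s rA < K" "free ?col ?X (regs s rA)"
    using fs V(2) unfolding fan_state_def by auto
  have E: "regs s rE < n" "En (regs s rE) = {?X, ?Y}" "?X \<noteq> ?Y" "?col (regs s rE) = 0"
    and sp: "spoke ?X ?Y ?col ?V (regs s rG)"
    using fan V unfolding fan_def by auto
  have XY: "0 < ?X" "0 < ?Y" using zero_notin_ends[OF E(1)] E(2) by auto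
  have lk: "0 < Suc 0 - arrs s 4 (?Y * regs s rN + c) + (Suc 0 - arrs s 4 (?V * regs s rN + c)) \<longleftrightarrow>
      free ?col ?Y c \<or> free ?col ?V c" if "0 < c" "c < K" for c
    using represents_free[OF rep, of c ?Y] represents_free[OF rep, of c ?V] that K XY V by auto
  have ed: "\<exists>g v. g < n \<and> En g = {?X, v} \<and> v \<noteq> ?X \<and> v \<noteq> 0 \<and> ?col g = c \<and>
      arrs s 4 (?X * regs s rN + c) = Suc g \<and> arrs s 2 g + arrs s 3 g - ?X = v"
    if c: "0 < c" "c < K" "free ?col ?Y c \<or> free ?col ?V c" for c
  proof -
    have "\<not> free ?col ?X c" "c \<le> n" using nc c V K unfolding no_conflict_def disjoint_free_def by auto
    then obtain g v where g: "g < n" "En g = {?X, v}" "v \<noteq> ?X" "v \<noteq> 0" "?col g = c"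
        "arrs s 4 (?X * regs s rN + c) = Suc g"
      using edge_of_colour[OF rep c(1) _ XY(1)] by blast
    moreover have "arrs s 2 g + arrs s 3 g - ?X = v"
      using represents_ends[OF rep g(1)] g(2,3) by (auto simp: doubleton_eq_iff)
    ultimately show ?thesis by blast
  qed
  show ?thesis
    unfolding fan_third_def
  proof (rule wp_Seq[where ?t1.0 = "Suc n" and ?t2.0 = "2 * n + 2"], rule wp_search, goal_cases)
    case (3 m)
    then have m: "0 < m" "m < K" using K by auto
    have fr: "free ?col ?Y m \<or> free ?col ?V m" using 3(3) lk[OF m] by (simp add: One_nat_def)
    obtain g v where g: "g < n" "En g = {?X, v}" "v \<noteq> ?X" "v \<noteq> 0" "?col g = m"
      "arrs s 4 (?X * regs s rN + m) = Suc g" "arrs s 2 g + arrs s 3 g - ?X = v"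
      using ed[OF m fr] by blast
    have v: "v \<noteq> ?Y" "v \<noteq> ?V" using 3(3) g(6,7) by auto
    let ?s = "s\<lparr>regs := (regs s)(12 := m, 10 := g, 9 := v)\<rparr>"
    have fan': "fan ?X ?Y (regs s rE) ?V (regs s rG) v g ?col"
      using fan V fr g v m unfolding fan_def spoke_def by auto
    have "wp attempt ?s (2 * n + 2) Q"
    proof (rule wp_attempt[where K = K])
      show "fan_state K ?s" unfolding fan_state_def using rep pc K fan' A by auto
      show "Q s'" if "extended K ?s s'" for s'
        using that by (intro Q1) (auto intro: extended_regs)
      show "Q (set_reg rC m' ?s)" if "no_conflict K ?s" for m'
        using that fan' B g V by (intro Q2) (auto simp: stuck_def no_conflict_def)
    qed simp
    moreover have "wp (other_endpoint 9 10 3 ;; attempt) (s\<lparr>regs := (regs s)(12 := m, 10 := g)\<rparr>) (2 * n + 2) Q \<longleftrightarrow>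
        wp attempt ?s (2 * n + 2) Q"
      using rep g by (subst wp_other_endpoint(2)[where y = v]) auto
    ultimately show ?case using m K g(6) by simp
  next
    case (4 m)
    have "closed_fan K ?col ?X ?Y ?V"
      unfolding closed_fan_def
    proof (intro allI impI)
      fix c e assume c: "0 < c" "c < K" "free ?col ?Y c \<or> free ?col ?V c" and e: "e < n" "?X \<in> En e" "?col e = c"
      obtain g v where g: "g < n" "En g = {?X, v}" "?col g = c"
        "arrs s 4 (?X * regs s rN + c) = Suc g" "arrs s 2 g + arrs s 3 g - ?X = v"
        using ed[OF c] by blast
      have "g = e" using pcol_unique[OF pc g(1) e(1), of ?X] g e c by auto
      moreover have "v = ?Y \<or> v = ?V"
        using 4(2)[of c] c lk[OF c(1,2)] g(4,5) K by (auto simp: One_nat_def)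
      ultimately show "En e = {?X, ?Y} \<or> En e = {?X, ?V}" using g(2) by auto
    qed
    then have "Q (set_reg rH m s)"
      using nc V B fan by (intro Q2) (auto simp: stuck_def no_conflict_def)
    moreover have "\<not> m < regs s rK" using 4(1) by simp
    ultimately show ?case by simp
  qed (use K t in auto)
qed

definition edge_state :: "nat \<Rightarrow> state \<Rightarrow> bool" where
  "edge_state K s \<longleftrightarrow> represents s \<and> pcol K (colouring s) \<and> K \<le> Suc n \<and> regs s rK = K \<and>
     regs s rE < n \<and> En (regs s rE) = {regs s rX, regs s rY} \<and> regs s rX \<noteq> regs s rY \<and>
     colouring s (regs s rE) = 0 \<and>
     0 < regs s rA \<and> regs s rA < K \<and> free (colouring s) (regs s rX) (regs s rA) \<and>
     0 < regs s rB \<and> regs s rB < K \<and> free (colouring s) (regs s rY) (regs s rB)"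

lemma wp_fan_second:
  assumes es: "edge_state K s" and V: "regs s rV = 0" "regs s rV' = 0" and nc: "no_conflict K s"
    and t: "5 * n + 5 \<le> t"
    and Q1: "\<And>s'. extended K s s' \<Longrightarrow> Q s'"
    and Q2: "\<And>s'. stuck K s s' \<Longrightarrow> Q s'"
  shows "wp fan_second s t Q"
proof -
  let ?X = "regs s rX" and ?Y = "regs s rY" and ?B = "regs s rB" and ?col = "colouring s"
  have rep: "represents s" and pc: "pcol K ?col" and K: "K \<le> Suc n" "regs s rK = K"
    and E: "regs s rE < n" "En (regs s rE) = {?X, ?Y}" "?X \<noteq> ?Y" "?col (regs s rE) = 0"
    and A: "0 < regs s rA" "regs s rA < K" "free ?col ?X (regs s rA)"
    and B: "0 < ?B" "?B < K" "free ?col ?Y ?B"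
    using es unfolding edge_state_def by auto
  have XY: "0 < ?X" "0 < ?Y" using zero_notin_ends[OF E(1)] E(2) by auto
  have "\<not> free ?col ?X ?B" "?B \<le> n" using nc B K unfolding no_conflict_def disjoint_free_def by auto
  then obtain g v where g: "g < n" "En g = {?X, v}" "v \<noteq> ?X" "v \<noteq> 0" "?col g = ?B"
      "arrs s 4 (?X * regs s rN + ?B) = Suc g"
    using edge_of_colour[OF rep B(1) _ XY(1)] by blast
  have vY: "v \<noteq> ?Y" using B(3) g unfolding free_def by auto
  let ?s = "s\<lparr>regs := (regs s)(8 := g, 7 := v)\<rparr>"
  have fs: "fan_state K ?s"
    unfolding fan_state_def fan_def spoke_def using rep pc K E A B g vY V by auto
  have "wp (attempt ;; com.If uncoloured fan_third Skip) ?s t Q"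
  proof (rule wp_Seq[where ?t1.0 = "2 * n + 2" and ?t2.0 = "3 * n + 3"], rule wp_attempt[OF fs])
    fix s' assume ex: "extended K ?s s'"
    then have "colouring s' (regs s' rE) \<noteq> 0" using extendedE_uncoloured[OF ex] E by auto
    moreover have "Q s'" using ex by (intro Q1) (auto intro: extended_regs)
    ultimately show "wp (com.If uncoloured fan_third Skip) s' (3 * n + 3) Q" by simp
  next
    fix m assume nc': "no_conflict K ?s"
    let ?s' = "set_reg rC m ?s"
    have "wp fan_third ?s' (3 * n + 3) Q"
    proof (rule wp_fan_third[where K = K])
      show "fan_state K ?s'" using fs unfolding fan_state_def by simp
      show "no_conflict K ?s'" using nc' by (simp add: no_conflict_def)
      show "Q s'" if "extended K ?s' s'" for s'
        using that by (intro Q1) (auto intro: extended_regs)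
      show "Q s'" if "stuck K ?s' s'" for s'
        using that by (intro Q2) (auto simp: stuck_def)
    qed (use g V in auto)
    then show "wp (com.If uncoloured fan_third Skip) ?s' (3 * n + 3) Q" using E by simp
  qed (use t in auto)
  moreover have "wp (other_endpoint 7 8 3 ;; attempt ;; com.If uncoloured fan_third Skip) (s\<lparr>regs := (regs s)(8 := g)\<rparr>) t Q \<longleftrightarrow>
      wp (attempt ;; com.If uncoloured fan_third Skip) ?s t Q"
    using rep g by (subst wp_other_endpoint(2)[where y = v]) auto
  ultimately show ?thesis unfolding fan_second_def using g(6) by simp
qed

lemma wp_fan_search:
  assumes es: "edge_state K s" and t: "7 * n + 7 \<le> t"
    and Q1: "\<And>s'. extended K s s' \<Longrightarrow> Q s'"
    and Q2: "\<And>s'. stuck K s s' \<Longrightarrow> Q s'"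
  shows "wp fan_search s t Q"
proof -
  have E: "regs s rE < n" "colouring s (regs s rE) = 0" using es unfolding edge_state_def by auto
  let ?s = "s\<lparr>regs := (regs s)(7 := 0, 9 := 0)\<rparr>"
  have fs: "fan_state K ?s"
    using es unfolding fan_state_def fan_def edge_state_def by auto
  have "wp (attempt ;; com.If uncoloured fan_second Skip) ?s t Q"
  proof (rule wp_Seq[where ?t1.0 = "2 * n + 2" and ?t2.0 = "5 * n + 5"], rule wp_attempt[OF fs])
    fix s' assume ex: "extended K ?s s'"
    then have "colouring s' (regs s' rE) \<noteq> 0" using extendedE_uncoloured[OF ex] E by auto
    moreover have "Q s'" using ex by (intro Q1) (auto intro: extended_regs)
    ultimately show "wp (com.If uncoloured fan_second Skip) s' (5 * n + 5) Q" by simp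
  next
    fix m assume nc': "no_conflict K ?s"
    let ?s' = "set_reg rC m ?s"
    have "wp fan_second ?s' (5 * n + 5) Q"
    proof (rule wp_fan_second[where K = K])
      show "edge_state K ?s'" using es unfolding edge_state_def by simp
      show "no_conflict K ?s'" using nc' by (simp add: no_conflict_def)
      show "Q s'" if "extended K ?s' s'" for s'
        using that by (intro Q1) (auto intro: extended_regs)
      show "Q s'" if "stuck K ?s' s'" for s'
        using that by (intro Q2) (auto simp: stuck_def)
    qed auto
    then show "wp (com.If uncoloured fan_second Skip) ?s' (5 * n + 5) Q" using E by simp
  qed (use t in auto)
  then show ?thesis unfolding fan_search_def by simp
qed

lemma wp_diamond:
  assumes es: "edge_state K s"
    and V: "spoke (regs s rX) (regs s rY) (colouring s) (regs s rV) (regs s rG)"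
      "colouring s (regs s rG) = regs s rB"
    and W: "spoke (regs s rY) (regs s rX) (colouring s) (regs s rW) (regs s rWG)"
      "colouring s (regs s rWG) = regs s rA"
    and VW: "regs s rV \<noteq> regs s rW"
    and cl: "closed_fan K (colouring s) (regs s rY) (regs s rX) (regs s rW)"
      "disjoint_free K (colouring s) (regs s rY) (regs s rW)"
    and t: "Suc n \<le> t"
    and Q1: "\<And>s'. extended K s s' \<Longrightarrow> Q s'"
    and Q2: "\<And>m. disjoint_free K (colouring s) (regs s rV) (regs s rW) \<Longrightarrow> Q (set_reg rC m s)"
  shows "wp diamond s t Q"
proof -
  let ?X = "regs s rX" and ?Y = "regs s rY" and ?A = "regs s rA" and ?B = "regs s rB" and ?col = "colouring s"
    and ?V = "regs s rV" and ?W = "regs s rW" and ?G = "regs s rG" and ?H = "regs s rWG" and ?E = "regs s rE"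
  have rep: "represents s" and pc: "pcol K ?col" and K: "K \<le> Suc n" "regs s rK = K"
    and E: "?E < n" "En ?E = {?X, ?Y}" "?X \<noteq> ?Y" "?col ?E = 0"
    and A: "0 < ?A" "?A < K" "free ?col ?X ?A"
    and B: "0 < ?B" "?B < K" "free ?col ?Y ?B"
    using es unfolding edge_state_def by auto
  have XY: "0 < ?X" "0 < ?Y" using zero_notin_ends[OF E(1)] E(2) by auto
  have v: "?V \<noteq> 0" "?G < n" "En ?G = {?X, ?V}" "?V \<noteq> ?X" "?V \<noteq> ?Y" using V(1) unfolding spoke_def by auto
  have w: "?W \<noteq> 0" "?H < n" "En ?H = {?Y, ?W}" "?W \<noteq> ?X" "?W \<noteq> ?Y" using W(1) unfolding spoke_def by auto
  show ?thesis
    unfolding diamond_def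
  proof (rule wp_Seq[where ?t1.0 = "Suc n" and ?t2.0 = 0], rule wp_search, goal_cases)
    case (3 m)
    then have m: "0 < m" "m < K" using K by auto
    have fr: "free ?col ?V m" "free ?col ?W m"
      using 3(3) represents_free[OF rep, of m] m K by auto
    \<comment> \<open>A colour missing at \<open>W\<close> sits on an edge \<open>XY\<close>, by
      maximality of the fan at \<open>Y\<close>; this is the \<open>h\<close> that
      \<open>diamond_recolour\<close> asks for.\<close>
    obtain h where h: "h < n" "En h = {?X, ?Y}" "?col h = m"
      using closed_fan_edge[OF cl w(5,4) m fr(2)] by (auto simp: insert_commute)
    have M: "arrs s 4 (?Y * regs s rN + m) = Suc h"
      using represents_cell[OF rep XY(2), of m h] m K h by auto
    note d = diamond_recolour[OF pc E V(1) _ W(1) _ VW m fr h, unfolded V(2) W(2), OF B(3) A(3)]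
    have ne: "h \<noteq> ?G" "h \<noteq> ?H" "?G \<noteq> ?H" "?E \<noteq> h" "?E \<noteq> ?G" "?E \<noteq> ?H"
    proof -
      have "?X \<in> En h" "?Y \<in> En h" "?X \<notin> En ?H" "?Y \<notin> En ?G" "?X \<in> En ?G"
        using h(2) v(3,5) w(3,4) E(3) v(4) by auto
      then show "h \<noteq> ?G" "h \<noteq> ?H" "?G \<noteq> ?H" by metis+
      show "?E \<noteq> h" "?E \<noteq> ?G" "?E \<noteq> ?H" using E(4) h(3) m V(2) W(2) A B by auto
    qed
    let ?s = "s\<lparr>regs := (regs s)(11 := m, 23 := h)\<rparr>"
    have rep': "represents ?s" using rep by simp
    have pc1: "pcol K (?col(h := 0))" "pcol K (?col(h := 0, ?H := 0))" by (intro pcol_unset pc)+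
    have "wp (unset_colour tF ;; unset_colour rWG ;; unset_colour rG ;;
       set_colour tF rA ;; set_colour rWG rC ;; set_colour rG rC ;; set_colour rE rB) ?s 0 Q"
      apply (rule wp_unset_colour_Seq[where K = K])
      using rep' h m K pc apply auto[6]
      apply (rule wp_unset_colour_Seq[where K = K])
      using w ne W(2) A K pc1 apply auto[6]
      apply (rule wp_unset_colour_Seq[where K = K])
      using v ne V(2) B K pc1 apply auto[6]
      apply (rule wp_set_colour_Seq)
      using h m K A d(1,2) ne apply auto[7]
      apply (rule wp_set_colour_Seq)
      using w m K d(4,5) ne apply auto[7]
      apply (rule wp_set_colour_Seq)
      using v m K d(7,8) ne apply auto[7]
      apply (rule wp_set_colour)
      using E m K B d(10,11) ne apply auto[7]
      apply (rule Q1)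
      using d(12) E h m ne v w V(2) W(2) A B K by (auto simp: extended_def)
    then show ?case using m K M by simp
  next
    case (4 m)
    have "disjoint_free K ?col ?V ?W"
      unfolding disjoint_free_def
    proof (intro allI impI)
      fix c assume c: "0 < c" "c < K"
      then have "\<not> (arrs s 4 (?V * regs s rN + c) = 0 \<and> arrs s 4 (?W * regs s rN + c) = 0)"
        using 4(2)[of c] K by auto
      then show "\<not> (free ?col ?V c \<and> free ?col ?W c)"
        using represents_free[OF rep, of c] c K v(1) w(1) by auto
    qed
    then have "Q (set_reg rC m s)" by (rule Q2)
    moreover have "\<not> m < regs s rK" using 4(1) by simp
    ultimately show ?case by simp
  qed (use K t in auto)
qed

end

context gamma_ends
begin

text \<open>The colours in use are \<open>1, ..., K - 1\<close> with \<open>K\<close> in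
  \<open>rK\<close>. \<open>K \<le> Suc e\<close> records that an edge brings at most one new
  colour, which keeps all colours within the width of the table; \<open>K \<le> Suc \<Gamma>\<close>
  is the bound to be proved.\<close>

definition coloured_upto :: "nat \<Rightarrow> state \<Rightarrow> bool" where
  "coloured_upto e s \<longleftrightarrow> represents s \<and> pcol (regs s rK) (colouring s) \<and> regs s 0 = n \<and>
     (\<forall>f<n. colouring s f = 0 \<longleftrightarrow> e \<le> f) \<and> 0 < regs s rK \<and> regs s rK \<le> Suc e \<and> regs s rK \<le> Suc \<Gamma>"

text \<open>The budget \<open>17 * (n + 1)\<close> covers two searches for missing colours, two fan
  searches of \<open>7 * (n + 1)\<close> each and the search in \<open>diamond\<close>. The 7
  consists of three attempts, each a scan of the colours and a Kempe chain, and the search for a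
  third fan vertex.\<close>

lemma wp_insert_edge:
  assumes s: "coloured_upto (regs s rE) s" and e: "regs s rE < n" and t: "17 * n + 17 \<le> t"
    and Q: "\<And>s'. coloured_upto (Suc (regs s rE)) s' \<Longrightarrow> regs s' rE = regs s rE \<Longrightarrow> Q s'"
  shows "wp insert_edge s t Q"
proof -
  define K where "K = regs s rK"
  let ?E = "regs s rE" and ?col = "colouring s"
  define X where "X = arrs s 2 ?E"
  define Y where "Y = arrs s 3 ?E"
  have rep: "represents s" and pc: "pcol K ?col" and n: "regs s 0 = n" and K: "0 < K" "K \<le> Suc ?E" "K \<le> Suc \<Gamma>"
    and dom: "\<And>f. f < n \<Longrightarrow> ?col f = 0 \<longleftrightarrow> ?E \<le> f"
    using s unfolding coloured_upto_def K_def by auto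
  have E: "En ?E = {X, Y}" "?col ?E = 0" "X \<noteq> Y"
    using represents_ends[OF rep e] card_ends[OF e] dom[OF e] unfolding X_def Y_def by auto
  have Kn: "K \<le> n" using K e by auto
  have XY: "0 < X" "0 < Y" using zero_notin_ends[OF e] E(1) by auto
  have last1: "wp new_colour s' u Q"
    if ex: "extended K s s'" for s' u
  proof -
    have "colouring s' (regs s' rE) \<noteq> 0" using extendedE_uncoloured[OF ex E(2) e] .
    moreover have "Q s'"
      using ex dom K n unfolding extended_def
      by (intro Q) (auto simp: coloured_upto_def K_def not_le less_Suc_eq_le le_less)
    ultimately show ?thesis by (simp add: new_colour_def)
  qed
  have last2: "wp new_colour s' u Q"
    if s': "represents s'" "colouring s' = ?col" "regs s' 0 = n" "regs s' rE = ?E" "regs s' rK = K" "K \<le> \<Gamma>" for s' u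
  proof -
    have fr: "free ?col v K" for v
      using pc unfolding free_def pcol_def by auto
    have "pcol (Suc K) (?col(?E := K))"
      using fr by (intro pcol_set pcol_mono[OF pc]) auto
    then have co: "coloured_upto (Suc ?E) s''" if "represents s''" "colouring s'' = ?col(?E := K)" "regs s'' 0 = n"
        "regs s'' rK = Suc K" for s''
      using that dom K s'(6) e unfolding coloured_upto_def by (auto simp: Suc_le_eq le_less)
    have "wp (set_colour rE rC ;; Assign rK (Plus (Var rK) (Const 1))) (set_reg rC K s') u Q"
      apply (rule wp_set_colour_Seq)
      using s' e K Kn E(2) fr apply auto[7]
      apply simp
      apply (rule Q)
       apply (rule co)
      using s' by (simp_all add: upd_col_def)
    then show ?thesis using s' E(2) by (simp add: new_colour_def)
  qed
  \<comment> \<open>Common postcondition of all branches: the edge is coloured, or the old colouring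
    is intact and a new colour is known to be affordable.\<close>
  define R where "R s' \<longleftrightarrow> extended K s s' \<or> represents s' \<and> colouring s' = ?col \<and> regs s' 0 = n \<and>
      regs s' rE = ?E \<and> regs s' rK = K \<and> K \<le> \<Gamma>" for s'
  have last: "R s' \<Longrightarrow> wp new_colour s' u Q" for s' u
    unfolding R_def using last1 last2 by blast
  have three: "K \<le> \<Gamma>" if st: "stuck K u u'" "regs u' rV' \<noteq> 0" "pcol K (colouring u)" for u u'
  proof -
    have nc: "no_conflict K u'" and fan: "fan (regs u rX) (regs u rY) (regs u rE) (regs u' rV) (regs u' rG)
        (regs u' rV') (regs u' rG') (colouring u)" and eq: "colouring u' = colouring u"
        "regs u' rX = regs u rX" "regs u' rY = regs u rY" and "regs u' rV \<noteq> 0"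
      using st(1) unfolding stuck_def by auto
    then show ?thesis
      using three_fan_bound[OF st(3) fan st(2)] st(2) unfolding no_conflict_def by auto
  qed
  have body: "wp both_fans s2 (15 * n + 15) R"
    if es: "edge_state K s2" and s2: "colouring s2 = ?col" "regs s2 0 = n" "regs s2 rE = ?E" "regs s2 rX = X" "regs s2 rY = Y"
      "regs s2 rN = regs s rN"
    for s2
    unfolding both_fans_def
  proof (rule wp_Seq[where ?t1.0 = "7 * n + 7" and ?t2.0 = "8 * n + 8"], rule wp_fan_search[OF es])
    have sK: "regs s2 rK = K" and rep2: "represents s2" using es unfolding edge_state_def by auto
    fix s' assume ex: "extended K s2 s'"
    have "extended K s s'" by (rule extended_regs[OF ex]) (use s2 n sK K_def in auto)
    moreover have "colouring s' (regs s' rE) \<noteq> 0" using extendedE_uncoloured[OF ex] s2 E e by auto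
    ultimately show "wp (com.If (And uncoloured (Equal (Var rV') (Const 0))) opposite_fan Skip) s' (8 * n + 8) R"
      by (simp add: R_def)
  next
    have sK: "regs s2 rK = K" and rep2: "represents s2" using es unfolding edge_state_def by auto
    fix s3 assume st: "stuck K s2 s3"
    have eq3: "regs s3 x = regs s2 x" if "x \<notin> {7, 8, 9, 10, 11, 12}" for x
      using st that unfolding stuck_def by auto
    have ar3: "arrs s3 = arrs s2" using st unfolding stuck_def by auto
    have rep3: "represents s3" using rep2 represents_cong[OF ar3] eq3 by simp
    have R3: "R (s3\<lparr>regs := r\<rparr>)" if "K \<le> \<Gamma>" "r 0 = n" "r rE = ?E" "r rK = K" "r rN = regs s rN" for r
      unfolding R_def using that rep3 ar3 s2 by (auto simp: eq3)
    show "wp (com.If (And uncoloured (Equal (Var rV') (Const 0))) opposite_fan Skip) s3 (8 * n + 8) R"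
    proof (cases "regs s3 rV' = 0")
      case False
      then have "K \<le> \<Gamma>" using three[OF st] pc s2 by auto
      then have "R s3" using R3[of "regs s3"] s2 sK by (simp add: eq3)
      then show ?thesis using False by simp
    next
      case True
      let ?V = "regs s3 rV" and ?G = "regs s3 rG"
      have nc3: "disjoint_free K ?col X Y" "disjoint_free K ?col X ?V" "disjoint_free K ?col Y ?V"
        and sp3: "spoke X Y ?col ?V ?G" "?col ?G = regs s2 rB"
        and cl3: "closed_fan K ?col X Y ?V" and V0: "?V \<noteq> 0"
        using st True s2 eq3[of rX] eq3[of rY] ar3 unfolding stuck_def no_conflict_def fan_def by auto
      let ?s4 = "s3\<lparr>regs := (regs s3)(13 := ?V, 14 := ?G, 20 := X, 3 := Y, 4 := X, 20 := regs s2 rA,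
          5 := regs s2 rB, 6 := regs s2 rA)\<rparr>"
      have es4: "edge_state K ?s4"
        using es rep3 s2 unfolding edge_state_def by (simp add: eq3 ar3 insert_commute)
      have "wp (fan_search ;; com.If (And uncoloured (And (Equal (Var rV') (Const 0))
          (bexp.Not (Equal (Var rV) (Var rW))))) diamond Skip) ?s4 (8 * n + 8) R"
      proof (rule wp_Seq[where ?t1.0 = "7 * n + 7" and ?t2.0 = "Suc n"], rule wp_fan_search[OF es4])
        fix s' assume ex: "extended K ?s4 s'"
        have "extended K s s'"
          by (rule extended_regs[OF ex]) (use s2 n sK K_def in \<open>auto simp: eq3 ar3\<close>)
        moreover have "colouring s' (regs s' rE) \<noteq> 0"
          using extendedE_uncoloured[OF ex] s2 E e by (auto simp: eq3 ar3)
        ultimately show "wp (com.If (And uncoloured (And (Equal (Var rV') (Const 0)) (bexp.Not (Equal (Var rV) (Var rW)))))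
            diamond Skip) s' (Suc n) R"
          by (simp add: R_def)
      next
        fix s5 assume st5: "stuck K ?s4 s5"
        have eq5: "regs s5 x = regs ?s4 x" if "x \<notin> {7, 8, 9, 10, 11, 12}" for x
          using st5 that unfolding stuck_def by auto
        have ar5: "arrs s5 = arrs s2" using st5 ar3 unfolding stuck_def by auto
        have rep5: "represents s5" using rep2 represents_cong[OF ar5] by (simp add: eq5 eq3)
        have R5: "R (s5\<lparr>regs := r\<rparr>)" if "K \<le> \<Gamma>" "r 0 = n" "r rE = ?E" "r rK = K" "r rN = regs s rN" for r
          unfolding R_def using that rep5 ar5 s2 by (auto simp: eq5 eq3)
        have R5': "R s5" if "K \<le> \<Gamma>" using R5[OF that, of "regs s5"] s2 sK by (simp add: eq5 eq3)
        let ?V5 = "regs s5 rV"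
        have es5: "edge_state K s5"
          using es4 rep5 unfolding edge_state_def by (simp add: eq5 ar5 ar3)
        have nc5: "disjoint_free K ?col Y ?V5"
          and sp5: "spoke Y X ?col ?V5 (regs s5 rG)" "?col (regs s5 rG) = regs s2 rA"
          and cl5: "regs s5 rV' = 0 \<Longrightarrow> closed_fan K ?col Y X ?V5"
          using st5 s2 ar5 ar3 eq5[of rX] eq5[of rY] unfolding stuck_def no_conflict_def fan_def
          by auto
        consider "regs s5 rV' \<noteq> 0" | "regs s5 rV' = 0" "?V5 = ?V" | "regs s5 rV' = 0" "?V5 \<noteq> ?V" by blast
        then show "wp (com.If (And uncoloured (And (Equal (Var rV') (Const 0)) (bexp.Not (Equal (Var rV) (Var rW)))))
            diamond Skip) s5 (Suc n) R"
        proof cases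
          case 1
          then have "K \<le> \<Gamma>" using three[OF st5] pc s2 ar3 by auto
          then show ?thesis using R5' 1 by simp
        next
          case 2
          \<comment> \<open>The first edge of the fan at \<open>Y\<close> leads to \<open>V\<close>
            and closes the triangle \<open>X\<close>, \<open>Y\<close>, \<open>V\<close>.\<close>
          have "K \<le> \<Gamma>"
            using triangle_fan_bound[OF pc e E(1,3,2) _ _ cl3 nc3(1,2), of "regs s5 rG"] sp5 sp3 2
            unfolding spoke_def by auto
          then show ?thesis using R5' 2 by (simp add: eq5)
        next
          case 3
          have "wp diamond s5 (Suc n) R"
          proof (rule wp_diamond[OF es5])
            fix s' assume ex: "extended K s5 s'"
            have "extended K s s'"
              by (rule extended_regs[OF ex]) (use s2 n sK K_def in \<open>auto simp: eq5 eq3 ar5\<close>)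
            then show "R s'" by (simp add: R_def)
          next
            fix m assume "disjoint_free K (colouring s5) ?V5 (regs s5 rW)"
            then have "disjoint_free K ?col ?V ?V5"
              using s2 by (auto simp: disjoint_free_def eq5 ar5)
            then have "K \<le> \<Gamma>"
              using two_fans_bound[OF pc e E(1,3,2) sp3(1) sp5(1) cl3 cl5[OF 3(1)] nc3(2) nc5] by blast
            then show "R (set_reg rC m s5)" using R5[of "(regs s5)(rC := m)"] s2 sK by (simp add: eq5 eq3)
          qed (use 3 sp5 sp3 cl3 nc3 s2 in \<open>auto simp: eq5 eq3 ar5\<close>)
          then show ?thesis using 3 R5' s2 E(2) by (simp add: eq5 eq3 ar5)
        qed
      qed auto
      then show ?thesis using True s2 E(2) by (simp add: opposite_fan_def eq3 ar3 fun_upd_twist)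
    qed
  qed auto
  have noK: "K \<le> \<Gamma>" if "v \<in> {X, Y}" "\<And>c. 0 < c \<Longrightarrow> c < K \<Longrightarrow> \<not> free ?col v c" for v
    using free_exists[OF pc e _ E(2), of v] that E(1) by (metis not_le)
  have afterB: "wp (com.If (And (Less (Var rA) (Var rK)) (Less (Var rB) (Var rK))) both_fans Skip ;; new_colour) s2 (15 * n + 15) Q"
    if s2: "represents s2" "colouring s2 = ?col" "regs s2 0 = n" "regs s2 rE = ?E" "regs s2 rX = X" "regs s2 rY = Y"
      "regs s2 rN = regs s rN" "regs s2 rK = K"
      and A: "0 < regs s2 rA \<and> regs s2 rA < K \<and> free ?col X (regs s2 rA) \<or> K \<le> regs s2 rA \<and> K \<le> \<Gamma>"
      and B: "0 < regs s2 rB \<and> regs s2 rB < K \<and> free ?col Y (regs s2 rB) \<or> K \<le> regs s2 rB \<and> K \<le> \<Gamma>" for s2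
  proof (cases "regs s2 rA < K \<and> regs s2 rB < K")
    case True
    have es2: "edge_state K s2"
      using s2 pc Kn e E True A B unfolding edge_state_def by auto
    have "wp (both_fans ;; new_colour) s2 (15 * n + 15) Q"
      by (rule wp_SeqI[OF body[OF es2 s2(2-7)] last[where u = 0]]) simp_all
    moreover have "bval (And (Less (Var rA) (Var rK)) (Less (Var rB) (Var rK))) s2 = True"
      using True s2 by simp
    ultimately show ?thesis by (simp only: wp_Seq_If if_True)
  next
    case False
    then have "R s2" using A B s2 unfolding R_def by auto
    then have "wp new_colour s2 (15 * n + 15) Q" by (rule last)
    moreover have "bval (And (Less (Var rA) (Var rK)) (Less (Var rB) (Var rK))) s2 = False"
      using False s2 by simp
    ultimately show ?thesis by (simp only: wp_Seq_If wp_Seq_Skip if_False)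
  qed
  have afterA: "wp (search rB 1 rK (is_free rY rB) ;;
      com.If (And (Less (Var rA) (Var rK)) (Less (Var rB) (Var rK))) both_fans Skip ;; new_colour) s2 (16 * n + 16) Q"
    if s2: "represents s2" "colouring s2 = ?col" "regs s2 0 = n" "regs s2 rE = ?E" "regs s2 rX = X" "regs s2 rY = Y"
      "regs s2 rN = regs s rN" "regs s2 rK = K"
      and A: "0 < regs s2 rA \<and> regs s2 rA < K \<and> free ?col X (regs s2 rA) \<or> K \<le> regs s2 rA \<and> K \<le> \<Gamma>" for s2
  proof (rule wp_Seq[where ?t1.0 = "Suc n" and ?t2.0 = "15 * n + 15"], rule wp_search, goal_cases)
    case (3 m)
    then have "free ?col Y m" using represents_free[OF s2(1), of m Y] s2 Kn by auto
    then show ?case using 3 s2 A by (intro afterB) auto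
  next
    case (4 m)
    have "\<not> free ?col Y c" if "0 < c" "c < K" for c
      using 4(2)[of c] represents_free[OF s2(1), of c Y] s2 Kn XY that by auto
    then have "K \<le> \<Gamma>" using noK[of Y] by blast
    then show ?case using 4(1) s2 A by (intro afterB) auto
  qed (use s2 Kn in auto)
  let ?s1 = "s\<lparr>regs := (regs s)(3 := X, 4 := Y)\<rparr>"
  have "wp (search rA 1 rK (is_free rX rA) ;; search rB 1 rK (is_free rY rB) ;;
      com.If (And (Less (Var rA) (Var rK)) (Less (Var rB) (Var rK))) both_fans Skip ;; new_colour) ?s1 t Q"
  proof (rule wp_Seq[where ?t1.0 = "Suc n" and ?t2.0 = "16 * n + 16"], rule wp_search, goal_cases)
    case (3 m)
    then have "free ?col X m" using represents_free[OF rep, of m X] Kn by (auto simp: K_def)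
    then show ?case using 3 rep n by (intro afterA) (auto simp: K_def)
  next
    case (4 m)
    have "\<not> free ?col X c" if "0 < c" "c < K" for c
      using 4(2)[of c] represents_free[OF rep, of c X] Kn XY that by (auto simp: K_def)
    then have "K \<le> \<Gamma>" using noK[of X] by blast
    then show ?case using 4(1) rep n by (intro afterA) (auto simp: K_def)
  qed (use t Kn in \<open>auto simp: K_def\<close>)
  then show ?thesis unfolding insert_edge_def by (simp add: X_def Y_def)
qed

end

section \<open>Twin classes by a trie\<close>

definition colour_edges :: com where
  "colour_edges = Assign rN (Plus (Var 0) (Const 1)) ;; Assign rK (Const 1) ;;
     For tZ 0 (Store 4 (Plus (Var tZ) (Const 1)) (Const 1)) ;; For rE 0 insert_edge"

lemma (in gamma_ends) wp_colour_edges: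
  assumes n: "regs s 0 = n" and ends: "\<And>e. e < n \<Longrightarrow> En e = {arrs s 2 e, arrs s 3 e}"
    and z: "\<And>i. arrs s 1 i = 0" "\<And>i. arrs s 4 i = 0" and t: "n + n * (17 * n + 18) \<le> t"
    and Q: "\<And>s'. coloured_upto n s' \<Longrightarrow> Q s'"
  shows "wp colour_edges s t Q"
proof -
  let ?s = "s\<lparr>regs := (regs s)(15 := Suc n, 16 := 1)\<rparr>"
  have "wp (For tZ 0 (Store 4 (Plus (Var tZ) (Const 1)) (Const 1)) ;; For rE 0 insert_edge) ?s t Q"
  proof (rule wp_Seq[where ?t1.0 = n and ?t2.0 = "n * (17 * n + 18)"],
      rule wp_For[where I = "\<lambda>k s'. (\<forall>i. arrs s' 4 i = (if 0 < i \<and> i \<le> k then 1 else 0)) \<and>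
        (\<forall>a. a \<noteq> 4 \<longrightarrow> arrs s' a = arrs s a) \<and> regs s' 0 = n \<and> regs s' 15 = Suc n \<and> regs s' 16 = 1"
        and u = 0 and N = n], goal_cases)
    case (4 k s')
    then show ?case by (auto simp: le_Suc_eq)
  next
    case (5 s')
    then have eq: "\<And>i. arrs s' 4 i = (if 0 < i \<and> i \<le> n then 1 else 0)" "\<And>a. a \<noteq> 4 \<Longrightarrow> arrs s' a = arrs s a"
      "regs s' 0 = n" "regs s' 15 = Suc n" "regs s' 16 = 1" by auto
    have rep: "represents s'"
      unfolding represents_def
    proof (intro conjI allI impI)
      fix v c e :: nat assume "0 < v" "0 < c" "c \<le> n"
      \<comment> \<open>The rows of real vertices lie beyond cell \<open>n\<close>, where the table
        still holds zeros.\<close>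
      then have "n < v * regs s' rN + c" unfolding eq(4) by (cases v) auto
      then show "arrs s' 4 (v * regs s' rN + c) = Suc e \<longleftrightarrow> e < n \<and> v \<in> En e \<and> colouring s' e = c"
        using eq(1,2) z(1) \<open>0 < c\<close> by auto
    qed (use eq ends in auto)
    then have "coloured_upto 0 s'"
      unfolding coloured_upto_def pcol_def using eq z(1) by auto
    then show ?case
    proof (intro wp_For[where I = "\<lambda>k s'. coloured_upto k s'" and u = "17 * n + 17" and N = n], goal_cases)
      case (4 k s')
      then show ?case
        by (intro wp_insert_edge) (auto simp: coloured_upto_def)
    qed (use eq Q in \<open>auto simp: coloured_upto_def\<close>)
  qed (use n z t in auto)
  then show ?thesis unfolding colour_edges_def using n by simp
qed

section \<open>Binary tries\<close>

fun walk :: "(nat \<Rightarrow> nat) \<Rightarrow> (nat \<Rightarrow> nat) \<Rightarrow> nat \<Rightarrow> nat" where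
  "walk ch b 0 = 1"
| "walk ch b (Suc m) = ch (walk ch b m + walk ch b m + b m)"

text \<open>Injectivity on non-zero cells says that a node hangs in one cell only; the bound makes
  \<open>Suc N\<close> a fresh name.\<close>

definition trie :: "(nat \<Rightarrow> nat) \<Rightarrow> nat \<Rightarrow> bool" where
  "trie ch N \<longleftrightarrow> (\<forall>i j. ch i = ch j \<longrightarrow> ch i \<noteq> 0 \<longrightarrow> i = j) \<and> (\<forall>i. ch i \<le> N)"

definition stored :: "(nat \<Rightarrow> nat) \<Rightarrow> (nat \<Rightarrow> nat) \<Rightarrow> nat \<Rightarrow> bool" where
  "stored ch b m \<longleftrightarrow> (\<forall>j\<le>m. walk ch b j \<noteq> 0)"

lemma trie_insert: "trie ch N \<Longrightarrow> ch i = 0 \<Longrightarrow> trie (ch(i := Suc N)) (Suc N)"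
  unfolding trie_def
proof (intro conjI allI impI)
  fix a b assume t: "(\<forall>i j. ch i = ch j \<longrightarrow> ch i \<noteq> 0 \<longrightarrow> i = j) \<and> (\<forall>i. ch i \<le> N)"
    and eq: "(ch(i := Suc N)) a = (ch(i := Suc N)) b" "(ch(i := Suc N)) a \<noteq> 0"
  have N: "ch j \<noteq> Suc N" for j using t Suc_n_not_le_n by metis
  show "a = b"
  proof (cases "a = i \<or> b = i")
    case True
    then show ?thesis using eq N[of a] N[of b] by (auto split: if_splits)
  next
    case False
    then have "ch a = ch b" "ch a \<noteq> 0" using eq by auto
    then show ?thesis using t by blast
  qed
qed (auto simp: le_Suc_eq)

lemma stored_extend:
  assumes "stored ch b m" "\<And>i. ch i \<noteq> 0 \<Longrightarrow> ch' i = ch i"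
  shows "j \<le> m \<Longrightarrow> walk ch' b j = walk ch b j" "stored ch' b m"
proof -
  have *: "j \<le> m \<Longrightarrow> walk ch' b j = walk ch b j" for j
  proof (induction j)
    case (Suc j)
    have "walk ch b (Suc j) \<noteq> 0" using assms(1) Suc.prems unfolding stored_def by blast
    then show ?case using Suc assms(2) by simp
  qed simp
  show "j \<le> m \<Longrightarrow> walk ch' b j = walk ch b j" by (rule *)
  show "stored ch' b m" using assms(1) * unfolding stored_def by simp
qed

text \<open>A node determines the cell it hangs in, whose parity is the last bit and whose half is
  the preceding node, so a path can be read backwards from its end. It is enough that one of the two
  paths is stored, as equal end nodes are then both non-zero.\<close>

lemma walk_eq_iff:
  assumes "trie ch N" "stored ch b m" "\<And>j. b j \<le> 1" "\<And>j. c j \<le> 1"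
  shows "walk ch b m = walk ch c m \<longleftrightarrow> (\<forall>j<m. b j = c j)"
  using assms(2)
proof (induction m)
  case (Suc m)
  have st: "stored ch b m" "walk ch b (Suc m) \<noteq> 0" using Suc.prems unfolding stored_def by auto
  have "walk ch b (Suc m) = walk ch c (Suc m) \<longleftrightarrow> walk ch b m + walk ch b m + b m = walk ch c m + walk ch c m + c m"
    using assms(1) st(2) unfolding trie_def by auto
  also have "\<dots> \<longleftrightarrow> walk ch b m = walk ch c m \<and> b m = c m"
    using assms(3)[of m] assms(4)[of m] by presburger
  finally show ?case using Suc.IH[OF st(1)] by (auto simp: less_Suc_eq)
qed simp

abbreviation adjacency :: "nat \<Rightarrow> nat \<Rightarrow> aexp" where
  "adjacency x y \<equiv> Read 0 (Plus (Times (Var x) (Var 0)) (Var y))"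

text \<open>The closed neighbourhoods are inserted into a binary trie; cell \<open>2 w + b\<close> of array 6 is the child \<open>b\<close>
  of the node \<open>w\<close>, and array 7 holds \<open>e + 1\<close> at the leaf first reached by \<open>e\<close>.\<close>

definition twin_phase :: com where
  "twin_phase = Assign 17 (Const 1) ;; For 2 0
     (Assign 21 (Const 1) ;;
      For 20 0
       (com.If (And (Equal (adjacency 2 20) (Const 0)) (bexp.Not (Equal (Var 2) (Var 20))))
          (Assign 22 (Const 0)) (Assign 22 (Const 1)) ;;
        com.If (Equal (Read 6 (Plus (Plus (Var 21) (Var 21)) (Var 22))) (Const 0))
          (Assign 17 (Plus (Var 17) (Const 1)) ;; Store 6 (Plus (Plus (Var 21) (Var 21)) (Var 22)) (Var 17)) Skip ;;
        Assign 21 (Read 6 (Plus (Plus (Var 21) (Var 21)) (Var 22)))) ;;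
      com.If (Equal (Read 7 (Var 21)) (Const 0)) (Store 7 (Var 21) (Plus (Var 2) (Const 1))) Skip ;;
      Store 5 (Var 2) (Minus (Read 7 (Var 21)) (Const 1)))"

definition adjacency_state :: "nat \<Rightarrow> (nat \<Rightarrow> nat \<Rightarrow> bool) \<Rightarrow> state \<Rightarrow> bool" where
  "adjacency_state n ad s \<longleftrightarrow> regs s 0 = n \<and> (\<forall>e<n. \<forall>x<n. arrs s 0 (e * n + x) = of_bool (ad e x))"

abbreviation adj_bit :: "(nat \<Rightarrow> nat \<Rightarrow> bool) \<Rightarrow> nat \<Rightarrow> nat \<Rightarrow> nat" where
  "adj_bit ad e x \<equiv> of_bool (cadj ad e x)"

definition reps_upto :: "nat \<Rightarrow> (nat \<Rightarrow> nat \<Rightarrow> bool) \<Rightarrow> nat \<Rightarrow> state \<Rightarrow> bool" where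
  "reps_upto n ad e s \<longleftrightarrow> trie (arrs s 6) (regs s 17) \<and>
     (\<forall>f<e. stored (arrs s 6) (adj_bit ad f) n \<and> arrs s 7 (walk (arrs s 6) (adj_bit ad f) n) = Suc (arrs s 5 f)) \<and>
     (\<forall>m. arrs s 7 m \<noteq> 0 \<longrightarrow> (\<exists>f<e. arrs s 7 m = Suc f \<and> walk (arrs s 6) (adj_bit ad f) n = m \<and> arrs s 5 f = f))"

lemma reps_upto_twin_rep:
  assumes "reps_upto n ad n s" shows "twin_rep n ad (arrs s 5)"
proof -
  let ?w = "\<lambda>f. walk (arrs s 6) (adj_bit ad f) n"
  have st: "stored (arrs s 6) (adj_bit ad f) n" "arrs s 7 (?w f) = Suc (arrs s 5 f)" if "f < n" for f
    using assms that unfolding reps_upto_def by auto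
  have lf: "arrs s 5 f < n \<and> ?w (arrs s 5 f) = ?w f \<and> arrs s 5 (arrs s 5 f) = arrs s 5 f" if "f < n" for f
    using assms st(2)[OF that] unfolding reps_upto_def by (metis Suc_inject nat.distinct(1))
  have "arrs s 5 e = arrs s 5 f \<longleftrightarrow> twins n ad e f" if "e < n" "f < n" for e f
  proof -
    have "arrs s 5 e = arrs s 5 f \<longleftrightarrow> ?w e = ?w f"
      using lf[OF that(1)] lf[OF that(2)] st(2)[OF that(1)] st(2)[OF that(2)] by (metis Suc_inject)
    also have "\<dots> \<longleftrightarrow> (\<forall>x<n. adj_bit ad e x = adj_bit ad f x)"
      using assms st(1)[OF that(1)] unfolding reps_upto_def by (intro walk_eq_iff) auto
    finally show ?thesis unfolding twins_def by auto
  qed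
  then show ?thesis unfolding twin_rep_def using lf by blast
qed

lemma wp_twin_phase:
  assumes ad: "adjacency_state n ad s" and z: "\<And>a i. a \<noteq> 0 \<Longrightarrow> arrs s a i = 0"
    and t: "n * (1 + n) \<le> t"
    and Q: "\<And>s'. adjacency_state n ad s' \<Longrightarrow> twin_rep n ad (arrs s' 5) \<Longrightarrow>
      (\<And>a. a \<notin> {5, 6, 7} \<Longrightarrow> arrs s' a = arrs s a) \<Longrightarrow> Q s'"
  shows "wp twin_phase s t Q"
proof -
  define I where "I e s' \<longleftrightarrow> reps_upto n ad e s' \<and> regs s' 0 = n \<and> (\<forall>a. a \<notin> {5, 6, 7} \<longrightarrow> arrs s' a = arrs s a)" for e and s' :: state
  have A: "arrs s 0 (e * n + x) = of_bool (ad e x)" if "e < n" "x < n" for e x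
    using ad that unfolding adjacency_state_def by auto
  have "wp twin_phase s (n * (1 + n)) Q"
    unfolding twin_phase_def wp_Seq_Assign
  proof (rule wp_For[where I = I and N = n and u = n], goal_cases)
    case 1
    then show ?case using ad z by (auto simp: I_def reps_upto_def trie_def adjacency_state_def)
  next
    case (4 e s1)
    let ?ch = "arrs s1 6"
    have I1: "reps_upto n ad e s1" "regs s1 0 = n" "\<And>a. a \<notin> {5, 6, 7} \<Longrightarrow> arrs s1 a = arrs s a"
      using 4 unfolding I_def by auto
    have e: "regs s1 2 = e" "e < n" using 4 by auto
    define J where "J x s' \<longleftrightarrow> trie (arrs s' 6) (regs s' 17) \<and>
       (\<forall>i. ?ch i \<noteq> 0 \<longrightarrow> arrs s' 6 i = ?ch i) \<and>
       stored (arrs s' 6) (adj_bit ad e) x \<and> regs s' 21 = walk (arrs s' 6) (adj_bit ad e) x \<and>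
       regs s' 0 = n \<and> regs s' 2 = e \<and> (\<forall>a. a \<noteq> 6 \<longrightarrow> arrs s' a = arrs s1 a)" for x and s' :: state
    show ?case
      unfolding wp_Seq_Assign
    proof (rule wp_Seq[where ?t1.0 = n and ?t2.0 = 0], rule wp_For[where I = J and N = n and u = 0], goal_cases)
      case 1
      then show ?case using I1 e by (auto simp: J_def reps_upto_def stored_def)
    next
      case (4 x s')
      let ?i = "regs s' 21 + regs s' 21 + adj_bit ad e x" and ?ch' = "arrs s' 6"
      have J: "trie ?ch' (regs s' 17)" "\<And>i. ?ch i \<noteq> 0 \<Longrightarrow> ?ch' i = ?ch i"
        "stored ?ch' (adj_bit ad e) x" "regs s' 21 = walk ?ch' (adj_bit ad e) x" "regs s' 0 = n" "regs s' 2 = e"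
        "\<And>a. a \<noteq> 6 \<Longrightarrow> arrs s' a = arrs s1 a"
        using 4(1) unfolding J_def by auto
      \<comment> \<open>The bit on the diagonal is always 1, whatever the matrix contains there,
        because closed neighbourhoods are inserted.\<close>
      have bit: "arrs s' 0 (e * n + x) = 0 \<and> e \<noteq> x \<longleftrightarrow> \<not> cadj ad e x"
        using A[OF e(2) 4(4)] J(7) I1(3) unfolding cadj_def by auto
      have stS: "stored ch (adj_bit ad e) (Suc x) \<and> walk ch (adj_bit ad e) (Suc x) = ch ?i"
        if "\<And>i. ?ch' i \<noteq> 0 \<Longrightarrow> ch i = ?ch' i" "ch ?i \<noteq> 0" for ch
      proof -
        have "walk ch (adj_bit ad e) x = regs s' 21" "stored ch (adj_bit ad e) x"
          using stored_extend[OF J(3), of ch, OF that(1)] J(4) by auto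
        then show ?thesis using that(2) unfolding stored_def by (auto simp: le_Suc_eq)
      qed
      have step: "J (Suc x) s''" if "arrs s'' 6 = ch" "trie ch (regs s'' 17)" "\<And>i. ?ch' i \<noteq> 0 \<Longrightarrow> ch i = ?ch' i"
        "ch ?i \<noteq> 0" "regs s'' 21 = ch ?i" "regs s'' 0 = n" "regs s'' 2 = e" "\<And>a. a \<noteq> 6 \<Longrightarrow> arrs s'' a = arrs s1 a" for ch s''
        unfolding J_def using that stS[OF that(3,4)] J(2) by auto
      have new: "?ch' ?i = 0 \<Longrightarrow> trie (?ch'(?i := Suc (regs s' 17))) (Suc (regs s' 17))"
        by (rule trie_insert[OF J(1)])
      have "bval (And (Equal (adjacency 2 20) (Const 0)) (bexp.Not (Equal (Var 2) (Var 20)))) s' \<longleftrightarrow> \<not> cadj ad e x"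
        using bit 4(2) J(5,6) by simp
      then have first: "wp (com.If (And (Equal (adjacency 2 20) (Const 0)) (bexp.Not (Equal (Var 2) (Var 20))))
          (Assign 22 (Const 0)) (Assign 22 (Const 1)) ;; d) s' u R \<longleftrightarrow> wp d (set_reg 22 (adj_bit ad e x) s') u R" for d u R
        by (simp only: wp_Seq_If) simp
      show ?case
      proof (cases "?ch' ?i = 0")
        case True
        show ?thesis unfolding first using 4(2) J(5,6) True
          apply (simp split del: split_of_bool)
          apply (rule step[where ch = "?ch'(?i := Suc (regs s' 17))"])
          using new[OF True] True J by auto
      next
        case False
        show ?thesis unfolding first using 4(2) J(5,6) False
          apply (simp split del: split_of_bool)
          apply (rule step[where ch = ?ch'])
          using False J by auto
      qed
    next
      case (5 s')
      let ?w = "regs s' 21" and ?ch' = "arrs s' 6" and ?rep = "arrs s1 5" and ?leaf = "arrs s1 7"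
      have J: "trie ?ch' (regs s' 17)" "\<And>i. ?ch i \<noteq> 0 \<Longrightarrow> ?ch' i = ?ch i"
        "stored ?ch' (adj_bit ad e) n" "?w = walk ?ch' (adj_bit ad e) n" "regs s' 0 = n" "regs s' 2 = e"
        "\<And>a. a \<noteq> 6 \<Longrightarrow> arrs s' a = arrs s1 a"
        using 5(1) unfolding J_def by auto
      have old: "stored ?ch' (adj_bit ad f) n" "walk ?ch' (adj_bit ad f) n = walk ?ch (adj_bit ad f) n"
        "?leaf (walk ?ch' (adj_bit ad f) n) = Suc (?rep f)" if "f < e" for f
      proof -
        have st: "stored ?ch (adj_bit ad f) n" using I1(1) that unfolding reps_upto_def by auto
        show "stored ?ch' (adj_bit ad f) n" "walk ?ch' (adj_bit ad f) n = walk ?ch (adj_bit ad f) n"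
          using stored_extend[OF st J(2)] by auto
        then show "?leaf (walk ?ch' (adj_bit ad f) n) = Suc (?rep f)"
          using I1(1) that unfolding reps_upto_def by auto
      qed
      have leaf: "\<exists>f<e. ?leaf m = Suc f \<and> walk ?ch' (adj_bit ad f) n = m \<and> ?rep f = f" if "?leaf m \<noteq> 0" for m
        using I1(1) that old(2) unfolding reps_upto_def by metis
      have fin: "I (Suc e) s''" if "arrs s'' 6 = ?ch'" "regs s'' 17 = regs s' 17" "regs s'' 0 = n"
        "arrs s'' 7 = (if ?leaf ?w = 0 then ?leaf(?w := Suc e) else ?leaf)"
        "arrs s'' 5 = ?rep(e := (if ?leaf ?w = 0 then e else ?leaf ?w - 1))"
        "\<And>a. a \<notin> {5, 6, 7} \<Longrightarrow> arrs s'' a = arrs s a" for s''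
      proof -
        have r: "arrs s'' 5 f = ?rep f" if "f < e" for f
          using \<open>arrs s'' 5 = _\<close> that by simp
        have "(\<forall>f<Suc e. stored ?ch' (adj_bit ad f) n \<and> arrs s'' 7 (walk ?ch' (adj_bit ad f) n) = Suc (arrs s'' 5 f)) \<and>
          (\<forall>m. arrs s'' 7 m \<noteq> 0 \<longrightarrow>
            (\<exists>f<Suc e. arrs s'' 7 m = Suc f \<and> walk ?ch' (adj_bit ad f) n = m \<and> arrs s'' 5 f = f))"
        proof (cases "?leaf ?w = 0")
          case True
          then have l: "arrs s'' 7 = ?leaf(?w := Suc e)" "arrs s'' 5 e = e" using that(4,5) by simp_all
          have "arrs s'' 7 (walk ?ch' (adj_bit ad f) n) = Suc (?rep f)" if "f < e" for f
            using old(3)[OF that] True l(1) by (cases "walk ?ch' (adj_bit ad f) n = ?w") auto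
          then have "\<forall>f<Suc e. stored ?ch' (adj_bit ad f) n \<and> arrs s'' 7 (walk ?ch' (adj_bit ad f) n) = Suc (arrs s'' 5 f)"
            using old(1) r J(3,4) l by (simp add: less_Suc_eq)
          moreover have "\<exists>f<Suc e. arrs s'' 7 m = Suc f \<and> walk ?ch' (adj_bit ad f) n = m \<and> arrs s'' 5 f = f"
            if "arrs s'' 7 m \<noteq> 0" for m
          proof (cases "m = ?w")
            case True
            then show ?thesis using l J(4) by (intro exI[of _ e]) simp
          next
            case False
            then have "?leaf m \<noteq> 0" "arrs s'' 7 m = ?leaf m" using that l(1) by auto
            then show ?thesis using leaf[of m] r less_SucI by metis
          qed
          ultimately show ?thesis by blast
        next
          case False
          then have l: "arrs s'' 7 = ?leaf" "Suc (arrs s'' 5 e) = ?leaf ?w" using that(4,5) by simp_all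
          have "\<forall>f<Suc e. stored ?ch' (adj_bit ad f) n \<and> arrs s'' 7 (walk ?ch' (adj_bit ad f) n) = Suc (arrs s'' 5 f)"
            using old(1,3) r J(3,4) l by (simp add: less_Suc_eq)
          moreover have "\<exists>f<Suc e. arrs s'' 7 m = Suc f \<and> walk ?ch' (adj_bit ad f) n = m \<and> arrs s'' 5 f = f"
            if "arrs s'' 7 m \<noteq> 0" for m
            using leaf[of m] that l(1) r less_SucI by metis
          ultimately show ?thesis by blast
        qed
        then have "reps_upto n ad (Suc e) s''"
          unfolding reps_upto_def using that(1,2) J(1) by simp
        then show ?thesis using that(3,6) unfolding I_def by auto
      qed
      show ?case
      proof (cases "?leaf ?w = 0")
        case True
        show ?thesis using J(5,6) True J(7)[of 7]
          apply simp
          apply (rule fin)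
          using J(5-7) I1(3) True by auto
      next
        case False
        show ?thesis using J(5,6) False J(7)[of 7]
          apply simp
          apply (rule fin)
          using J(5-7) I1(3) False by auto
      qed
    qed (use I1 in auto)
  next
    case (5 s')
    then show ?case using ad unfolding I_def
      by (intro Q) (auto simp: adjacency_state_def reps_upto_twin_rep)
  qed (use ad in \<open>auto simp: adjacency_state_def\<close>)
  then show ?thesis using t by (rule wp_mono)
qed

section \<open>Labelling the stars\<close>

abbreviation is_rep :: "nat \<Rightarrow> bexp" where
  "is_rep g \<equiv> Equal (Read 5 (Var g)) (Var g)"

abbreviation adjb :: "nat \<Rightarrow> nat \<Rightarrow> bexp" where
  "adjb x y \<equiv> bexp.Not (Equal (adjacency x y) (Const 0))"

abbreviation cadjb :: "nat \<Rightarrow> nat \<Rightarrow> bexp" where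
  "cadjb x y \<equiv> bexp.Not (And (bexp.Not (Equal (Var x) (Var y))) (Equal (adjacency x y) (Const 0)))"

definition label_star :: "bexp \<Rightarrow> com" where
  "label_star b = For 7 0 (com.If (And (is_rep 7) b)
     (com.If (Equal (Read 2 (Var 7)) (Const 0)) (Store 2 (Var 7) (Var 16)) (Store 3 (Var 7) (Var 16))) Skip)"

text \<open>Register 3 holds a neighbour \<open>P\<close> of \<open>F\<close> (or \<open>F\<close> itself if there is none), register 4 a common neighbour
  \<open>Q\<close> (or \<open>n\<close>), and register 5 a witness that the triangle is odd (or \<open>n\<close>).\<close>

definition first_star :: com where
  "first_star = Assign 16 (Plus (Var 16) (Const 1)) ;;
     search 3 0 0 (And (is_rep 3) (adjb 2 3)) ;;
     com.If (Less (Var 3) (Var 0)) Skip (Assign 3 (Var 2)) ;;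
     search 4 0 0 (And (is_rep 4) (And (adjb 2 4) (adjb 3 4))) ;;
     search 5 0 0 (And (Less (Var 4) (Var 0)) (And (is_rep 5)
       (bexp.Not (And (bexp.Not (Equal (Plus (Plus (adjacency 2 5) (adjacency 3 5)) (adjacency 4 5)) (Const 1)))
          (bexp.Not (Equal (Plus (Plus (adjacency 2 5) (adjacency 3 5)) (adjacency 4 5)) (Const 3))))))) ;;
     com.If (Less (Var 5) (Var 0)) (label_star (And (cadjb 2 7) (And (cadjb 3 7) (cadjb 4 7))))
       (label_star (And (cadjb 2 7) (And (cadjb 3 7) (bexp.Not (Equal (Var 7) (Var 4))))))"

definition next_star :: com where
  "next_star = Assign 16 (Plus (Var 16) (Const 1)) ;; Assign 6 (Read 2 (Var 2)) ;;
     label_star (bexp.Not (And (bexp.Not (Equal (Var 7) (Var 2)))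
       (bexp.Not (And (adjb 2 7) (And (bexp.Not (Equal (Read 2 (Var 7)) (Var 6)))
          (bexp.Not (Equal (Read 3 (Var 7)) (Var 6))))))))"

text \<open>Half-named edges are completed before a fresh one is taken up. So when
  \<open>first_star\<close> runs, every representative has two labels or none, as the hypothesis
  \<open>full\<close> of \<open>partial_root_start\<close> demands.\<close>

definition root_step :: com where
  "root_step = search 2 0 0 (And (is_rep 2) (And (bexp.Not (Equal (Read 2 (Var 2)) (Const 0))) (Equal (Read 3 (Var 2)) (Const 0)))) ;;
     com.If (Less (Var 2) (Var 0)) next_star
      (search 2 0 0 (And (is_rep 2) (Equal (Read 2 (Var 2)) (Const 0))) ;;
       com.If (Less (Var 2) (Var 0)) first_star (Assign 8 (Const 0)))"

definition root_phase :: com where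
  "root_phase = Assign 8 (Const 1) ;; Assign 16 (Const 0) ;; While (bexp.Not (Equal (Var 8) (Const 0))) root_step"

definition copy_phase :: com where
  "copy_phase = For 7 0 (Store 2 (Var 7) (Read 2 (Read 5 (Var 7))) ;; Store 3 (Var 7) (Read 3 (Read 5 (Var 7))))"

text \<open>The condition may read labels while the loop is writing them. It sees only those of the
  current edge, which the loop has not touched yet, so its truth is that of the starting
  state.\<close>

lemma wp_label_star:
  fixes s :: state and C :: "nat \<Rightarrow> bool"
  defines "S \<equiv> {g. g < regs s 0 \<and> arrs s 5 g = g \<and> C g}"
  assumes L: "regs s 16 \<noteq> 0"
    and cond: "\<And>s' g. g < regs s 0 \<Longrightarrow> regs s' = (regs s)(7 := g) \<Longrightarrow> arrs s' 0 = arrs s 0 \<Longrightarrow>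
      arrs s' 2 g = arrs s 2 g \<Longrightarrow> arrs s' 3 g = arrs s 3 g \<Longrightarrow> bval b s' \<longleftrightarrow> C g"
    and t: "regs s 0 \<le> t"
    and Q: "\<And>s'. arrs s' 2 = label_first S (regs s 16) (arrs s 2) \<Longrightarrow>
      arrs s' 3 = label_second S (regs s 16) (arrs s 2) (arrs s 3) \<Longrightarrow>
      (\<And>a. a \<noteq> 2 \<Longrightarrow> a \<noteq> 3 \<Longrightarrow> arrs s' a = arrs s a) \<Longrightarrow> (\<And>x. x \<noteq> 7 \<Longrightarrow> regs s' x = regs s x) \<Longrightarrow> Q s'"
  shows "wp (label_star b) s t Q"
  unfolding label_star_def
proof (rule wp_For[where I = "\<lambda>k s'. regs s' = (regs s)(7 := k) \<and>
      arrs s' 2 = label_first (S \<inter> {..<k}) (regs s 16) (arrs s 2) \<and>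
      arrs s' 3 = label_second (S \<inter> {..<k}) (regs s 16) (arrs s 2) (arrs s 3) \<and>
      (\<forall>a. a \<noteq> 2 \<longrightarrow> a \<noteq> 3 \<longrightarrow> arrs s' a = arrs s a)" and N = "regs s 0" and u = 0], goal_cases)
  case 1
  then show ?case by (auto simp: label_first_def label_second_def)
next
  case (4 k s')
  then have k: "k < regs s 0" and eq: "regs s' = (regs s)(7 := k)"
      "arrs s' 2 = label_first (S \<inter> {..<k}) (regs s 16) (arrs s 2)"
      "arrs s' 3 = label_second (S \<inter> {..<k}) (regs s 16) (arrs s 2) (arrs s 3)"
      "\<And>a. a \<noteq> 2 \<Longrightarrow> a \<noteq> 3 \<Longrightarrow> arrs s' a = arrs s a" by auto
  have k23: "arrs s' 2 k = arrs s 2 k" "arrs s' 3 k = arrs s 3 k"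
    using eq(2,3) by (auto simp: label_first_def label_second_def)
  have "bval b s' \<longleftrightarrow> C k" by (rule cond[OF k eq(1) _ k23]) (simp add: eq(4))
  then have b: "bval (And (is_rep 7) b) s' \<longleftrightarrow> k \<in> S" using k eq by (auto simp: S_def)
  show ?case
  proof (cases "k \<in> S")
    case True
    then have f: "S \<inter> {..<Suc k} = insert k (S \<inter> {..<k})" by (auto simp: less_Suc_eq)
    show ?thesis
    proof (cases "arrs s 2 k = 0")
      case z: True
      have "label_first (insert k (S \<inter> {..<k})) (regs s 16) (arrs s 2) =
          (label_first (S \<inter> {..<k}) (regs s 16) (arrs s 2))(k := regs s 16)"
        "label_second (insert k (S \<inter> {..<k})) (regs s 16) (arrs s 2) (arrs s 3) =
          label_second (S \<inter> {..<k}) (regs s 16) (arrs s 2) (arrs s 3)"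
        using z by (auto simp: label_first_def label_second_def fun_eq_iff)
      then show ?thesis using b True z k23 eq f k by (simp add: fun_upd_idem_iff)
    next
      case z: False
      have "label_first (insert k (S \<inter> {..<k})) (regs s 16) (arrs s 2) =
          label_first (S \<inter> {..<k}) (regs s 16) (arrs s 2)"
        "label_second (insert k (S \<inter> {..<k})) (regs s 16) (arrs s 2) (arrs s 3) =
          (label_second (S \<inter> {..<k}) (regs s 16) (arrs s 2) (arrs s 3))(k := regs s 16)"
        using z by (auto simp: label_first_def label_second_def fun_eq_iff)
      then show ?thesis using b True z k23 eq f k by (simp add: fun_upd_idem_iff)
    qed
  next
    case False
    then have "S \<inter> {..<Suc k} = S \<inter> {..<k}" by (auto simp: less_Suc_eq)
    moreover have "bval (And (is_rep 7) b) s' = False" using b False by simp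
    ultimately show ?thesis using eq k by (simp only: wp_If if_False wp_Skip) simp
  qed
next
  case (5 s')
  moreover have "S \<inter> {..<regs s 0} = S" by (auto simp: S_def)
  ultimately show ?case by (intro Q) auto
qed (use t in auto)

definition root_inv :: "nat \<Rightarrow> (nat \<Rightarrow> nat \<Rightarrow> bool) \<Rightarrow> state \<Rightarrow> bool" where
  "root_inv n ad s \<longleftrightarrow> adjacency_state n ad s \<and>
     partial_root {g. g < n \<and> arrs s 5 g = g} ad (regs s 16) (arrs s 2) (arrs s 3)"

text \<open>Empty label slots. Each star fills at least one, the slot of its edge \<open>F\<close>,
  so this serves as the variant of the main loop.\<close>

definition open_ends :: "nat \<Rightarrow> state \<Rightarrow> nat" where
  "open_ends n s = card {g. g < n \<and> arrs s 2 g = 0} + card {g. g < n \<and> arrs s 3 g = 0}"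

lemma open_ends_label:
  assumes "F < n" "F \<in> S" "l \<noteq> 0" "arrs s 2 F = 0 \<or> arrs s 3 F = 0"
    and s': "arrs s' 2 = label_first S l (arrs s 2)" "arrs s' 3 = label_second S l (arrs s 2) (arrs s 3)"
  shows "open_ends n s' < open_ends n s"
proof -
  let ?A = "\<lambda>s. {g. g < n \<and> arrs s 2 g = 0}" and ?B = "\<lambda>s. {g. g < n \<and> arrs s 3 g = 0}"
  have sub: "?A s' \<subseteq> ?A s" "?B s' \<subseteq> ?B s"
    using s' assms(3) by (auto simp: label_first_def label_second_def split: if_splits)
  then have le: "card (?A s') \<le> card (?A s)" "card (?B s') \<le> card (?B s)"
    by (auto intro!: card_mono)
  show ?thesis
  proof (cases "arrs s 2 F = 0")
    case True
    then have "F \<in> ?A s - ?A s'" using s' assms by (auto simp: label_first_def)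
    then have "?A s' \<subset> ?A s" using sub by blast
    then have "card (?A s') < card (?A s)" by (intro psubset_card_mono) simp_all
    then show ?thesis using le unfolding open_ends_def by simp
  next
    case False
    then have "F \<in> ?B s - ?B s'" using s' assms by (auto simp: label_second_def)
    then have "?B s' \<subset> ?B s" using sub by blast
    then have "card (?B s') < card (?B s)" by (intro psubset_card_mono) simp_all
    then show ?thesis using le unfolding open_ends_def by simp
  qed
qed

lemma wp_next_star:
  assumes I: "root_inv n ad s" and F: "regs s 2 < n" "arrs s 5 (regs s 2) = regs s 2"
      "arrs s 2 (regs s 2) \<noteq> 0" "arrs s 3 (regs s 2) = 0"
    and t: "n \<le> t"
    and Q: "\<And>s'. root_inv n ad s' \<Longrightarrow> open_ends n s' < open_ends n s \<Longrightarrow> regs s' 8 = regs s 8 \<Longrightarrow>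
      (\<And>a. a \<noteq> 2 \<Longrightarrow> a \<noteq> 3 \<Longrightarrow> arrs s' a = arrs s a) \<Longrightarrow> Q s'"
  shows "wp next_star s t Q"
proof -
  let ?F = "regs s 2" and ?a = "arrs s 2" and ?b = "arrs s 3"
  let ?s = "s\<lparr>regs := (regs s)(16 := Suc (regs s 16), 6 := ?a ?F)\<rparr>"
  let ?C = "\<lambda>g. g = ?F \<or> ad ?F g \<and> ?a g \<noteq> ?a ?F \<and> ?b g \<noteq> ?a ?F"
  let ?S = "{g. g < n \<and> arrs s 5 g = g \<and> ?C g}"
  have n: "regs s 0 = n" and A: "\<And>e x. e < n \<Longrightarrow> x < n \<Longrightarrow> arrs s 0 (e * n + x) = of_bool (ad e x)"
    and pr: "partial_root {g. g < n \<and> arrs s 5 g = g} ad (regs s 16) ?a ?b"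
    using I unfolding root_inv_def adjacency_state_def by auto
  have "partial_root {g. g < n \<and> arrs s 5 g = g} ad (Suc (regs s 16))
      (label_first ?S (Suc (regs s 16)) ?a) (label_second ?S (Suc (regs s 16)) ?a ?b)"
    by (rule partial_root_extend[OF pr, of ?F]) (use F in auto)
  then have fin: "Q s'" if "arrs s' 2 = label_first ?S (Suc (regs s 16)) ?a"
      "arrs s' 3 = label_second ?S (Suc (regs s 16)) ?a ?b" "regs s' 0 = n" "regs s' 16 = Suc (regs s 16)"
      "regs s' 8 = regs s 8" "\<And>a. a \<noteq> 2 \<Longrightarrow> a \<noteq> 3 \<Longrightarrow> arrs s' a = arrs s a" for s'
    using that F A open_ends_label[of ?F n ?S "Suc (regs s 16)" s s']
    by (intro Q) (auto simp: root_inv_def adjacency_state_def)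
  have "wp (label_star (bexp.Not (And (bexp.Not (Equal (Var 7) (Var 2)))
       (bexp.Not (And (adjb 2 7) (And (bexp.Not (Equal (Read 2 (Var 7)) (Var 6)))
          (bexp.Not (Equal (Read 3 (Var 7)) (Var 6)))))))))  ?s t Q"
  proof (rule wp_label_star[where C = ?C], goal_cases)
    case (2 s' g)
    then show ?case using A[of ?F g] F n by auto
  next
    case (4 s')
    then show ?case using n by (intro fin) auto
  qed (use n t in auto)
  then show ?thesis unfolding next_star_def by simp
qed

lemma wp_first_star:
  assumes I: "root_inv n ad s" and F: "regs s 2 < n" "arrs s 5 (regs s 2) = regs s 2" "arrs s 2 (regs s 2) = 0"
    and sym: "\<And>e f. ad e f \<Longrightarrow> ad f e" and irr: "\<And>e. \<not> ad e e"
    and full: "\<And>g. g < n \<Longrightarrow> arrs s 5 g = g \<Longrightarrow> arrs s 2 g \<noteq> 0 \<Longrightarrow> arrs s 3 g \<noteq> 0"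
    and t: "4 * n \<le> t"
    and Q: "\<And>s'. root_inv n ad s' \<Longrightarrow> open_ends n s' < open_ends n s \<Longrightarrow> regs s' 8 = regs s 8 \<Longrightarrow>
      (\<And>a. a \<noteq> 2 \<Longrightarrow> a \<noteq> 3 \<Longrightarrow> arrs s' a = arrs s a) \<Longrightarrow> Q s'"
  shows "wp first_star s t Q"
proof -
  let ?F = "regs s 2" and ?a = "arrs s 2" and ?b = "arrs s 3" and ?R = "{g. g < n \<and> arrs s 5 g = g}"
  let ?L = "Suc (regs s 16)"
  have n: "regs s 0 = n" and A: "\<And>e x. e < n \<Longrightarrow> x < n \<Longrightarrow> arrs s 0 (e * n + x) = of_bool (ad e x)"
    and pr: "partial_root ?R ad (regs s 16) ?a ?b"
    using I unfolding root_inv_def adjacency_state_def by auto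
  define C where "C P Q g \<longleftrightarrow> cadj ad ?F g \<and> cadj ad P g \<and>
      (if Q \<in> ?R \<and> odd_triangle ?R ad ?F P Q then cadj ad Q g else g \<noteq> Q)" for P Q g
  define S where "S P Q = {g. g < n \<and> arrs s 5 g = g \<and> C P Q g}" for P Q
  define okP where "okP P \<longleftrightarrow> P \<in> ?R \<and> ad ?F P \<or> P = ?F \<and> (\<forall>g\<in>?R. \<not> ad ?F g)" for P
  define okQ where "okQ P Q \<longleftrightarrow> Q \<in> ?R \<and> ad ?F Q \<and> ad P Q \<or> Q \<notin> ?R \<and> (\<forall>g\<in>?R. \<not> (ad ?F g \<and> ad P g))" for P Q
  have FR: "?F \<in> ?R" using F by simp
  have fin: "Q s'" if ok: "okP p" "okQ p q" and s': "arrs s' 2 = label_first (S p q) ?L ?a"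
      "arrs s' 3 = label_second (S p q) ?L ?a ?b" "regs s' 0 = n" "regs s' 16 = ?L"
      "regs s' 8 = regs s 8" "\<And>a. a \<noteq> 2 \<Longrightarrow> a \<noteq> 3 \<Longrightarrow> arrs s' a = arrs s a" for p q s'
  proof -
    have FS: "?F \<in> S p q"
      unfolding S_def C_def using F ok sym irr unfolding okP_def okQ_def cadj_def by auto
    have "partial_root ?R ad ?L (label_first (S p q) ?L ?a) (label_second (S p q) ?L ?a ?b)"
      by (rule partial_root_start[OF pr FR F(3)]) (use full ok in \<open>auto simp: S_def C_def okP_def okQ_def\<close>)
    then show ?thesis
      using s' F A open_ends_label[OF F(1) FS, of ?L s s']
      by (intro Q) (auto simp: root_inv_def adjacency_state_def)
  qed
  let ?label = "com.If (Less (Var 5) (Var 0)) (label_star (And (cadjb 2 7) (And (cadjb 3 7) (cadjb 4 7))))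
       (label_star (And (cadjb 2 7) (And (cadjb 3 7) (bexp.Not (Equal (Var 7) (Var 4))))))"
  have p_lt: "p < n" if "okP p" for p using that F unfolding okP_def by auto
  have label: "wp ?label (s\<lparr>regs := r\<rparr>) n Q"
    if ok: "okP (r 3)" "okQ (r 3) (r 4)" and r: "r 0 = n" "r 2 = ?F" "r 16 = ?L" "r 8 = regs s 8"
      and odd: "r 5 < n \<longleftrightarrow> r 4 \<in> ?R \<and> odd_triangle ?R ad ?F (r 3) (r 4)" for r
  proof (cases "r 5 < n")
    case True
    then have q: "r 4 < n" and od: "r 4 \<in> ?R \<and> odd_triangle ?R ad ?F (r 3) (r 4)" using odd by auto
    have "wp (label_star (And (cadjb 2 7) (And (cadjb 3 7) (cadjb 4 7)))) (s\<lparr>regs := r\<rparr>) n Q"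
    proof (rule wp_label_star[where C = "C (r 3) (r 4)"], goal_cases)
      case (2 s' g)
      then show ?case using A[of ?F g] A[of "r 3" g] A[of "r 4" g] F r q p_lt[OF ok(1)] od
        by (auto simp: C_def cadj_def)
    next
      case (4 s')
      then show ?case using r by (intro fin[OF ok]) (auto simp: S_def)
    qed (use r in auto)
    then show ?thesis using True r by simp
  next
    case False
    have "wp (label_star (And (cadjb 2 7) (And (cadjb 3 7) (bexp.Not (Equal (Var 7) (Var 4)))))) (s\<lparr>regs := r\<rparr>) n Q"
    proof (rule wp_label_star[where C = "C (r 3) (r 4)"], goal_cases)
      case (2 s' g)
      then show ?case using A[of ?F g] A[of "r 3" g] F r p_lt[OF ok(1)] odd False
        by (auto simp: C_def cadj_def)
    next
      case (4 s')
      then show ?case using r by (intro fin[OF ok]) (auto simp: S_def)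
    qed (use r in auto)
    then show ?thesis using False r by simp
  qed
  let ?u = "And (Less (Var 4) (Var 0)) (And (is_rep 5)
       (bexp.Not (And (bexp.Not (Equal (Plus (Plus (adjacency 2 5) (adjacency 3 5)) (adjacency 4 5)) (Const 1)))
          (bexp.Not (Equal (Plus (Plus (adjacency 2 5) (adjacency 3 5)) (adjacency 4 5)) (Const 3))))))"
  have searchU: "wp (search 5 0 0 ?u ;; ?label) (s\<lparr>regs := r\<rparr>) (2 * n) Q"
    if ok: "okP (r 3)" "okQ (r 3) (r 4)" and r: "r 0 = n" "r 2 = ?F" "r 16 = ?L" "r 8 = regs s 8"
      and q: "r 4 < n \<longleftrightarrow> r 4 \<in> ?R" for r
  proof -
    have u: "bval ?u (s\<lparr>regs := r(5 := m)\<rparr>) \<longleftrightarrow> r 4 \<in> ?R \<and> m \<in> ?R \<and>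
        odd (of_bool (ad ?F m) + of_bool (ad (r 3) m) + of_bool (ad (r 4) m) :: nat)" if m: "m < n" for m
    proof (cases "r 4 < n")
      case True
      let ?x = "of_bool (ad ?F m) + of_bool (ad (r 3) m) + of_bool (ad (r 4) m) :: nat"
      have "bval ?u (s\<lparr>regs := r(5 := m)\<rparr>) \<longleftrightarrow> arrs s 5 m = m \<and> (?x = 1 \<or> ?x = 3)"
        using r True by (simp add: A[OF F(1) m] A[OF p_lt[OF ok(1)] m] A[OF True m] split del: split_of_bool)
      \<comment> \<open>The machine has no parity test; a sum of three bits is odd iff it is 1 or
        3.\<close>
      moreover have "odd ?x \<longleftrightarrow> ?x = 1 \<or> ?x = 3"
        by (cases "ad ?F m"; cases "ad (r 3) m"; cases "ad (r 4) m") simp_all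
      moreover have "r 4 \<in> ?R" using q True by blast
      moreover have "m \<in> ?R \<longleftrightarrow> arrs s 5 m = m" using m by simp
      ultimately show ?thesis by blast
    next
      case False
      then have "r 4 \<notin> ?R" using q by blast
      then show ?thesis using False r by simp
    qed
    show ?thesis
    proof (rule wp_Seq[where ?t1.0 = n and ?t2.0 = n], rule wp_search, goal_cases)
      case (3 m)
      then have "m < n" "bval ?u (s\<lparr>regs := r(5 := m)\<rparr>)" using r by auto
      then have "r 4 \<in> ?R \<and> odd_triangle ?R ad ?F (r 3) (r 4)"
        using u[of m] unfolding odd_triangle_def by blast
      then show ?case using label[of "r(5 := m)"] ok r \<open>m < n\<close> by simp
    next
      case (4 m)
      have "\<not> (r 4 \<in> ?R \<and> odd_triangle ?R ad ?F (r 3) (r 4))"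
      proof
        assume "r 4 \<in> ?R \<and> odd_triangle ?R ad ?F (r 3) (r 4)"
        then obtain c where c: "c \<in> ?R"
          "odd (of_bool (ad ?F c) + of_bool (ad (r 3) c) + of_bool (ad (r 4) c) :: nat)" "r 4 \<in> ?R"
          unfolding odd_triangle_def by blast
        then have "bval ?u (s\<lparr>regs := r(5 := c)\<rparr>)" using u[of c] by blast
        then show False using 4(2)[of c] c r by auto
      qed
      then show ?case using label[of "r(5 := m)"] ok r 4(1) by simp
    qed (use r in auto)
  qed
  let ?q = "And (is_rep 4) (And (adjb 2 4) (adjb 3 4))"
  have searchQ: "wp (search 4 0 0 ?q ;; search 5 0 0 ?u ;; ?label) (s\<lparr>regs := r\<rparr>) (3 * n) Q"
    if ok: "okP (r 3)" and r: "r 0 = n" "r 2 = ?F" "r 16 = ?L" "r 8 = regs s 8" for r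
  proof -
    have q: "bval ?q (s\<lparr>regs := r(4 := m)\<rparr>) \<longleftrightarrow> m \<in> ?R \<and> ad ?F m \<and> ad (r 3) m" if m: "m < n" for m
      using A[OF F(1) m] A[OF p_lt[OF ok(1)] m] r m by auto
    show ?thesis
    proof (rule wp_Seq[where ?t1.0 = n and ?t2.0 = "2 * n"], rule wp_search, goal_cases)
      case (3 m)
      then have "m < n" "bval ?q (s\<lparr>regs := r(4 := m)\<rparr>)" using r by auto
      then have "m \<in> ?R" "okQ (r 3) m" using q[of m] unfolding okQ_def by auto
      then show ?case using searchU[of "r(4 := m)"] ok r by simp
    next
      case (4 m)
      have "\<not> (ad ?F c \<and> ad (r 3) c)" if "c \<in> ?R" for c
        using 4(2)[of c] q[of c] that r by auto
      then have "okQ (r 3) m" "m \<notin> ?R" using 4(1) r unfolding okQ_def by auto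
      then show ?case using searchU[of "r(4 := m)"] ok r 4(1) by simp
    qed (use r in auto)
  qed
  let ?p = "And (is_rep 3) (adjb 2 3)"
  let ?s = "set_reg 16 ?L s"
  have p: "bval ?p (set_reg 3 m ?s) \<longleftrightarrow> m \<in> ?R \<and> ad ?F m" if m: "m < n" for m
    using A[OF F(1) m] n m by auto
  have "wp (search 3 0 0 ?p ;; com.If (Less (Var 3) (Var 0)) Skip (Assign 3 (Var 2)) ;;
      search 4 0 0 ?q ;; search 5 0 0 ?u ;; ?label) ?s t Q"
  proof (rule wp_Seq[where ?t1.0 = n and ?t2.0 = "3 * n"], rule wp_search, goal_cases)
    case (3 m)
    then have m: "m < n" using n by auto
    then have "okP m" using p[OF m] 3 unfolding okP_def by blast
    then show ?case using searchQ[of "(regs s)(16 := ?L, 3 := m)"] n m by simp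
  next
    case (4 m)
    have "\<not> ad ?F c" if "c \<in> ?R" for c
      using 4(2)[of c] p[of c] that n by auto
    then have "okP ?F" unfolding okP_def by auto
    moreover have "\<not> m < n" using 4(1) n by auto
    ultimately show ?case using searchQ[of "(regs s)(16 := ?L, 3 := ?F)"] n by simp
  qed (use n t in auto)
  then show ?thesis unfolding first_star_def by simp
qed

lemma wp_root_step:
  assumes I: "root_inv n ad s" and sym: "\<And>e f. ad e f \<Longrightarrow> ad f e" and irr: "\<And>e. \<not> ad e e"
    and t: "6 * n \<le> t"
    and Q1: "\<And>s'. root_inv n ad s' \<Longrightarrow> open_ends n s' < open_ends n s \<Longrightarrow> regs s' 8 = regs s 8 \<Longrightarrow>
      (\<And>a. a \<noteq> 2 \<Longrightarrow> a \<noteq> 3 \<Longrightarrow> arrs s' a = arrs s a) \<Longrightarrow> Q s'"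
    and Q2: "\<And>s'. root_inv n ad s' \<Longrightarrow> arrs s' = arrs s \<Longrightarrow> regs s' 8 = 0 \<Longrightarrow>
      (\<And>g. g < n \<Longrightarrow> arrs s 5 g = g \<Longrightarrow> arrs s 2 g \<noteq> 0 \<and> arrs s 3 g \<noteq> 0) \<Longrightarrow> Q s'"
  shows "wp root_step s t Q"
proof -
  have n: "regs s 0 = n" using I unfolding root_inv_def adjacency_state_def by auto
  have I': "root_inv n ad (s\<lparr>regs := r\<rparr>)" if "r 0 = n" "r 16 = regs s 16" for r
    using I that unfolding root_inv_def adjacency_state_def by simp
  have oe: "open_ends n (s\<lparr>regs := r\<rparr>) = open_ends n s" for r by (simp add: open_ends_def)
  show ?thesis
    unfolding root_step_def
  proof (rule wp_Seq[where ?t1.0 = n and ?t2.0 = "5 * n"], rule wp_search, goal_cases)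
    case (3 m)
    then have "wp next_star (set_reg 2 m s) (5 * n) Q"
      using n by (intro wp_next_star[OF I'] Q1) (auto simp: oe)
    then show ?case using 3 n by simp
  next
    case (4 m)
    have full: "arrs s 3 g \<noteq> 0" if "g < n" "arrs s 5 g = g" "arrs s 2 g \<noteq> 0" for g
      using 4(2)[of g] that n by auto
    have "wp (search 2 0 0 (And (is_rep 2) (Equal (Read 2 (Var 2)) (Const 0))) ;;
       com.If (Less (Var 2) (Var 0)) first_star (Assign 8 (Const 0))) (set_reg 2 m s) (5 * n) Q"
    proof (rule wp_Seq[where ?t1.0 = n and ?t2.0 = "4 * n"], rule wp_search, goal_cases)
      case (3 k)
      then have "wp first_star (set_reg 2 k s) (4 * n) Q"
        using n full sym irr by (intro wp_first_star[OF I'] Q1) (auto simp: oe)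
      then show ?case using 3 n by simp
    next
      case (4 k)
      have "arrs s 2 g \<noteq> 0" if "g < n" "arrs s 5 g = g" for g
        using 4(2)[of g] that n by auto
      then have "Q (s\<lparr>regs := (regs s)(2 := k, 8 := 0)\<rparr>)"
        using full n by (intro Q2 I') auto
      then show ?case using 4(1) by simp
    qed (use n in auto)
    then show ?case using 4(1) by simp
  qed (use n t in auto)
qed

text \<open>At most \<open>2 * n\<close> rounds fill a slot, and one more finds nothing left to do.
  A round consists of at most two searches and \<open>first_star\<close> with its
  \<open>4 * n\<close> iterations.\<close>

lemma wp_root_phase:
  assumes ad: "adjacency_state n ad s" and z: "arrs s 2 = (\<lambda>_. 0)" "arrs s 3 = (\<lambda>_. 0)"
    and root: "root_on {g. g < n \<and> arrs s 5 g = g} ad r"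
    and sym: "\<And>e f. ad e f \<Longrightarrow> ad f e" and irr: "\<And>e. \<not> ad e e"
    and t: "(2 * n + 1) * (1 + 6 * n) \<le> t"
    and Q: "\<And>s'. root_inv n ad s' \<Longrightarrow> (\<And>a. a \<noteq> 2 \<Longrightarrow> a \<noteq> 3 \<Longrightarrow> arrs s' a = arrs s a) \<Longrightarrow>
      (\<And>g. g < n \<Longrightarrow> arrs s 5 g = g \<Longrightarrow> arrs s' 2 g \<noteq> 0 \<and> arrs s' 3 g \<noteq> 0) \<Longrightarrow> Q s'"
  shows "wp root_phase s t Q"
proof -
  let ?s = "s\<lparr>regs := (regs s)(8 := 1, 16 := 0)\<rparr>"
  \<comment> \<open>No vertex is named yet, so any naming function fits.\<close>
  have "labelled {g. g < n \<and> arrs s 5 g = g} r id 0 (\<lambda>_. 0) (\<lambda>_. 0)" by (simp add: labelled_def)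
  then have I0: "root_inv n ad ?s"
    using ad root z unfolding root_inv_def adjacency_state_def partial_root_def by auto
  have "open_ends n ?s \<le> n + n"
  proof -
    have "card {g. g < n \<and> p g} \<le> n" for p
      using card_mono[of "{..<n}" "{g. g < n \<and> p g}"] by auto
    then show ?thesis unfolding open_ends_def by (intro add_mono)
  qed
  then have "Suc (open_ends n ?s) * (1 + 6 * n) \<le> (2 * n + 1) * (1 + 6 * n)"
    by (intro mult_le_mono1) simp
  then have m0: "Suc (open_ends n ?s) * (1 + 6 * n) \<le> t" using t by (rule le_trans)
  have "wp (While (bexp.Not (Equal (Var 8) (Const 0))) root_step) ?s t Q"
  proof (rule wp_While[where u = "6 * n" and m = "\<lambda>s. if regs s 8 = 0 then 0 else Suc (open_ends n s)" and
        I = "\<lambda>s'. root_inv n ad s' \<and> (\<forall>a. a \<noteq> 2 \<longrightarrow> a \<noteq> 3 \<longrightarrow> arrs s' a = arrs s a) \<and>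
          (regs s' 8 = 0 \<longrightarrow> (\<forall>g. g < n \<longrightarrow> arrs s 5 g = g \<longrightarrow> arrs s' 2 g \<noteq> 0 \<and> arrs s' 3 g \<noteq> 0))"], goal_cases)
    case (2 s')
    then have s': "root_inv n ad s'" "\<And>a. a \<noteq> 2 \<Longrightarrow> a \<noteq> 3 \<Longrightarrow> arrs s' a = arrs s a" "regs s' 8 \<noteq> 0" by auto
    show ?case
    proof (rule wp_root_step[OF s'(1)], goal_cases)
      case (1 e f)
      then show ?case by (rule sym)
    next
      case (2 e)
      show ?case by (rule irr)
    next
      case 3
      show ?case by (rule order_refl)
    next
      case (4 s'')
      then show ?case using s'(2,3) by simp
    next
      case (5 s'')
      then show ?case using s'(2,3) by simp
    qed
  next
    case (3 s')
    then show ?case by (intro Q) auto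
  next
    case 1
    show ?case using I0 by simp
  next
    case 4
    show ?case using m0 by simp
  qed
  then show ?thesis unfolding root_phase_def by simp
qed

text \<open>Copying in place is safe: the cells of a representative are overwritten with their own
  contents, so later reads still find the original labels.\<close>

lemma wp_copy_phase:
  assumes n: "regs s 0 = n" and rep: "\<And>g. g < n \<Longrightarrow> arrs s 5 (arrs s 5 g) = arrs s 5 g"
    and t: "n \<le> t"
    and Q: "\<And>s'. regs s' 0 = n \<Longrightarrow> (\<And>a. a \<noteq> 2 \<Longrightarrow> a \<noteq> 3 \<Longrightarrow> arrs s' a = arrs s a) \<Longrightarrow>
      (\<And>g. g < n \<Longrightarrow> arrs s' 2 g = arrs s 2 (arrs s 5 g) \<and> arrs s' 3 g = arrs s 3 (arrs s 5 g)) \<Longrightarrow> Q s'"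
  shows "wp copy_phase s t Q"
  unfolding copy_phase_def
proof (rule wp_For[where I = "\<lambda>k s'. regs s' 0 = n \<and> (\<forall>a. a \<noteq> 2 \<longrightarrow> a \<noteq> 3 \<longrightarrow> arrs s' a = arrs s a) \<and>
      (\<forall>g. arrs s' 2 g = arrs s 2 (if g < k then arrs s 5 g else g) \<and>
        arrs s' 3 g = arrs s 3 (if g < k then arrs s 5 g else g))" and N = n and u = 0], goal_cases)
  case (4 k s')
  then have eq: "regs s' 0 = n" "\<And>a. a \<noteq> 2 \<Longrightarrow> a \<noteq> 3 \<Longrightarrow> arrs s' a = arrs s a"
    "\<And>g. arrs s' 2 g = arrs s 2 (if g < k then arrs s 5 g else g)"
    "\<And>g. arrs s' 3 g = arrs s 3 (if g < k then arrs s 5 g else g)" by auto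
  have "arrs s' 2 (arrs s 5 k) = arrs s 2 (arrs s 5 k)" "arrs s' 3 (arrs s 5 k) = arrs s 3 (arrs s 5 k)"
    using eq(3,4) rep[OF 4(4)] by simp_all
  then show ?case using 4(2,3) eq by (simp add: less_Suc_eq)
next
  case (5 s')
  then show ?case by (intro Q) simp_all
qed (use n t in simp_all)

section \<open>The complete program and its running time\<close>

definition edge_colour_program :: com where
  "edge_colour_program = twin_phase ;; root_phase ;; copy_phase ;; colour_edges"

definition ticks :: "nat \<Rightarrow> nat" where
  "ticks n = n * (1 + n) + ((2 * n + 1) * (1 + 6 * n) + (n + (n + n * (17 * n + 18))))"

lemma wp_edge_colour_program:
  assumes G: "line_graph G" "verts G = {..<n}"
  shows "wp edge_colour_program (input_state n G) (ticks n)
    (\<lambda>s. proper_colouring G (output_colouring s) \<and> card (output_colouring s ` verts G) \<le> gamma_l G)"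
proof -
  let ?s = "input_state n G"
  obtain r :: "nat \<Rightarrow> nat set" where r': "\<forall>e<n. card (r e) = 2"
    "\<forall>e<n. \<forall>f<n. adj G e f \<longleftrightarrow> e \<noteq> f \<and> r e \<inter> r f \<noteq> {}"
    using line_graph_ends[OF G] by (elim exE conjE)
  have r: "card (r e) = 2" "f < n \<Longrightarrow> adj G e f \<longleftrightarrow> e \<noteq> f \<and> r e \<inter> r f \<noteq> {}" if "e < n" for e f
    using r'(1)[rule_format, OF that] r'(2)[rule_format, OF that] by simp_all
  have simple: "adj G u v \<Longrightarrow> adj G v u" "\<not> adj G u u" for u v
    using G(1) unfolding line_graph_def simple_graph_def by blast+
  have ad: "adjacency_state n (adj G) ?s"
    unfolding adjacency_state_def
  proof (intro conjI allI impI)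
    fix e x assume ex: "e < n" "x < n"
    have "e * n + x < Suc e * n" using ex by simp
    also have "\<dots> \<le> n * n" using ex by (intro mult_le_mono1) simp
    finally show "arrs ?s 0 (e * n + x) = of_bool (adj G e x)"
      using ex by (simp add: input_state_def)
  qed (simp add: input_state_def)
  show ?thesis
    unfolding edge_colour_program_def ticks_def
  proof (rule wp_Seq[OF wp_twin_phase[OF ad _ order_refl] order_refl], goal_cases)
    case (2 s1)
    have z1: "arrs s1 a i = 0" if "a \<notin> {0, 5, 6, 7}" for a i
      using 2(3)[of a] that by (simp add: input_state_def)
    show ?case
    proof (rule wp_Seq[where ?t1.0 = "(2 * n + 1) * (1 + 6 * n)" and ?t2.0 = "n + (n + n * (17 * n + 18))"], rule wp_root_phase[OF 2(1), where r = r], goal_cases)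
      case 1
      show ?case using z1[of 2] by (intro ext) simp
    next
      case 2
      show ?case using z1[of 3] by (intro ext) simp
    next
      case 3
      show ?case by (rule twin_rep_root[OF \<open>twin_rep n (adj G) (arrs s1 5)\<close>]) (use r in blast)+
    next
      case (4 e f)
      then show ?case by (rule simple)
    next
      case (5 e)
      show ?case by (rule simple)
    next
      case 6
      show ?case by (rule order_refl)
    next
      case 8
      show ?case by (rule order_refl)
    next
      case (7 s2)
      note 3 = 7
      have rep: "arrs s2 5 = arrs s1 5" using 3(2) by simp
      have tr: "twin_rep n (adj G) (arrs s2 5)" using 2(2) rep by simp
      have n2: "regs s2 0 = n" using 3(1) unfolding root_inv_def adjacency_state_def by simp
      have pr: "partial_root {e. e < n \<and> arrs s2 5 e = e} (adj G) (regs s2 16) (arrs s2 2) (arrs s2 3)"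
        using 3(1) unfolding root_inv_def by simp
      show ?case
      proof (rule wp_Seq[OF wp_copy_phase[OF n2 _ order_refl] order_refl], goal_cases)
        case (1 g)
        then show ?case using tr unfolding twin_rep_def by simp
      next
        case (2 s3)
        define En where "En e = {arrs s3 2 e, arrs s3 3 e}" for e
        have rl: "arrs s2 5 e < n" "arrs s2 5 (arrs s2 5 e) = arrs s2 5 e" if "e < n" for e
          using tr that unfolding twin_rep_def by auto
        have nz: "arrs s2 2 g \<noteq> 0 \<and> arrs s2 3 g \<noteq> 0" if "g < n" "arrs s2 5 g = g" for g
          using 3(3)[of g] that rep by simp
        have En: "En e = {arrs s2 2 (arrs s2 5 e), arrs s2 3 (arrs s2 5 e)}" if "e < n" for e
          using 2(3)[OF that] unfolding En_def by simp
        have adE: "adj G e f \<longleftrightarrow> e \<noteq> f \<and> En e \<inter> En f \<noteq> {}" if "e < n" "f < n" for e f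
        proof -
          have "adj G e f \<longleftrightarrow> e \<noteq> f \<and>
            {arrs s2 2 (arrs s2 5 e), arrs s2 3 (arrs s2 5 e)} \<inter> {arrs s2 2 (arrs s2 5 f), arrs s2 3 (arrs s2 5 f)} \<noteq> {}"
            by (rule twin_rep_ends[OF tr _ pr]) (use simple nz that in blast)+
          then show ?thesis unfolding En[OF that(1)] En[OF that(2)] .
        qed
        \<comment> \<open>From here on the root just found replaces the original multigraph;
          \<open>gamma_l G\<close> refers to the graph alone, so the same bounds hold.\<close>
        have "gamma_ends n En (gamma_l G)"
        proof (rule gamma_ends_line_graph[OF G(2)])
          fix e assume e: "e < n"
          have "arrs s2 2 (arrs s2 5 e) \<noteq> arrs s2 3 (arrs s2 5 e)"
            by (rule partial_root_complete(1)[OF pr, where f = "arrs s2 5 e"]) (use nz rl[OF e] in auto)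
          then show "card (En e) = 2" "0 \<notin> En e"
            using En[OF e] nz[of "arrs s2 5 e"] rl[OF e] by auto
        qed (use adE in auto)
        then interpret gamma_ends n En "gamma_l G" .
        show ?case
        proof (rule wp_colour_edges)
          show "arrs s3 1 i = 0" "arrs s3 4 i = 0" for i
            using 2(2)[of 1] 2(2)[of 4] 3(2)[of 1] 3(2)[of 4] z1[of 1 i] z1[of 4 i] by auto
          fix s' assume "coloured_upto n s'"
          then have c: "pcol (regs s' 16) (colouring s')" "\<And>e. e < n \<Longrightarrow> colouring s' e \<noteq> 0"
            "regs s' 16 \<le> Suc (gamma_l G)"
            unfolding coloured_upto_def by auto
          show "proper_colouring G (output_colouring s') \<and> card (output_colouring s' ` verts G) \<le> gamma_l G"
            unfolding output_colouring_def
          proof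
            show "proper_colouring G (colouring s')"
              by (rule pcol_proper_colouring(1)[OF c(1) _ G(2)]) (use c(2) adE in blast)+
            have "card (colouring s' ` verts G) \<le> regs s' 16 - 1"
              by (rule pcol_proper_colouring(2)[OF c(1) _ G(2)]) (use c(2) adE in blast)+
            then show "card (colouring s' ` verts G) \<le> gamma_l G" using c(3) by simp
          qed
        qed (use 2 En_def in auto)
      qed
    qed
  qed (auto simp: input_state_def)
qed

lemma tame_edge_colour_program: "tame edge_colour_program"
  by (simp add: edge_colour_program_def twin_phase_def root_phase_def copy_phase_def colour_edges_def
      root_step_def next_star_def first_star_def label_star_def For_def search_def insert_edge_def
      fan_search_def fan_second_def fan_third_def attempt_def both_fans_def
      opposite_fan_def new_colour_def kempe_def finish_def shift_spoke_def
      diamond_def set_colour_def unset_colour_def other_endpoint_def)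

lemma polynomial_growth_ticks: "polynomial_growth ticks"
  unfolding ticks_def[abs_def] by (intro polynomial_growth_intros)

theorem theorem12:
  "\<exists>(P :: com) (k :: nat) (T :: nat \<Rightarrow> nat).
     (\<lambda>n. real (T n)) \<in> O(\<lambda>n. real n ^ 2) \<and>
     (\<forall>(n :: nat) (G :: nat graph). line_graph G \<and> verts G = {..<n} \<longrightarrow>
        (\<exists>t s. exec ((n + 2) ^ k) P (input_state n G) t s \<and> t \<le> T n \<and>
           proper_colouring G (output_colouring s) \<and>
           card (output_colouring s ` verts G) \<le> gamma_l G))"
proof -
  let ?P = edge_colour_program
  obtain k where k: "\<forall>n G. line_graph G \<and> verts G = {..<n} \<longrightarrow>
      (\<exists>t s. exec ((n + 2) ^ k) ?P (input_state n G) t s \<and> t \<le> com_cost ?P * (1 + ticks n) \<and>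
        proper_colouring G (output_colouring s) \<and> card (output_colouring s ` verts G) \<le> gamma_l G)"
    using wp_exec[OF tame_edge_colour_program polynomial_growth_ticks,
        of "\<lambda>n G. line_graph G \<and> verts G = {..<n}"
           "\<lambda>n G s. proper_colouring G (output_colouring s) \<and> card (output_colouring s ` verts G) \<le> gamma_l G"]
      wp_edge_colour_program by blast
  have "(\<lambda>n. real (com_cost ?P * (1 + ticks n))) \<in> O(\<lambda>n. real n ^ 2)"
  \<comment> \<open>The coefficients of \<open>1 + ticks n\<close> add up to 30 + 29 + 2 = 61, and
    each of its monomials is at most \<open>n ^ 2\<close> for positive \<open>n\<close>.\<close>
  proof (rule bigoI[where c = "real (com_cost ?P) * 62"], rule eventually_sequentiallyI[of 1])
    fix n :: nat assume n: "1 \<le> n"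
    have "1 + ticks n = 30 * (n * n) + 29 * n + 2"
      by (simp add: ticks_def algebra_simps)
    moreover have "n \<le> n * n" using n by simp
    ultimately have "1 + ticks n \<le> 62 * n ^ 2"
      using n unfolding power2_eq_square by linarith
    then have "com_cost ?P * (1 + ticks n) \<le> com_cost ?P * (62 * n ^ 2)" by (rule mult_le_mono2)
    then have "real (com_cost ?P * (1 + ticks n)) \<le> real (com_cost ?P * (62 * n ^ 2))" by (rule of_nat_mono)
    then show "norm (real (com_cost ?P * (1 + ticks n))) \<le> real (com_cost ?P) * 62 * norm (real n ^ 2)"
      by (simp add: mult.assoc)
  qed
  then show ?thesis using k by (intro exI[of _ ?P] exI[of _ k] exI[of _ "\<lambda>n. com_cost ?P * (1 + ticks n)"] conjI)
qed

end
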